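(* Consider the well-posed port-Hamiltonian system with constant uniform wave speed $$\frac{\partial}{\partial t}z(\zeta,t)=-\lambda_0\frac{\partial}{\partial\zeta}z(\zeta,t),\quad z(\zeta,0)=z_0(\zeta),\quad \begin{bmatrix}0\\ u(t)\end{bmatrix}=-\lambda_0Kz(0,t)-\lambda_0Lz(1,t),\quad y(t)=-\lambda_0K_yz(0,t)-\lambda_0L_yz(1,t),$$ for $\zeta\in(0,1)$, $t\ge0$, as described in the context. Let $z_0\in L^2(0,1;\mathbb{C}^n)$. Then the following are equivalent. 1. There exists an input $u\in L^2_{loc}(0,\infty;\mathbb{C}^p)$ such that the output $y$ of the system with initial condition $z(\cdot,0)=z_0$ is identically zero. 2. $z_0\in L^2(0,1;V_d^* )$, where $V_d^*\subset\mathbb{C}^n$ is the largest output nulling subspace of the discrete-time system $\Sigma(A_d,B_d,C_d,D_d)$ with state space $\mathbb{C}^n$ given by $$w(n+1)=A_dw(n)+B_du(n),\qquad y(n)=C_dw(n)+D_du(n).$$ In particular, the largest output nulling subspace $V^*$ of the port-Hamiltonian system is given by $V^*=L^2(0,1;V_d^* )$.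
   Context: Here $\lambda_0>0$ is a constant, $K,L\in\mathbb{C}^{n\times n}$, $K_y,L_y\in\mathbb{C}^{m\times n}$, the input is $u(t)\in\mathbb{C}^p$ and the output is $y(t)\in\mathbb{C}^m$ (the zero in the boundary condition has $n-p$ components). The matrix $K$ is assumed invertible, which is equivalent to well-posedness of the system on $X=L^2(0,1;\mathbb{C}^n)$: for every $z_0\in X$ and $u\in L^2_{loc}(0,\infty;\mathbb{C}^p)$ there is a unique mild solution $z\in C([0,\infty);X)$ and the output $y$ is well-defined in $L^2_{loc}(0,\infty;\mathbb{C}^m)$. Mild solution means that, for all $t\ge0$, $Z(t)=\int_0^tz(\cdot,\tau)\,d\tau\in H^1(0,1;\mathbb{C}^n)$, $z(\cdot,t)-z_0=-\lambda_0\,\partial_\zeta Z(t)$, and the boundary condition holds with $z(\cdot,t),u(t)$ replaced by $Z(t),\int_0^tu$; the output equation is understood in the same integrated sense. The largest output nulling subspace $V^*$ of the port-Hamiltonian system is the set of $z_0\in X$ for which there exists $u\in L^2_{loc}(0,\infty;\mathbb{C}^p)$ such that the mild solution satisfies $y=0$. The matrices of the discrete-time system are $$A_d=-K^{-1}L,\qquad B_d=-\lambda_0^{-1}K^{-1}\begin{bmatrix}0\\ I\end{bmatrix},\qquad C_d=-\lambda_0K_yA_d-\lambda_0L_y,\qquad D_d=-\lambda_0K_yB_d,$$ where $I$ is the $p\times p$ identity and $0$ is the $(n-p)\times p$ zero matrix. The largest output nulling subspace $V_d^*$ of $\Sigma(A_d,B_d,C_d,D_d)$ is the set of initial states $w(0)\in\mathbb{C}^n$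 for which there is an input sequence in $\mathbb{C}^p$ such that the output sequence vanishes for all times $0,1,2,\dots$. In the discrete-time system the letter $n$ in $w(n),u(n),y(n)$ is the discrete time, distinct from the dimension $n$. *)

theory Defs
  imports "HOL-Analysis.Analysis" "Jordan_Normal_Form.Gauss_Jordan_Elimination"
begin

hide_type (open) Finite_Cartesian_Product.vec
hide_const (open) Finite_Cartesian_Product.vec Finite_Cartesian_Product.mat Polynomial.content
no_notation vec_nth (infixl \<open>$\<close> 90)

text \<open>
  Vectors and matrices of variable size are those of the AFP entry Jordan_Normal_Form. Elements of
  an L2-space are handled through representatives: functions \<open>real \<Rightarrow> complex vec\<close>, only
  their values on the domain matter, and a vector-valued function is measured and integrated
  componentwise.
\<close>

definition L2_on :: "real set \<Rightarrow> nat \<Rightarrow> (real \<Rightarrow> complex vec) \<Rightarrow> bool" where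
  "L2_on S n f \<longleftrightarrow>
     (\<forall>x\<in>S. f x \<in> carrier_vec n) \<and>
     (\<forall>i<n. set_borel_measurable lebesgue S (\<lambda>x. f x $ i) \<and>
            set_integrable lebesgue S (\<lambda>x. (cmod (f x $ i))\<^sup>2))"

text \<open>Square integrability up to the initial time, as is meant by local square integrability of
  inputs and outputs of well-posed systems.\<close>

definition L2_loc :: "nat \<Rightarrow> (real \<Rightarrow> complex vec) \<Rightarrow> bool" where
  "L2_loc n f \<longleftrightarrow> (\<forall>T>0. L2_on {0<..<T} n f)"

abbreviation state_space :: "nat \<Rightarrow> (real \<Rightarrow> complex vec) set" where
  "state_space n \<equiv> {f. L2_on {0<..<1} n f}"

definition state_norm :: "nat \<Rightarrow> (real \<Rightarrow> complex vec) \<Rightarrow> real" where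
  "state_norm n f = sqrt (\<Sum>i<n. LINT \<zeta>:{0<..<1}|lebesgue. (cmod (f \<zeta> $ i))\<^sup>2)"

text \<open>The space \<open>L2(0,1;V)\<close>.\<close>

definition L2_into :: "nat \<Rightarrow> complex vec set \<Rightarrow> (real \<Rightarrow> complex vec) set" where
  "L2_into n V = {f \<in> state_space n. AE \<zeta>\<in>{0<..<1} in lebesgue. f \<zeta> \<in> V}"

definition vec_integral :: "real set \<Rightarrow> nat \<Rightarrow> (real \<Rightarrow> complex vec) \<Rightarrow> complex vec" where
  "vec_integral S n f = vec n (\<lambda>i. LINT x:S|lebesgue. f x $ i)"

definition state_continuous :: "nat \<Rightarrow> (real \<Rightarrow> real \<Rightarrow> complex vec) \<Rightarrow> bool" where
  "state_continuous n z \<longleftrightarrow>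
     (\<forall>t\<ge>0. z t \<in> state_space n) \<and>
     (\<forall>s\<ge>0. ((\<lambda>t. state_norm n (\<lambda>\<zeta>. z t \<zeta> - z s \<zeta>)) \<longlongrightarrow> 0) (at s within {0..}))"

text \<open>\<open>I\<close> is the integral of the state-space valued function \<open>z\<close> over \<open>{a..b}\<close>. This is
  the library's \<^const>\<open>has_integral\<close> unfolded on a compact interval, with convergence of the Riemann
  sums in \<^const>\<open>state_norm\<close>; for continuous \<open>z\<close> it is the Riemann (equivalently, Bochner)
  integral.\<close>

definition state_has_integral ::
    "nat \<Rightarrow> (real \<Rightarrow> real \<Rightarrow> complex vec) \<Rightarrow> (real \<Rightarrow> complex vec) \<Rightarrow> real \<Rightarrow> real \<Rightarrow> bool" where
  "state_has_integral n z I a b \<longleftrightarrow>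
     I \<in> state_space n \<and>
     ((\<lambda>D. state_norm n (\<lambda>\<zeta>. vec n (\<lambda>i. \<Sum>(\<tau>, k)\<in>D. content k *\<^sub>R (z \<tau> \<zeta> $ i)) - I \<zeta>))
        \<longlongrightarrow> 0) (division_filter {a..b})"

text \<open>\<open>f\<close> is the absolutely continuous representative on \<open>{0..1}\<close> of an element of
  \<open>H1(0,1)\<close>, and \<open>g\<close> is its derivative in L2. Since \<open>f\<close> is a function on the closed
  interval, \<open>f 0\<close> and \<open>f 1\<close> are the boundary traces.\<close>

definition has_H1_derivative ::
    "nat \<Rightarrow> (real \<Rightarrow> complex vec) \<Rightarrow> (real \<Rightarrow> complex vec) \<Rightarrow> bool" where
  "has_H1_derivative n f g \<longleftrightarrow>
     f 0 \<in> carrier_vec n \<and> g \<in> state_space n \<and>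
     (\<forall>\<zeta>\<in>{0..1}. f \<zeta> = f 0 + vec_integral {0<..<\<zeta>} n g)"

text \<open>\<open>Z\<close> is the integral of \<open>z\<close> over \<open>{0..t}\<close>; it lies in \<open>H1(0,1)\<close> and
  \<open>dZ\<close> is its spatial derivative. On \<open>{0..1}\<close> the function \<open>Z\<close> is determined
  uniquely by \<open>z\<close> and \<open>t\<close>.\<close>

definition integrated_state ::
    "nat \<Rightarrow> (real \<Rightarrow> real \<Rightarrow> complex vec) \<Rightarrow> real \<Rightarrow> (real \<Rightarrow> complex vec) \<Rightarrow> (real \<Rightarrow> complex vec) \<Rightarrow> bool" where
  "integrated_state n z t Z dZ \<longleftrightarrow>
     state_has_integral n z Z 0 t \<and> has_H1_derivative n Z dZ"

text \<open>The time comes first in the argument order of the state trajectory: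
  \<open>z t \<zeta>\<close> stands for \<open>z(\<zeta>,t)\<close>.\<close>

definition mild_solution ::
    "real \<Rightarrow> nat \<Rightarrow> nat \<Rightarrow> complex mat \<Rightarrow> complex mat \<Rightarrow> (real \<Rightarrow> complex vec) \<Rightarrow> (real \<Rightarrow> complex vec)
      \<Rightarrow> (real \<Rightarrow> real \<Rightarrow> complex vec) \<Rightarrow> bool" where
  "mild_solution lam n p K L z0 u z \<longleftrightarrow>
     state_continuous n z \<and>
     (\<forall>t\<ge>0. \<exists>Z dZ. integrated_state n z t Z dZ \<and>
        (AE \<zeta>\<in>{0<..<1} in lebesgue. z t \<zeta> - z0 \<zeta> = complex_of_real (- lam) \<cdot>\<^sub>v dZ \<zeta>) \<and>
        0\<^sub>v (n - p) @\<^sub>v vec_integral {0<..<t} p u =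
          complex_of_real (- lam) \<cdot>\<^sub>v (K *\<^sub>v Z 0) - complex_of_real lam \<cdot>\<^sub>v (L *\<^sub>v Z 1))"

definition has_output ::
    "real \<Rightarrow> nat \<Rightarrow> nat \<Rightarrow> complex mat \<Rightarrow> complex mat \<Rightarrow> (real \<Rightarrow> real \<Rightarrow> complex vec)
      \<Rightarrow> (real \<Rightarrow> complex vec) \<Rightarrow> bool" where
  "has_output lam n m Ky Ly z y \<longleftrightarrow>
     L2_loc m y \<and>
     (\<forall>t\<ge>0. \<exists>Z dZ. integrated_state n z t Z dZ \<and>
        vec_integral {0<..<t} m y =
          complex_of_real (- lam) \<cdot>\<^sub>v (Ky *\<^sub>v Z 0) - complex_of_real lam \<cdot>\<^sub>v (Ly *\<^sub>v Z 1))"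

text \<open>Mild solution and output are unique up to null sets when \<open>K\<close> is invertible, so the
  quantifiers over \<open>z\<close> and \<open>y\<close> only name them.\<close>

definition output_can_vanish ::
    "real \<Rightarrow> nat \<Rightarrow> nat \<Rightarrow> nat \<Rightarrow> complex mat \<Rightarrow> complex mat \<Rightarrow> complex mat \<Rightarrow> complex mat
      \<Rightarrow> (real \<Rightarrow> complex vec) \<Rightarrow> bool" where
  "output_can_vanish lam n p m K L Ky Ly z0 \<longleftrightarrow>
     (\<exists>u. L2_loc p u \<and>
        (\<exists>z y. mild_solution lam n p K L z0 u z \<and> has_output lam n m Ky Ly z y \<and>
           (AE t\<in>{0<..} in lebesgue. y t = 0\<^sub>v m)))"

definition phs_output_nulling ::
    "real \<Rightarrow> nat \<Rightarrow> nat \<Rightarrow> nat \<Rightarrow> complex mat \<Rightarrow> complex mat \<Rightarrow> complex mat \<Rightarrow> complex mat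
      \<Rightarrow> (real \<Rightarrow> complex vec) set" where
  "phs_output_nulling lam n p m K L Ky Ly =
     {z0 \<in> state_space n. output_can_vanish lam n p m K L Ky Ly z0}"

text \<open>\<^const>\<open>mat_inverse\<close> returns an option; it is \<open>Some\<close> of the inverse for invertible matrices.\<close>

definition A_d :: "complex mat \<Rightarrow> complex mat \<Rightarrow> complex mat" where
  "A_d K L = - the (mat_inverse K) * L"

definition B_d :: "real \<Rightarrow> nat \<Rightarrow> nat \<Rightarrow> complex mat \<Rightarrow> complex mat" where
  "B_d lam n p K =
     complex_of_real (- inverse lam) \<cdot>\<^sub>m (the (mat_inverse K) * (0\<^sub>m (n - p) p @\<^sub>r 1\<^sub>m p))"

definition C_d :: "real \<Rightarrow> complex mat \<Rightarrow> complex mat \<Rightarrow> complex mat \<Rightarrow> complex mat \<Rightarrow> complex mat" where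
  "C_d lam K L Ky Ly =
     complex_of_real (- lam) \<cdot>\<^sub>m (Ky * A_d K L) - complex_of_real lam \<cdot>\<^sub>m Ly"

definition D_d :: "real \<Rightarrow> nat \<Rightarrow> nat \<Rightarrow> complex mat \<Rightarrow> complex mat \<Rightarrow> complex mat" where
  "D_d lam n p K Ky = complex_of_real (- lam) \<cdot>\<^sub>m (Ky * B_d lam n p K)"

definition discrete_output_nulling ::
    "nat \<Rightarrow> nat \<Rightarrow> nat \<Rightarrow> complex mat \<Rightarrow> complex mat \<Rightarrow> complex mat \<Rightarrow> complex mat \<Rightarrow> complex vec set" where
  "discrete_output_nulling n p m A B C D =
     {w0 \<in> carrier_vec n. \<exists>w u y.
        (\<forall>k. u k \<in> carrier_vec p) \<and> w 0 = w0 \<and>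
        (\<forall>k::nat. w (Suc k) = A *\<^sub>v w k + B *\<^sub>v u k \<and> y k = C *\<^sub>v w k + D *\<^sub>v u k) \<and>
        (\<forall>k. y k = 0\<^sub>v m)}"

end

theory Submission
  imports Defs
begin

text \<open>
  Along the lines \<open>\<zeta> - lam * t = const\<close> the state does not change, so a solution has the form
  \<open>z t \<zeta> = f (\<zeta> - lam * t)\<close> with \<open>f = z0\<close> on \<open>(0,1)\<close>. As \<open>K\<close> is invertible, the boundary condition
  at time \<open>t = - x / lam\<close> says \<open>f x = A_d f (x + 1) + B_d u t\<close>, and the output there is
  \<open>C_d f (x + 1) + D_d u t\<close>. Hence for almost every \<open>x\<close> in \<open>(0,1)\<close> the samples
  \<open>f x, f (x - 1), f (x - 2), ...\<close> form a trajectory of the discrete-time system that starts in \<open>z0 x\<close>,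
  and the output vanishes if and only if it vanishes along almost all of these trajectories. Two points
  need work: the inputs of the discrete trajectories have to fit together to a square integrable
  \<open>u\<close>, and the solution is only a mild one, for which neither point values nor traces of \<open>z\<close> exist.

  From the discrete system to the boundary control system. The discrete subspace \<open>V\<close> is linear, so a
  control that keeps the state in \<open>V\<close> with zero output can be chosen as a matrix \<open>F\<close> applied to the state
  (\<open>linear_selection\<close>, \<open>output_nulling_feedback\<close>). With \<open>u t = F f (1 - lam * t)\<close> the recursion for \<open>f\<close>
  becomes autonomous and extends \<open>z0\<close> to a locally square integrable \<open>f\<close> with values in \<open>V\<close>
  (\<open>extend_initial_state\<close>). That \<open>f (\<zeta> - lam * t)\<close> is a mild solution rests on two facts about translation
  in \<open>L2\<close>: it is continuous (\<open>translation_L2_continuous\<close>), and the Riemann sums of the translates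
  converge in \<open>L2\<close> to the integral of \<open>f\<close> over a moving window, divided by \<open>lam\<close> (\<open>translation_Riemann_sums_L2\<close>). Both
  are evident for continuous \<open>f\<close> and carry over because continuous functions are dense.

  From the boundary control system to the discrete one. All quantities are integrated once more in
  space, which makes them continuous: for one component of a mild solution, the function
  \<open>G x t = Z t 0 - (\<integral>\<^sub>0\<^sup>x z t) / lam\<close>, which differs from \<open>Z t x\<close> by a function of \<open>x\<close> only, is continuous
  and satisfies the transport equation in integral form. It is therefore constant along
  characteristics (\<open>constant_along_characteristics\<close>), which expresses the trace \<open>Z t 1\<close> by earlier values
  of \<open>Z\<close> at \<open>0\<close> or by \<open>z0\<close> (\<open>mild_solution_boundary_traces\<close>). Differences of the traces at the times
  \<open>(k + 1 - x) / lam\<close> and \<open>k / lam\<close> then form a discrete trajectory with zero output that starts in a multiple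
  of \<open>\<integral>\<^sub>x\<^sup>1 z0\<close>. So these integrals lie in \<open>V\<close> for all \<open>x\<close>, and differentiation in \<open>x\<close> gives
  \<open>z0 x \<in> V\<close> for almost every \<open>x\<close>.
\<close>

section \<open>Subspaces and linear selections\<close>

definition vec_subspace :: "nat \<Rightarrow> 'a::field vec set \<Rightarrow> bool" where
  "vec_subspace n V \<longleftrightarrow> V \<subseteq> carrier_vec n \<and> 0\<^sub>v n \<in> V \<and>
     (\<forall>v\<in>V. \<forall>w\<in>V. v + w \<in> V) \<and> (\<forall>c. \<forall>v\<in>V. c \<cdot>\<^sub>v v \<in> V)"

lemma vec_subspaceD:
  assumes "vec_subspace n V"
  shows "v \<in> V \<Longrightarrow> v \<in> carrier_vec n" "0\<^sub>v n \<in> V" "v \<in> V \<Longrightarrow> w \<in> V \<Longrightarrow> v + w \<in> V"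
    "v \<in> V \<Longrightarrow> c \<cdot>\<^sub>v v \<in> V"
  using assms by (auto simp: vec_subspace_def)

lemma rank_one_mult_vec:
  fixes x w :: "'a::field vec"
  assumes "x \<in> carrier_vec n" "w \<in> carrier_vec n'" "k < n'"
  shows "mat n n' (\<lambda>(i, j). if j = k then x $ i else 0) *\<^sub>v w = (w $ k) \<cdot>\<^sub>v x"
proof (rule eq_vecI)
  fix i assume "i < dim_vec ((w $ k) \<cdot>\<^sub>v x)"
  then have i: "i < n" using assms by auto
  then have "(mat n n' (\<lambda>(i, j). if j = k then x $ i else 0) *\<^sub>v w) $ i
      = (\<Sum>j\<in>{0..<n'}. (if j = k then x $ i else 0) * w $ j)"
    using assms by (auto simp: scalar_prod_def intro!: sum.cong)
  also have "\<dots> = (\<Sum>j\<in>{0..<n'}. if j = k then x $ i * w $ j else 0)"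
    by (intro sum.cong) auto
  also have "\<dots> = x $ i * w $ k" using assms by simp
  finally show "(mat n n' (\<lambda>(i, j). if j = k then x $ i else 0) *\<^sub>v w) $ i = ((w $ k) \<cdot>\<^sub>v x) $ i"
    using assms i by simp
qed (use assms in auto)

text \<open>
  Induction on the number of leading coordinates in which elements of \<open>V\<close> may be nonzero. If some
  \<open>v \<in> V\<close> has last coordinate \<open>1\<close>, subtracting \<open>w $ k\<close> times \<open>v\<close> from \<open>w\<close> reduces the problem to the
  elements of \<open>V\<close> whose last coordinate is \<open>0\<close>.
\<close>

lemma subspace_projection:
  fixes V :: "'a::field vec set"
  assumes "vec_subspace n V"
  obtains P where "P \<in> carrier_mat n n" "\<And>w. w \<in> carrier_vec n \<Longrightarrow> P *\<^sub>v w \<in> V"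
    "\<And>w. w \<in> V \<Longrightarrow> P *\<^sub>v w = w"
proof -
  have "\<exists>P\<in>carrier_mat n n. (\<forall>w\<in>carrier_vec n. P *\<^sub>v w \<in> V) \<and> (\<forall>w\<in>V. P *\<^sub>v w = w)"
    if "k \<le> n" "vec_subspace n V" "\<forall>v\<in>V. \<forall>i<n. k \<le> i \<longrightarrow> v $ i = 0" for k and V :: "'a vec set"
    using that
  proof (induction k arbitrary: V)
    case 0
    have V0: "v = 0\<^sub>v n" if "v \<in> V" for v
      using 0 that vec_subspaceD(1)[OF 0(2) that] by (intro eq_vecI) auto
    show ?case
    proof (intro bexI[of _ "0\<^sub>m n n"] conjI ballI)
      show "0\<^sub>m n n *\<^sub>v w \<in> V" if "w \<in> carrier_vec n" for w
      proof -
        have "0\<^sub>m n n *\<^sub>v w = 0\<^sub>v n" using that by (intro eq_vecI) auto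
        then show ?thesis using vec_subspaceD(2)[OF 0(2)] by simp
      qed
      show "0\<^sub>m n n *\<^sub>v w = w" if "w \<in> V" for w
        using V0[OF that] by (intro eq_vecI) auto
    qed simp
  next
    case (Suc k)
    note V = vec_subspaceD[OF Suc.prems(2)]
    have dimV: "dim_vec v = n" if "v \<in> V" for v using V(1)[OF that] by simp
    show ?case
    proof (cases "\<exists>v\<in>V. v $ k \<noteq> 0")
      case False
      with Suc.prems have "\<forall>v\<in>V. \<forall>i<n. k \<le> i \<longrightarrow> v $ i = 0"
        by (metis le_SucE Suc_le_eq le_antisym not_less_eq_eq)
      with Suc show ?thesis by simp
    next
      case True
      then obtain v' where v': "v' \<in> V" "v' $ k \<noteq> 0" by blast
      have k: "k < n" using Suc.prems by simp
      define v where "v = (1 / v' $ k) \<cdot>\<^sub>v v'"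
      have "v $ k = 1 / v' $ k * v' $ k"
        unfolding v_def by (rule index_smult_vec(1)) (simp add: dimV[OF v'(1)] k)
      then have v: "v \<in> V" "v \<in> carrier_vec n" "v $ k = 1"
        using V(4)[OF v'(1)] V(1) v' by (simp_all add: v_def)
      define V' where "V' = {w \<in> V. w $ k = 0}"
      have "vec_subspace n V'"
        using V k by (auto simp: vec_subspace_def V'_def dimV)
      moreover have "\<forall>w\<in>V'. \<forall>i<n. k \<le> i \<longrightarrow> w $ i = 0"
        using Suc.prems(3) by (auto simp: V'_def) (metis le_antisym not_less_eq_eq)
      ultimately obtain P' where P': "P' \<in> carrier_mat n n"
        "\<And>w. w \<in> carrier_vec n \<Longrightarrow> P' *\<^sub>v w \<in> V'" "\<And>w. w \<in> V' \<Longrightarrow> P' *\<^sub>v w = w"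
        using Suc.IH[of V'] Suc.prems(1) by auto
      define x where "x = v - P' *\<^sub>v v"
      have x: "x \<in> carrier_vec n" using v P' by (auto simp: x_def)
      define P where "P = P' + mat n n (\<lambda>(i, j). if j = k then x $ i else 0)"
      have P: "P \<in> carrier_mat n n" using P' by (auto simp: P_def)
      have Pw: "P *\<^sub>v w = P' *\<^sub>v (w + (- w $ k) \<cdot>\<^sub>v v) + (w $ k) \<cdot>\<^sub>v v" if w: "w \<in> carrier_vec n" for w
      proof -
        have "P *\<^sub>v w = P' *\<^sub>v w + (w $ k) \<cdot>\<^sub>v x"
          unfolding P_def using P' w x k
          by (subst add_mult_distrib_mat_vec[of _ n n]) (auto simp: rank_one_mult_vec)
        also have "\<dots> = P' *\<^sub>v (w + (- w $ k) \<cdot>\<^sub>v v) + (w $ k) \<cdot>\<^sub>v v"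
          unfolding x_def using P'(1) w v(2)
          by (subst mult_add_distrib_mat_vec[of _ n n])
             (auto simp: mult_mat_vec algebra_simps intro!: eq_vecI)
        finally show ?thesis .
      qed
      show ?thesis
      proof (intro bexI[of _ P] conjI ballI)
        fix w :: "'a vec" assume w: "w \<in> carrier_vec n"
        have "P' *\<^sub>v (w + (- w $ k) \<cdot>\<^sub>v v) \<in> V" using P'(2)[of "w + (- w $ k) \<cdot>\<^sub>v v"] w v by (auto simp: V'_def)
        then show "P *\<^sub>v w \<in> V" using V v by (simp add: Pw[OF w])
      next
        fix w assume w: "w \<in> V"
        then have wc: "w \<in> carrier_vec n" using V by blast
        have "w + (- w $ k) \<cdot>\<^sub>v v \<in> V'"
          using w wc V v k by (auto simp: V'_def dimV)
        then show "P *\<^sub>v w = w"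
          using P'(3) wc v by (auto simp: Pw[OF wc] intro!: eq_vecI)
      qed (rule P)
    qed
  qed
  from this[of n V] assms that show ?thesis by auto
qed

text \<open>
  By linearity of the relation it suffices to choose a partner for the projection of each unit vector;
  these partners are the columns of the matrix.
\<close>

lemma linear_selection:
  fixes R :: "'a::field vec \<Rightarrow> 'a vec \<Rightarrow> bool"
  assumes V: "vec_subspace n V"
    and total: "\<And>w. w \<in> V \<Longrightarrow> \<exists>u\<in>carrier_vec p. R w u"
    and add: "\<And>w u w' u'. w \<in> V \<Longrightarrow> w' \<in> V \<Longrightarrow> u \<in> carrier_vec p \<Longrightarrow> u' \<in> carrier_vec p \<Longrightarrow>
      R w u \<Longrightarrow> R w' u' \<Longrightarrow> R (w + w') (u + u')"
    and smult: "\<And>c w u. w \<in> V \<Longrightarrow> u \<in> carrier_vec p \<Longrightarrow> R w u \<Longrightarrow> R (c \<cdot>\<^sub>v w) (c \<cdot>\<^sub>v u)"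
  obtains F where "F \<in> carrier_mat p n" "\<And>w. w \<in> V \<Longrightarrow> R w (F *\<^sub>v w)"
proof -
  obtain P where P: "P \<in> carrier_mat n n" "\<And>w. w \<in> carrier_vec n \<Longrightarrow> P *\<^sub>v w \<in> V"
    "\<And>w. w \<in> V \<Longrightarrow> P *\<^sub>v w = w"
    using subspace_projection[OF V] by metis
  have "\<forall>i. \<exists>u\<in>carrier_vec p. R (P *\<^sub>v unit_vec n i) u"
    using total[OF P(2)[OF unit_vec_carrier]] by blast
  then obtain U where U: "\<And>i. U i \<in> carrier_vec p" "\<And>i. R (P *\<^sub>v unit_vec n i) (U i)"
    by metis
  define F where "F = mat p n (\<lambda>(j, i). U i $ j)"
  have F: "F \<in> carrier_mat p n" by (simp add: F_def)
  have FU: "F *\<^sub>v unit_vec n k = U k" if "k < n" for k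
    using that U(1)[of k] by (intro eq_vecI) (auto simp: F_def)
  have "R (P *\<^sub>v w) (F *\<^sub>v w)" if w: "w \<in> carrier_vec n" for w
  proof -
    let ?w = "\<lambda>k. vec n (\<lambda>i. if i < k then w $ i else 0)"
    have step: "?w (Suc k) = ?w k + (w $ k) \<cdot>\<^sub>v unit_vec n k" if "k < n" for k
      using that by (intro eq_vecI) (auto simp: less_Suc_eq)
    have "R (P *\<^sub>v ?w k) (F *\<^sub>v ?w k)" if "k \<le> n" for k
      using that
    proof (induction k)
      case 0
      have "?w 0 = 0 \<cdot>\<^sub>v unit_vec n 0" by (intro eq_vecI) auto
      moreover obtain u where "u \<in> carrier_vec p" "R (P *\<^sub>v unit_vec n 0) u"
        using total[OF P(2)[of "unit_vec n 0"]] by auto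
      moreover have "F *\<^sub>v (0 \<cdot>\<^sub>v unit_vec n 0) = 0 \<cdot>\<^sub>v u"
        using F \<open>u \<in> carrier_vec p\<close> by (subst mult_mat_vec[of _ p n]) (auto intro!: eq_vecI)
      moreover have "P *\<^sub>v (0 \<cdot>\<^sub>v unit_vec n 0) = 0 \<cdot>\<^sub>v (P *\<^sub>v unit_vec n 0)"
        using P by (subst mult_mat_vec[of _ n n]) auto
      ultimately show ?case using smult[of "P *\<^sub>v unit_vec n 0" u 0] P(2) by simp
    next
      case (Suc k)
      then have k: "k < n" by simp
      have "P *\<^sub>v ?w (Suc k) = P *\<^sub>v ?w k + (w $ k) \<cdot>\<^sub>v (P *\<^sub>v unit_vec n k)"
        unfolding step[OF k] using P(1)
        by (simp add: mult_add_distrib_mat_vec[of _ n n] mult_mat_vec[of _ n n])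
      moreover have "F *\<^sub>v ?w (Suc k) = F *\<^sub>v ?w k + (w $ k) \<cdot>\<^sub>v U k"
        unfolding step[OF k] using F FU[OF k]
        by (simp add: mult_add_distrib_mat_vec[of _ p n] mult_mat_vec[of _ p n])
      moreover have "R (P *\<^sub>v ?w k + (w $ k) \<cdot>\<^sub>v (P *\<^sub>v unit_vec n k)) (F *\<^sub>v ?w k + (w $ k) \<cdot>\<^sub>v U k)"
        using Suc k F U P(2) vec_subspaceD(4)[OF V]
        by (intro add smult) (auto intro: mult_mat_vec_carrier)
      ultimately show ?case by simp
    qed
    moreover have "?w n = w" using w by (intro eq_vecI) auto
    ultimately show ?thesis by (metis order_refl)
  qed
  then show ?thesis using that[OF F] P(3) vec_subspaceD(1)[OF V] by metis
qed

section \<open>The boundary condition as one step of the discrete-time system\<close>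

lemma smult_mat_mult_vec:
  fixes A :: "'a::comm_ring_1 mat"
  assumes "A \<in> carrier_mat m n" "v \<in> carrier_vec n"
  shows "(c \<cdot>\<^sub>m A) *\<^sub>v v = c \<cdot>\<^sub>v (A *\<^sub>v v)"
  using assms by (intro eq_vecI) (auto simp: scalar_prod_def sum_distrib_left mult.assoc)

lemma uminus_mat_mult_vec:
  fixes A :: "'a::comm_ring_1 mat"
  assumes "A \<in> carrier_mat m n" "v \<in> carrier_vec n"
  shows "(- A) *\<^sub>v v = - (A *\<^sub>v v)"
  using assms by (intro eq_vecI) (auto simp: scalar_prod_def sum_negf)

lemma mat_inverse_invertible:
  fixes K :: "'a::field mat"
  assumes K: "K \<in> carrier_mat n n" "invertible_mat K"
  shows "the (mat_inverse K) \<in> carrier_mat n n" "the (mat_inverse K) * K = 1\<^sub>m n"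
    "K * the (mat_inverse K) = 1\<^sub>m n"
proof -
  obtain B where B: "inverts_mat K B" "inverts_mat B K"
    using K unfolding invertible_mat_def by auto
  have "dim_col (K * B) = dim_col (1\<^sub>m n :: 'a mat)" "dim_col (B * K) = dim_col (1\<^sub>m (dim_row B) :: 'a mat)"
    using B K unfolding inverts_mat_def by auto
  then have Bc: "B \<in> carrier_mat n n" using K by auto
  then have "K \<in> Units (ring_mat TYPE('a) n (undefined :: unit))"
    using B K unfolding Units_def ring_mat_def inverts_mat_def by auto
  then obtain Ki where Ki: "mat_inverse K = Some Ki"
    using mat_inverse(1)[OF K(1), of "undefined :: unit"] by (cases "mat_inverse K") auto
  from mat_inverse(2)[OF K(1) Ki] Ki show "the (mat_inverse K) \<in> carrier_mat n n"
    "the (mat_inverse K) * K = 1\<^sub>m n" "K * the (mat_inverse K) = 1\<^sub>m n" by auto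
qed

lemma input_embedding_mult_vec:
  fixes u :: "'a::comm_ring_1 vec"
  assumes "u \<in> carrier_vec p"
  shows "(0\<^sub>m q p @\<^sub>r 1\<^sub>m p) *\<^sub>v u = 0\<^sub>v q @\<^sub>v u"
proof -
  have "0\<^sub>m q p *\<^sub>v u = 0\<^sub>v q" using assms by (intro eq_vecI) auto
  then show ?thesis
    using assms by (subst mat_mult_append[of _ q p _ p]) auto
qed

lemma smult_vec_zero: "c \<cdot>\<^sub>v 0\<^sub>v m = (0\<^sub>v m :: 'a::semiring_0 vec)"
  by (intro eq_vecI) auto

locale phs_matrices =
  fixes lam :: real and n p m :: nat and K L Ky Ly :: "complex mat"
  assumes lam: "lam > 0" and p: "p \<le> n"
    and K: "K \<in> carrier_mat n n" and L: "L \<in> carrier_mat n n"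
    and Ky: "Ky \<in> carrier_mat m n" and Ly: "Ly \<in> carrier_mat m n"
    and inv: "invertible_mat K"
begin

abbreviation "A \<equiv> A_d K L"
abbreviation "B \<equiv> B_d lam n p K"
abbreviation "C \<equiv> C_d lam K L Ky Ly"
abbreviation "D \<equiv> D_d lam n p K Ky"
abbreviation "Vd \<equiv> discrete_output_nulling n p m A B C D"

lemma E_carrier: "0\<^sub>m (n - p) p @\<^sub>r 1\<^sub>m p \<in> carrier_mat n p"
  using carrier_append_rows[of "0\<^sub>m (n - p) p" "n - p" p "1\<^sub>m p" p] p by simp

lemma carriers:
  shows A: "A \<in> carrier_mat n n" and B: "B \<in> carrier_mat n p"
    and C: "C \<in> carrier_mat m n" and D: "D \<in> carrier_mat m p"
  using mat_inverse_invertible[OF K inv] E_carrier L Ky Ly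
  unfolding A_d_def B_d_def C_d_def D_d_def
  by (auto intro!: mult_carrier_mat smult_carrier_mat)

text \<open>
  The boundary condition, solved for the value \<open>b\<close> at the inflow end, is the state equation of the
  discrete-time system with the value \<open>s\<close> at the outflow end as current state.
\<close>

lemma boundary_condition_iff:
  assumes b: "b \<in> carrier_vec n" and s: "s \<in> carrier_vec n" and u: "u \<in> carrier_vec p"
  shows "0\<^sub>v (n - p) @\<^sub>v u = complex_of_real (- lam) \<cdot>\<^sub>v (K *\<^sub>v b) - complex_of_real lam \<cdot>\<^sub>v (L *\<^sub>v s)
    \<longleftrightarrow> b = A *\<^sub>v s + B *\<^sub>v u"
proof -
  let ?Ki = "the (mat_inverse K)" and ?e = "0\<^sub>v (n - p) @\<^sub>v u"
  note Ki = mat_inverse_invertible[OF K inv]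
  have e: "?e \<in> carrier_vec n" using u p append_carrier_vec[of "0\<^sub>v (n - p)" "n - p" u p] by simp
  have KA: "K *\<^sub>v (A *\<^sub>v s) = - (L *\<^sub>v s)"
  proof -
    have "A *\<^sub>v s = - (?Ki *\<^sub>v (L *\<^sub>v s))"
      unfolding A_d_def using Ki(1) L s
      by (subst assoc_mult_mat_vec[of _ n n]) (auto simp: uminus_mat_mult_vec[of _ n n])
    then have "K *\<^sub>v (A *\<^sub>v s) = - (K *\<^sub>v (?Ki *\<^sub>v (L *\<^sub>v s)))"
      using K Ki(1) L s by (intro eq_vecI) (auto simp: mult_mat_vec_carrier)
    also have "K *\<^sub>v (?Ki *\<^sub>v (L *\<^sub>v s)) = L *\<^sub>v s"
      using K Ki L s by (subst assoc_mult_mat_vec[symmetric, of _ n n _ n]) (auto simp: mult_mat_vec_carrier)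
    finally show ?thesis .
  qed
  have KB: "K *\<^sub>v (B *\<^sub>v u) = complex_of_real (- inverse lam) \<cdot>\<^sub>v ?e"
  proof -
    have "B *\<^sub>v u = complex_of_real (- inverse lam) \<cdot>\<^sub>v (?Ki *\<^sub>v ?e)"
      unfolding B_d_def using Ki(1) E_carrier u
      by (subst smult_mat_mult_vec[of _ n p])
         (auto simp: assoc_mult_mat_vec[of _ n n _ p] input_embedding_mult_vec intro!: mult_carrier_mat)
    then have "K *\<^sub>v (B *\<^sub>v u) = complex_of_real (- inverse lam) \<cdot>\<^sub>v (K *\<^sub>v (?Ki *\<^sub>v ?e))"
      using K Ki(1) e by (simp add: mult_mat_vec[of _ n n])
    also have "K *\<^sub>v (?Ki *\<^sub>v ?e) = ?e"
      using K Ki e by (subst assoc_mult_mat_vec[symmetric, of _ n n _ n]) auto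
    finally show ?thesis .
  qed
  have "b = A *\<^sub>v s + B *\<^sub>v u \<longleftrightarrow> K *\<^sub>v b = K *\<^sub>v (A *\<^sub>v s + B *\<^sub>v u)"
  proof
    assume eq: "K *\<^sub>v b = K *\<^sub>v (A *\<^sub>v s + B *\<^sub>v u)"
    have "?Ki *\<^sub>v (K *\<^sub>v v) = v" if "v \<in> carrier_vec n" for v
      using Ki K that by (subst assoc_mult_mat_vec[symmetric, of _ n n _ n]) auto
    then show "b = A *\<^sub>v s + B *\<^sub>v u"
      using arg_cong[OF eq, of "\<lambda>v. ?Ki *\<^sub>v v"] b A B s u by (simp add: mult_mat_vec_carrier)
  qed simp
  also have "K *\<^sub>v (A *\<^sub>v s + B *\<^sub>v u) = - (L *\<^sub>v s) + complex_of_real (- inverse lam) \<cdot>\<^sub>v ?e"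
    using K A B s u by (simp add: mult_add_distrib_mat_vec[of _ n n] mult_mat_vec_carrier KA KB)
  also have "K *\<^sub>v b = - (L *\<^sub>v s) + complex_of_real (- inverse lam) \<cdot>\<^sub>v ?e
      \<longleftrightarrow> ?e = complex_of_real (- lam) \<cdot>\<^sub>v (K *\<^sub>v b) - complex_of_real lam \<cdot>\<^sub>v (L *\<^sub>v s)"
  proof -
    have dims: "dim_vec (K *\<^sub>v b) = n" "dim_vec (L *\<^sub>v s) = n" "dim_vec ?e = n"
      using K L e by (auto simp del: index_append_vec)
    have scal: "x = - y + complex_of_real (- inverse lam) * w
        \<longleftrightarrow> w = complex_of_real (- lam) * x - complex_of_real lam * y" for x y w :: complex
      using lam by (auto simp: field_simps eq_neg_iff_add_eq_0)
    show ?thesis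
      unfolding vec_eq_iff using dims scal by (simp del: index_append_vec index_mult_mat_vec)
  qed
  finally show ?thesis by blast
qed

lemma output_eq:
  assumes s: "s \<in> carrier_vec n" and u: "u \<in> carrier_vec p"
  shows "complex_of_real (- lam) \<cdot>\<^sub>v (Ky *\<^sub>v (A *\<^sub>v s + B *\<^sub>v u)) - complex_of_real lam \<cdot>\<^sub>v (Ly *\<^sub>v s)
    = C *\<^sub>v s + D *\<^sub>v u"
proof -
  have "C *\<^sub>v s = complex_of_real (- lam) \<cdot>\<^sub>v (Ky *\<^sub>v (A *\<^sub>v s)) - complex_of_real lam \<cdot>\<^sub>v (Ly *\<^sub>v s)"
    unfolding C_d_def using Ky Ly A s
    by (subst minus_mult_distrib_mat_vec[of _ m n])
       (auto simp: smult_mat_mult_vec[of _ m n] assoc_mult_mat_vec[of _ m n _ n] intro!: mult_carrier_mat)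
  moreover have "D *\<^sub>v u = complex_of_real (- lam) \<cdot>\<^sub>v (Ky *\<^sub>v (B *\<^sub>v u))"
    unfolding D_d_def using Ky B u
    by (subst smult_mat_mult_vec[of _ m p]) (auto simp: assoc_mult_mat_vec[of _ m n _ p] intro!: mult_carrier_mat)
  moreover have "Ky *\<^sub>v (A *\<^sub>v s + B *\<^sub>v u) = Ky *\<^sub>v (A *\<^sub>v s) + Ky *\<^sub>v (B *\<^sub>v u)"
    using Ky A B s u by (simp add: mult_add_distrib_mat_vec[of _ m n] mult_mat_vec_carrier)
  ultimately show ?thesis
    using Ky Ly by (intro eq_vecI) (auto simp: algebra_simps simp del: index_mult_mat_vec)
qed

text \<open>
  Pairs of a state and an input sequence with zero output. Unlike membership in the subspace, this is
  visibly preserved by linear combinations and by shifting the time.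
\<close>

definition nulling_trajectory :: "(nat \<Rightarrow> complex vec) \<Rightarrow> (nat \<Rightarrow> complex vec) \<Rightarrow> bool" where
  "nulling_trajectory w u \<longleftrightarrow> (\<forall>k. w k \<in> carrier_vec n \<and> u k \<in> carrier_vec p \<and>
     w (Suc k) = A *\<^sub>v w k + B *\<^sub>v u k \<and> C *\<^sub>v w k + D *\<^sub>v u k = 0\<^sub>v m)"

lemma nulling_trajectoryD:
  assumes "nulling_trajectory w u"
  shows "w k \<in> carrier_vec n" "u k \<in> carrier_vec p"
    "w (Suc k) = A *\<^sub>v w k + B *\<^sub>v u k" "C *\<^sub>v w k + D *\<^sub>v u k = 0\<^sub>v m"
  using assms unfolding nulling_trajectory_def by blast+

lemma Vd_iff: "w0 \<in> Vd \<longleftrightarrow> (\<exists>w u. nulling_trajectory w u \<and> w 0 = w0)"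
proof
  assume "w0 \<in> Vd"
  then obtain w u y where wu: "w0 \<in> carrier_vec n" "\<forall>k. u k \<in> carrier_vec p" "w 0 = w0"
    "\<forall>k. w (Suc k) = A *\<^sub>v w k + B *\<^sub>v u k \<and> y k = C *\<^sub>v w k + D *\<^sub>v u k" "\<forall>k. y k = 0\<^sub>v m"
    unfolding discrete_output_nulling_def mem_Collect_eq by blast
  have "w k \<in> carrier_vec n" for k
  proof (induction k)
    case (Suc k)
    have "A *\<^sub>v w k + B *\<^sub>v u k \<in> carrier_vec n"
      using Suc wu(2) A B by (intro add_carrier_vec mult_mat_vec_carrier[of _ n _]) auto
    then show ?case using wu(4) by simp
  qed (use wu in simp)
  then have "nulling_trajectory w u" using wu(2,4,5) by (simp add: nulling_trajectory_def)
  with wu(3) show "\<exists>w u. nulling_trajectory w u \<and> w 0 = w0" by blast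
next
  assume "\<exists>w u. nulling_trajectory w u \<and> w 0 = w0"
  then obtain w u where wu: "nulling_trajectory w u" "w 0 = w0" by blast
  show "w0 \<in> Vd"
    unfolding discrete_output_nulling_def
  proof (intro CollectI conjI exI)
    show "\<forall>k. u k \<in> carrier_vec p" "w 0 = w0" "w0 \<in> carrier_vec n"
      "\<forall>k. w (Suc k) = A *\<^sub>v w k + B *\<^sub>v u k \<and> (\<lambda>_. 0\<^sub>v m) k = C *\<^sub>v w k + D *\<^sub>v u k"
      using wu nulling_trajectoryD[OF wu(1)] by auto
  qed simp
qed

lemma linear_combination_step:
  assumes "M \<in> carrier_mat r n" "N \<in> carrier_mat r p" "w \<in> carrier_vec n" "u \<in> carrier_vec p"
  shows "w' \<in> carrier_vec n \<Longrightarrow> u' \<in> carrier_vec p \<Longrightarrow> M *\<^sub>v (w + w') + N *\<^sub>v (u + u') = (M *\<^sub>v w + N *\<^sub>v u) + (M *\<^sub>v w' + N *\<^sub>v u')"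
    and "M *\<^sub>v (c \<cdot>\<^sub>v w) + N *\<^sub>v (c \<cdot>\<^sub>v u) = c \<cdot>\<^sub>v (M *\<^sub>v w + N *\<^sub>v (u :: complex vec))"
proof -
  assume *: "w' \<in> carrier_vec n" "u' \<in> carrier_vec p"
  show "M *\<^sub>v (w + w') + N *\<^sub>v (u + u') = (M *\<^sub>v w + N *\<^sub>v u) + (M *\<^sub>v w' + N *\<^sub>v u')"
    unfolding mult_add_distrib_mat_vec[OF assms(1,3) *(1)] mult_add_distrib_mat_vec[OF assms(2,4) *(2)]
    using assms * by (intro eq_vecI) (auto simp del: index_mult_mat_vec)
next
  show "M *\<^sub>v (c \<cdot>\<^sub>v w) + N *\<^sub>v (c \<cdot>\<^sub>v u) = c \<cdot>\<^sub>v (M *\<^sub>v w + N *\<^sub>v u)"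
    unfolding mult_mat_vec[OF assms(1,3)] mult_mat_vec[OF assms(2,4)]
    using assms by (intro eq_vecI) (auto simp: algebra_simps simp del: index_mult_mat_vec)
qed

lemma Vd_subspace: "vec_subspace n Vd"
  unfolding vec_subspace_def
proof (intro conjI ballI allI)
  show "Vd \<subseteq> carrier_vec n" by (auto simp: discrete_output_nulling_def)
  have "nulling_trajectory (\<lambda>_. 0\<^sub>v n) (\<lambda>_. 0\<^sub>v p)"
    unfolding nulling_trajectory_def using carriers by (auto intro!: eq_vecI)
  then show "0\<^sub>v n \<in> Vd" unfolding Vd_iff by blast
next
  fix v v' assume "v \<in> Vd" "v' \<in> Vd"
  then obtain w u w' u' where wu: "nulling_trajectory w u" "w 0 = v" "nulling_trajectory w' u'" "w' 0 = v'"
    unfolding Vd_iff by blast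
  have "nulling_trajectory (\<lambda>k. w k + w' k) (\<lambda>k. u k + u' k)"
    using nulling_trajectoryD[OF wu(1)] nulling_trajectoryD[OF wu(3)]
    by (simp add: nulling_trajectory_def linear_combination_step(1)[OF A B] linear_combination_step(1)[OF C D])
  with wu show "v + v' \<in> Vd" unfolding Vd_iff by blast
next
  fix c v assume "v \<in> Vd"
  then obtain w u where wu: "nulling_trajectory w u" "w 0 = v" unfolding Vd_iff by blast
  have "nulling_trajectory (\<lambda>k. c \<cdot>\<^sub>v w k) (\<lambda>k. c \<cdot>\<^sub>v u k)"
    using nulling_trajectoryD[OF wu(1)]
    by (simp add: nulling_trajectory_def linear_combination_step(2)[OF A B]
        linear_combination_step(2)[OF C D] smult_vec_zero)
  with wu show "c \<cdot>\<^sub>v v \<in> Vd" unfolding Vd_iff by blast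
qed

lemma Vd_invariant:
  assumes "v \<in> Vd"
  shows "\<exists>u\<in>carrier_vec p. A *\<^sub>v v + B *\<^sub>v u \<in> Vd \<and> C *\<^sub>v v + D *\<^sub>v u = 0\<^sub>v m"
proof -
  obtain w u where wu: "nulling_trajectory w u" "w 0 = v" using assms unfolding Vd_iff by blast
  have "nulling_trajectory (\<lambda>k. w (Suc k)) (\<lambda>k. u (Suc k))"
    using wu(1) unfolding nulling_trajectory_def by blast
  then have "w (Suc 0) \<in> Vd" unfolding Vd_iff by blast
  then show ?thesis
    using nulling_trajectoryD[OF wu(1), of 0] wu(2) by (intro bexI[of _ "u 0"]) simp_all
qed

text \<open>
  The admissible inputs depend on the state through a linear relation, so they can be selected by a
  matrix. Linearity is what turns square integrable states into square integrable inputs.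
\<close>

lemma output_nulling_feedback:
  obtains F where "F \<in> carrier_mat p n"
    "\<And>v. v \<in> Vd \<Longrightarrow> A *\<^sub>v v + B *\<^sub>v (F *\<^sub>v v) \<in> Vd \<and> C *\<^sub>v v + D *\<^sub>v (F *\<^sub>v v) = 0\<^sub>v m"
proof -
  note V = vec_subspaceD[OF Vd_subspace]
  show ?thesis
  proof (rule linear_selection[OF Vd_subspace, of p "\<lambda>v u. A *\<^sub>v v + B *\<^sub>v u \<in> Vd \<and> C *\<^sub>v v + D *\<^sub>v u = 0\<^sub>v m"])
    show "\<exists>u\<in>carrier_vec p. A *\<^sub>v w + B *\<^sub>v u \<in> Vd \<and> C *\<^sub>v w + D *\<^sub>v u = 0\<^sub>v m" if "w \<in> Vd" for w
      by (rule Vd_invariant[OF that])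
  next
    fix w u w' u' assume *: "w \<in> Vd" "w' \<in> Vd" "u \<in> carrier_vec p" "u' \<in> carrier_vec p"
      "A *\<^sub>v w + B *\<^sub>v u \<in> Vd \<and> C *\<^sub>v w + D *\<^sub>v u = 0\<^sub>v m"
      "A *\<^sub>v w' + B *\<^sub>v u' \<in> Vd \<and> C *\<^sub>v w' + D *\<^sub>v u' = 0\<^sub>v m"
    show "A *\<^sub>v (w + w') + B *\<^sub>v (u + u') \<in> Vd \<and> C *\<^sub>v (w + w') + D *\<^sub>v (u + u') = 0\<^sub>v m"
      unfolding linear_combination_step(1)[OF A B V(1)[OF *(1)] *(3) V(1)[OF *(2)] *(4)]
        linear_combination_step(1)[OF C D V(1)[OF *(1)] *(3) V(1)[OF *(2)] *(4)]
      using * V(3) by auto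
  next
    fix c w u assume *: "w \<in> Vd" "u \<in> carrier_vec p"
      "A *\<^sub>v w + B *\<^sub>v u \<in> Vd \<and> C *\<^sub>v w + D *\<^sub>v u = 0\<^sub>v m"
    show "A *\<^sub>v (c \<cdot>\<^sub>v w) + B *\<^sub>v (c \<cdot>\<^sub>v u) \<in> Vd \<and> C *\<^sub>v (c \<cdot>\<^sub>v w) + D *\<^sub>v (c \<cdot>\<^sub>v u) = 0\<^sub>v m"
      unfolding linear_combination_step(2)[OF A B V(1)[OF *(1)] *(2)]
        linear_combination_step(2)[OF C D V(1)[OF *(1)] *(2)]
      using * V(4) by auto
  qed (rule that)
qed

end

section \<open>Approximation of square integrable functions\<close>

lemma square_norm_add_le: "(norm (x + y :: 'a::real_normed_vector))\<^sup>2 \<le> 2 * (norm x)\<^sup>2 + 2 * (norm y)\<^sup>2"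
proof -
  have "(norm (x + y))\<^sup>2 \<le> (norm x + norm y)\<^sup>2"
    by (intro power_mono norm_triangle_ineq) simp
  also have "\<dots> \<le> 2 * (norm x)\<^sup>2 + 2 * (norm y)\<^sup>2"
    using zero_le_power2[of "norm x - norm y"] by (simp add: power2_sum power2_diff)
  finally show ?thesis .
qed

lemma set_integrable_if_square_integrable:
  fixes f :: "'a \<Rightarrow> 'b::{banach, second_countable_topology}"
  assumes f: "set_borel_measurable M S f" and S: "S \<in> sets M" "emeasure M S < \<infinity>"
    and sq: "set_integrable M S (\<lambda>x. (norm (f x))\<^sup>2)"
  shows "set_integrable M S f"
proof (rule set_integrable_bound[where f = "\<lambda>x. 1 + (norm (f x))\<^sup>2"])
  have "set_integrable M S (\<lambda>x. 1 :: real)"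
    using S by (simp add: set_integrable_def)
  with sq show "set_integrable M S (\<lambda>x. 1 + (norm (f x))\<^sup>2)" by (intro set_integral_add)
  have "norm (f x) \<le> norm (1 + (norm (f x))\<^sup>2)" for x
  proof -
    have "2 * norm (f x) \<le> 1 + (norm (f x))\<^sup>2"
      using zero_le_power2[of "norm (f x) - 1"] by (simp add: power2_diff)
    then show ?thesis using norm_ge_zero[of "f x"] unfolding real_norm_def by linarith
  qed
  then show "AE x in M. x \<in> S \<longrightarrow> norm (f x) \<le> norm (1 + (norm (f x))\<^sup>2)" by simp
qed (rule f)

lemma set_integral_mono_subset:
  fixes f :: "'a \<Rightarrow> real"
  assumes "set_integrable M S f" "\<And>x. x \<in> S \<Longrightarrow> 0 \<le> f x" "T \<in> sets M" "T \<subseteq> S"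
  shows "(LINT x:T|M. f x) \<le> (LINT x:S|M. f x)"
  using assms set_integrable_subset[OF assms(1,3,4)]
  unfolding set_lebesgue_integral_def set_integrable_def
  by (intro integral_mono) (auto simp: indicator_def)

text \<open>
  The inequality of Cauchy and Schwarz against the constant function \<open>1\<close>, obtained from
  \<open>\<integral> (norm f - c)\<^sup>2 \<ge> 0\<close> for all constants \<open>c\<close>.
\<close>

lemma square_set_integral_le:
  fixes f :: "'a \<Rightarrow> 'b::{banach, second_countable_topology}"
  assumes f: "set_borel_measurable M S f" and S: "S \<in> sets M" "emeasure M S < \<infinity>"
    and sq: "set_integrable M S (\<lambda>x. (norm (f x))\<^sup>2)" and T: "T \<in> sets M" "T \<subseteq> S"
  shows "(norm (LINT x:T|M. f x))\<^sup>2 \<le> measure M S * (LINT x:S|M. (norm (f x))\<^sup>2)"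
proof -
  let ?m = "LINT x:S|M. norm (f x)" and ?Q = "LINT x:S|M. (norm (f x))\<^sup>2" and ?l = "measure M S"
  have int: "set_integrable M S f" by (rule set_integrable_if_square_integrable) fact+
  then have intn: "set_integrable M S (\<lambda>x. norm (f x))" by (rule set_integrable_norm)
  have intc: "set_integrable M S (\<lambda>x. c :: real)" for c
    using S by (simp add: set_integrable_def)
  have "norm (LINT x:T|M. f x) \<le> (LINT x:T|M. norm (f x))"
    using int T by (intro set_integral_norm_bound) (rule set_integrable_subset)
  also have "\<dots> \<le> ?m"
    using intn T by (intro set_integral_mono_subset) auto
  finally have 1: "norm (LINT x:T|M. f x) \<le> ?m" .
  have quad: "0 \<le> ?Q - 2 * c * ?m + c\<^sup>2 * ?l" for c
  proof -
    have "0 \<le> (LINT x:S|M. (norm (f x) - c)\<^sup>2)"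
      unfolding set_lebesgue_integral_def by (intro integral_nonneg_AE) simp
    also have "\<dots> = (LINT x:S|M. ((norm (f x))\<^sup>2 - (2 * c) * norm (f x)) + c\<^sup>2)"
      by (rule arg_cong[where f = "set_lebesgue_integral M S"]) (simp add: fun_eq_iff power2_diff)
    also have "\<dots> = (?Q - (2 * c) * ?m) + (LINT x:S|M. c\<^sup>2)"
      using sq intc intn
      by (simp only: set_integral_add(2) set_integral_diff set_integrable_mult_right set_integral_mult_right)
    also have "(LINT x:S|M. c\<^sup>2) = c\<^sup>2 * ?l"
      using S by (simp add: set_lebesgue_integral_def)
    finally show ?thesis .
  qed
  have "?m\<^sup>2 \<le> ?l * ?Q"
  proof (cases "?l = 0")
    case True
    have "?m = 0"
      \<comment> \<open>if the quadratic polynomial in \<open>c\<close> is affine and nonnegative, its slope vanishes\<close>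
      using quad[of "(?Q + 1) / (2 * ?m)"] True by (cases "?m = 0") auto
    with True show ?thesis by simp
  next
    case False
    then have l: "?l > 0" by (simp add: zero_less_measure_iff)
    \<comment> \<open>the minimum of the quadratic polynomial is attained at the mean value of \<open>norm f\<close>\<close>
    show ?thesis using quad[of "?m / ?l"] l by (simp add: field_simps power2_eq_square)
  qed
  with 1 show ?thesis by (meson norm_ge_zero order_trans power_mono)
qed

text \<open>
  Radial truncation to the ball of radius \<open>k\<close>. The maximum in the denominator makes one formula cover
  both cases, so that continuity is immediate.
\<close>

definition truncate_norm :: "real \<Rightarrow> 'a::real_normed_vector \<Rightarrow> 'a" where
  "truncate_norm k z = (k / max k (norm z)) *\<^sub>R z"

lemma norm_truncate_le: "k > 0 \<Longrightarrow> norm (truncate_norm k z) \<le> k"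
  by (simp add: truncate_norm_def divide_le_eq max_def)

lemma truncate_norm_eq: "k > 0 \<Longrightarrow> norm z \<le> k \<Longrightarrow> truncate_norm k z = z"
  by (simp add: truncate_norm_def max_def)

lemma norm_diff_truncate_le: "k > 0 \<Longrightarrow> norm (z - truncate_norm k z) \<le> norm z"
proof -
  assume k: "k > 0"
  have "z - truncate_norm k z = (1 - k / max k (norm z)) *\<^sub>R z"
    by (simp add: truncate_norm_def algebra_simps)
  moreover have "\<bar>1 - k / max k (norm z)\<bar> \<le> 1" using k by (auto simp: max_def abs_if divide_le_eq)
  ultimately show ?thesis by (simp add: mult_left_le_one_le)
qed

lemma continuous_on_truncate_norm: "k > 0 \<Longrightarrow> continuous_on S (truncate_norm k)"
  unfolding truncate_norm_def by (intro continuous_intros) auto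

text \<open>
  Measurability provides continuous functions that converge to \<open>f\<close> almost everywhere, but without a
  common majorant. Truncating both \<open>f\<close> and these functions at the same level makes dominated convergence
  applicable on the bounded interval; truncating \<open>f\<close> alone costs little in \<open>L2\<close>.
\<close>

lemma square_integrable_approx_continuous:
  fixes f :: "real \<Rightarrow> 'a::euclidean_space"
  assumes f: "f \<in> borel_measurable borel" and sq: "set_integrable lborel {a..b} (\<lambda>x. (norm (f x))\<^sup>2)"
    and e: "e > 0"
  obtains g where "continuous_on UNIV g" "set_integrable lborel {a..b} (\<lambda>x. (norm (f x - g x))\<^sup>2)"
    "(LINT x:{a..b}|lborel. (norm (f x - g x))\<^sup>2) < e"
proof -
  let ?S = "{a..b}" and ?k = "\<lambda>n. 1 + real n"
  have tr[measurable]: "truncate_norm (?k n) \<in> borel_measurable borel" for n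
    by (intro borel_measurable_continuous_onI continuous_on_truncate_norm) auto
  note [measurable] = f
  have dom: "set_integrable lborel ?S (\<lambda>x. (norm (f x - truncate_norm (?k n) (f x)))\<^sup>2)" for n
    by (rule set_integrable_bound[OF sq])
       (auto simp: set_borel_measurable_def intro!: power_mono norm_diff_truncate_le)
  have "(\<lambda>n. LINT x:?S|lborel. (norm (f x - truncate_norm (?k n) (f x)))\<^sup>2) \<longlonglongrightarrow> (LINT x:?S|lborel. 0)"
    unfolding set_lebesgue_integral_def
  proof (rule integral_dominated_convergence[where w = "\<lambda>x. indicator ?S x *\<^sub>R (norm (f x))\<^sup>2"])
    show "integrable lborel (\<lambda>x. indicator ?S x *\<^sub>R (norm (f x))\<^sup>2)"
      using sq by (simp add: set_integrable_def)
    show "AE x in lborel. (\<lambda>n. indicator ?S x *\<^sub>R (norm (f x - truncate_norm (?k n) (f x)))\<^sup>2)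
        \<longlonglongrightarrow> indicator ?S x *\<^sub>R 0"
    proof (rule AE_I2)
      fix x
      obtain N where N: "norm (f x) \<le> real N" using real_arch_simple by blast
      have "\<forall>\<^sub>F n in sequentially. indicator ?S x *\<^sub>R (norm (f x - truncate_norm (?k n) (f x)))\<^sup>2
          = indicat_real ?S x *\<^sub>R 0"
        using eventually_ge_at_top[of N]
      proof eventually_elim
        case (elim n)
        then have "norm (f x) \<le> ?k n" using N by linarith
        then show ?case by (simp add: truncate_norm_eq)
      qed
      then show "(\<lambda>n. indicator ?S x *\<^sub>R (norm (f x - truncate_norm (?k n) (f x)))\<^sup>2)
          \<longlonglongrightarrow> indicator ?S x *\<^sub>R 0" by (rule tendsto_eventually)
    qed
    show "AE x in lborel. norm (indicator ?S x *\<^sub>R (norm (f x - truncate_norm (?k n) (f x)))\<^sup>2)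
        \<le> indicator ?S x *\<^sub>R (norm (f x))\<^sup>2" for n
      by (intro AE_I2) (auto simp: indicator_def intro!: power_mono norm_diff_truncate_le)
  qed measurable
  then have "\<forall>\<^sub>F n in sequentially. (LINT x:?S|lborel. (norm (f x - truncate_norm (?k n) (f x)))\<^sup>2) < e / 4"
    using e by (intro order_tendstoD(2)[of _ 0]) (auto simp: set_lebesgue_integral_def)
  then obtain n where n: "(LINT x:?S|lborel. (norm (f x - truncate_norm (?k n) (f x)))\<^sup>2) < e / 4"
    using eventually_happens'[OF sequentially_bot] by blast
  define c where "c = (truncate_norm (?k n) :: 'a \<Rightarrow> 'a)"
  have c_cont: "continuous_on UNIV c" and c_le: "norm (c z) \<le> ?k n" for z
    unfolding c_def by (simp_all add: continuous_on_truncate_norm norm_truncate_le)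
  have [measurable]: "c \<in> borel_measurable borel" by (simp add: c_def)
  have "f \<in> borel_measurable (lebesgue_on ?S)"
    using f by (intro measurable_restrict_space1 measurable_completion) simp
  then have "f measurable_on ?S" by (simp add: measurable_on_iff_borel_measurable)
  then obtain N g where N: "negligible N" and g: "\<And>j. continuous_on UNIV (g j)"
    and lim: "\<And>x. x \<notin> N \<Longrightarrow> (\<lambda>j. g j x) \<longlonglongrightarrow> (if x \<in> ?S then f x else 0)"
    unfolding measurable_on_def by blast
  have [measurable]: "g j \<in> borel_measurable borel" for j
    by (intro borel_measurable_continuous_onI g)
  have AE_N: "AE x in lborel. x \<notin> N"
    using AE_not_in[of N lebesgue] N unfolding negligible_iff_null_sets AE_completion_iff by blast
  have bound: "(norm (c z - c w))\<^sup>2 \<le> (2 * ?k n)\<^sup>2" for z w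
    using norm_triangle_ineq4[of "c z" "c w"] c_le[of z] c_le[of w] by (intro power_mono) auto
  have intS: "set_integrable lborel ?S (\<lambda>x. K :: real)" for K
    using integrable_real_indicator[of ?S lborel]
    by (auto simp: set_integrable_def emeasure_lborel_Icc_eq)
  have dom2: "set_integrable lborel ?S (\<lambda>x. (norm (c (f x) - c (g j x)))\<^sup>2)" for j
    by (rule set_integrable_bound[OF intS[of "(2 * ?k n)\<^sup>2"]])
       (use bound in \<open>auto simp: set_borel_measurable_def\<close>)
  have "(\<lambda>j. LINT x:?S|lborel. (norm (c (f x) - c (g j x)))\<^sup>2) \<longlonglongrightarrow> (LINT x:?S|lborel. 0)"
    unfolding set_lebesgue_integral_def
  proof (rule integral_dominated_convergence[where w = "\<lambda>x. indicator ?S x *\<^sub>R (2 * ?k n)\<^sup>2"])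
    show "integrable lborel (\<lambda>x. indicator ?S x *\<^sub>R (2 * ?k n)\<^sup>2)"
      using intS unfolding set_integrable_def by blast
    show "AE x in lborel. (\<lambda>j. indicator ?S x *\<^sub>R (norm (c (f x) - c (g j x)))\<^sup>2)
        \<longlonglongrightarrow> indicator ?S x *\<^sub>R 0"
      using AE_N
    proof eventually_elim
      case (elim x)
      show ?case
      proof (cases "x \<in> ?S")
        case True
        with lim[OF elim] have "(\<lambda>j. g j x) \<longlonglongrightarrow> f x" by simp
        then have "(\<lambda>j. c (g j x)) \<longlonglongrightarrow> c (f x)"
          using c_cont by (intro continuous_on_tendsto_compose[OF c_cont]) auto
        then have "(\<lambda>j. (norm (c (f x) - c (g j x)))\<^sup>2) \<longlonglongrightarrow> (norm (c (f x) - c (f x)))\<^sup>2"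
          by (intro tendsto_intros)
        then show ?thesis using True by simp
      qed simp
    qed
    show "AE x in lborel. norm (indicator ?S x *\<^sub>R (norm (c (f x) - c (g j x)))\<^sup>2)
        \<le> indicator ?S x *\<^sub>R (2 * ?k n)\<^sup>2" for j
      using bound by (intro AE_I2) (auto simp: indicator_def)
  qed measurable
  then have "\<forall>\<^sub>F j in sequentially. (LINT x:?S|lborel. (norm (c (f x) - c (g j x)))\<^sup>2) < e / 4"
    using e by (intro order_tendstoD(2)[of _ 0]) (auto simp: set_lebesgue_integral_def)
  then obtain j where j: "(LINT x:?S|lborel. (norm (c (f x) - c (g j x)))\<^sup>2) < e / 4"
    using eventually_happens'[OF sequentially_bot] by blast
  let ?d = "\<lambda>x. 2 * (norm (f x - c (f x)))\<^sup>2 + 2 * (norm (c (f x) - c (g j x)))\<^sup>2"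
  have le: "(norm (f x - c (g j x)))\<^sup>2 \<le> ?d x" for x
    using square_norm_add_le[of "f x - c (f x)" "c (f x) - c (g j x)"] by simp
  have d: "set_integrable lborel ?S ?d"
    using dom[of n] dom2[of j] unfolding c_def
    by (intro set_integral_add set_integrable_mult_right) auto
  have int: "set_integrable lborel ?S (\<lambda>x. (norm (f x - c (g j x)))\<^sup>2)"
    by (rule set_integrable_bound[OF d]) (use le in \<open>auto simp: set_borel_measurable_def intro: order_trans[OF _ abs_ge_self]\<close>)
  have "(LINT x:?S|lborel. (norm (f x - c (g j x)))\<^sup>2) \<le> (LINT x:?S|lborel. ?d x)"
    by (intro set_integral_mono int d le)
  also have "\<dots> = 2 * (LINT x:?S|lborel. (norm (f x - c (f x)))\<^sup>2)
      + 2 * (LINT x:?S|lborel. (norm (c (f x) - c (g j x)))\<^sup>2)"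
    using dom[of n] dom2[of j] unfolding c_def
    by (subst set_integral_add) (auto intro!: set_integrable_mult_right)
  also have "\<dots> < e" using n j unfolding c_def by simp
  finally show ?thesis
    using int by (intro that[of "\<lambda>x. c (g j x)"]) (auto intro: continuous_on_compose2[OF c_cont g])
qed

section \<open>Translation in L2\<close>

text \<open>
  A crude substitute for the triangle inequality in \<open>L2\<close>: it holds pointwise and can be integrated
  term by term, which is all that the approximation arguments require.
\<close>

lemma square_norm_add3_le:
  "(norm (x + y + z :: 'a::real_normed_vector))\<^sup>2 \<le> 3 * (norm x)\<^sup>2 + 3 * (norm y)\<^sup>2 + 3 * (norm z)\<^sup>2"
proof -
  let ?a = "norm x" and ?b = "norm y" and ?c = "norm z"
  have "(norm (x + y + z))\<^sup>2 \<le> (?a + ?b + ?c)\<^sup>2"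
    by (intro power_mono order_trans[OF norm_triangle_ineq] add_right_mono norm_triangle_ineq) simp
  also have "\<dots> \<le> 3 * ?a\<^sup>2 + 3 * ?b\<^sup>2 + 3 * ?c\<^sup>2"
    using zero_le_power2[of "?a - ?b"] zero_le_power2[of "?b - ?c"] zero_le_power2[of "?a - ?c"]
    by (simp add: power2_eq_square algebra_simps)
  finally show ?thesis .
qed

lemma square_norm_weighted_sum_le:
  fixes f :: "'b \<Rightarrow> 'a::real_normed_vector"
  assumes "\<And>k. k \<in> p \<Longrightarrow> 0 \<le> c k"
  shows "(norm (\<Sum>k\<in>p. c k *\<^sub>R f k))\<^sup>2 \<le> (\<Sum>k\<in>p. c k) * (\<Sum>k\<in>p. c k * (norm (f k))\<^sup>2)"
proof -
  have "norm (\<Sum>k\<in>p. c k *\<^sub>R f k) \<le> (\<Sum>k\<in>p. sqrt (c k) * (sqrt (c k) * norm (f k)))"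
    by (rule order_trans[OF norm_sum]) (use assms in \<open>auto intro!: sum_mono simp flip: mult.assoc\<close>)
  then have "(norm (\<Sum>k\<in>p. c k *\<^sub>R f k))\<^sup>2 \<le> (\<Sum>k\<in>p. sqrt (c k) * (sqrt (c k) * norm (f k)))\<^sup>2"
    by (intro power_mono) auto
  also have "\<dots> \<le> (\<Sum>k\<in>p. (sqrt (c k))\<^sup>2) * (\<Sum>k\<in>p. (sqrt (c k) * norm (f k))\<^sup>2)"
    by (rule Cauchy_Schwarz_ineq_sum)
  also have "\<dots> = (\<Sum>k\<in>p. c k) * (\<Sum>k\<in>p. c k * (norm (f k))\<^sup>2)"
    using assms by (simp add: power_mult_distrib cong: sum.cong)
  finally show ?thesis .
qed

lemma set_integral_translate:
  fixes h :: "real \<Rightarrow> 'a::{banach, second_countable_topology}"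
  shows "(LINT x:{a<..<b}|lborel. h (x - c)) = (LINT x:{a - c<..<b - c}|lborel. h x)"
    and "set_integrable lborel {a<..<b} (\<lambda>x. h (x - c)) \<longleftrightarrow> set_integrable lborel {a - c<..<b - c} h"
proof -
  have eq: "(\<lambda>x. indicator {a - c<..<b - c} (- c + 1 * x) *\<^sub>R h (- c + 1 * x))
      = (\<lambda>x. indicat_real {a<..<b} x *\<^sub>R h (x - c))"
    by (auto simp: indicator_def fun_eq_iff)
  show "(LINT x:{a<..<b}|lborel. h (x - c)) = (LINT x:{a - c<..<b - c}|lborel. h x)"
    using lborel_integral_real_affine[of 1 "\<lambda>x. indicator {a - c<..<b - c} x *\<^sub>R h x" "- c"]
    unfolding set_lebesgue_integral_def eq by simp
  show "set_integrable lborel {a<..<b} (\<lambda>x. h (x - c)) \<longleftrightarrow> set_integrable lborel {a - c<..<b - c} h"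
    using lborel_integrable_real_affine_iff[of 1 "\<lambda>x. indicator {a - c<..<b - c} x *\<^sub>R h x" "- c"]
    unfolding set_integrable_def eq by simp
qed

lemma set_integral_translate_le:
  fixes h :: "real \<Rightarrow> real"
  assumes h: "set_integrable lborel {a..b} h" "\<And>x. 0 \<le> h x" and c: "a \<le> - c" "1 - c \<le> b"
  shows "set_integrable lborel {0<..<1} (\<lambda>x. h (x - c))"
    and "(LINT x:{0<..<1}|lborel. h (x - c)) \<le> (LINT x:{a..b}|lborel. h x)"
proof -
  have sub: "{0 - c<..<1 - c} \<subseteq> {a..b}" using c by auto
  show "set_integrable lborel {0<..<1} (\<lambda>x. h (x - c))"
    unfolding set_integral_translate(2) by (rule set_integrable_subset[OF h(1) _ sub]) simp
  show "(LINT x:{0<..<1}|lborel. h (x - c)) \<le> (LINT x:{a..b}|lborel. h x)"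
    unfolding set_integral_translate(1) by (rule set_integral_mono_subset) (use h sub in auto)
qed

lemma set_integral_mono':
  fixes f g :: "'a \<Rightarrow> real"
  assumes "set_integrable M S g" "\<And>x. x \<in> S \<Longrightarrow> f x \<le> g x" "\<And>x. x \<in> S \<Longrightarrow> 0 \<le> g x"
  shows "(LINT x:S|M. f x) \<le> (LINT x:S|M. g x)"
  using assms unfolding set_lebesgue_integral_def set_integrable_def
  by (intro integral_mono') (auto simp: indicator_def)

lemma set_integrable_const:
  assumes "S \<in> sets M" "emeasure M S < \<infinity>"
  shows "set_integrable M S (\<lambda>x. c :: 'b::{banach, second_countable_topology})"
  using assms by (auto simp: set_integrable_def intro!: integrable_scaleR_left)

text \<open>
  A continuous approximation \<open>g\<close> of \<open>f\<close> is uniformly continuous on an interval that contains all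
  relevant translates of \<open>(0,1)\<close>; the two errors \<open>f - g\<close> are small uniformly in the translation.
\<close>

lemma translation_L2_continuous:
  fixes f :: "real \<Rightarrow> 'a::euclidean_space"
  assumes f: "f \<in> borel_measurable borel" and sq: "\<And>a b. set_integrable lborel {a..b} (\<lambda>x. (norm (f x))\<^sup>2)"
    and lam: "lam > 0"
  shows "((\<lambda>t. LINT x:{0<..<1}|lborel. (norm (f (x - lam * t) - f (x - lam * s)))\<^sup>2) \<longlongrightarrow> 0) (at s)"
proof (rule LIM_I)
  fix e :: real assume e: "e > 0"
  \<comment> \<open>contains all translates of \<open>(0,1)\<close> that belong to times within distance \<open>1\<close> of \<open>s\<close>\<close>
  define a b where "a = - lam * (s + 1)" and "b = 1 - lam * (s - 1)"
  obtain g where g: "continuous_on UNIV g" "set_integrable lborel {a..b} (\<lambda>x. (norm (f x - g x))\<^sup>2)"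
    "(LINT x:{a..b}|lborel. (norm (f x - g x))\<^sup>2) < e / 9"
    using square_integrable_approx_continuous[OF f sq[of a b], of "e / 9"] e by auto
  let ?E = "LINT x:{a..b}|lborel. (norm (f x - g x))\<^sup>2"
  have "uniformly_continuous_on {a..b} g"
    using g(1) by (intro compact_uniformly_continuous) (auto intro: continuous_on_subset)
  then obtain d where d: "d > 0" "\<And>x y. x \<in> {a..b} \<Longrightarrow> y \<in> {a..b} \<Longrightarrow> dist x y < d \<Longrightarrow> dist (g x) (g y) < sqrt e / 3"
    using e by (metis uniformly_continuous_on_def real_sqrt_gt_0_iff divide_pos_pos zero_less_numeral)
  have "norm (LINT x:{0<..<1}|lborel. (norm (f (x - lam * t) - f (x - lam * s)))\<^sup>2) < e"
    if t: "\<bar>t - s\<bar> < min 1 (d / lam)" for t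
  proof -
    let ?u = "\<lambda>r x. (norm (f (x - lam * r) - g (x - lam * r)))\<^sup>2"
    have r: "set_integrable lborel {0<..<1} (?u r)" "(LINT x:{0<..<1}|lborel. ?u r x) \<le> ?E" 
        "a \<le> - (lam * r)" "1 - lam * r \<le> b"
      if "\<bar>r - s\<bar> < 1" for r
    proof -
      have "lam * r \<le> lam * (s + 1)" "lam * (s - 1) \<le> lam * r"
        using that lam by (auto intro!: mult_left_mono)
      then show ab: "a \<le> - (lam * r)" "1 - lam * r \<le> b" by (auto simp: a_def b_def)
      show "set_integrable lborel {0<..<1} (?u r)" "(LINT x:{0<..<1}|lborel. ?u r x) \<le> ?E"
        using set_integral_translate_le[OF g(2) _ ab] by auto
    qed
    have rt: "\<bar>t - s\<bar> < 1" "\<bar>s - s\<bar> < 1" using t by auto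
    define q where "q = 3 * (sqrt e / 3)\<^sup>2"
    have q_int: "set_integrable lborel {0<..<1::real} (\<lambda>x. q)"
      by (rule set_integrable_const) simp_all
    let ?w = "\<lambda>x. 3 * ?u t x + q + 3 * ?u s x"
    have w: "set_integrable lborel {0<..<1} ?w"
      by (intro set_integral_add(1) set_integrable_mult_right r(1) rt set_integrable_const)
         (auto simp: emeasure_lborel_Ioo)
    have le: "(norm (f (x - lam * t) - f (x - lam * s)))\<^sup>2 \<le> ?w x" if x: "x \<in> {0<..<1}" for x
    proof -
      have "lam * \<bar>t - s\<bar> < d" using t lam by (simp add: field_simps)
      then have "dist (x - lam * t) (x - lam * s) < d"
        using lam by (simp add: dist_real_def abs_mult abs_minus_commute flip: right_diff_distrib)
      then have "dist (g (x - lam * t)) (g (x - lam * s)) < sqrt e / 3"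
        using r(3,4)[OF rt(1)] r(3,4)[OF rt(2)] x by (intro d(2)) auto
      then have "(norm (g (x - lam * t) - g (x - lam * s)))\<^sup>2 \<le> (sqrt e / 3)\<^sup>2"
        by (intro power_mono) (auto simp: dist_norm)
      then show ?thesis
        using square_norm_add3_le[of "f (x - lam * t) - g (x - lam * t)" "g (x - lam * t) - g (x - lam * s)"
            "g (x - lam * s) - f (x - lam * s)"]
        by (simp add: norm_minus_commute q_def)
    qed
    have "(LINT x:{0<..<1}|lborel. (norm (f (x - lam * t) - f (x - lam * s)))\<^sup>2)
        \<le> (LINT x:{0<..<1}|lborel. ?w x)"
      by (intro set_integral_mono' w le) (auto simp: q_def)
    also have "\<dots> = 3 * (LINT x:{0<..<1}|lborel. ?u t x) + (LINT x:{0<..<1::real}|lborel. q)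
        + 3 * (LINT x:{0<..<1}|lborel. ?u s x)"
      using r(1)[OF rt(1)] r(1)[OF rt(2)] q_int
      by (simp only: set_integral_add set_integrable_mult_right set_integral_mult_right)
    also have "(LINT x:{0<..<1::real}|lborel. q) = e / 3"
      using e by (simp add: set_lebesgue_integral_def power_divide q_def)
    also have "3 * (LINT x:{0<..<1}|lborel. ?u t x) + e / 3 + 3 * (LINT x:{0<..<1}|lborel. ?u s x) < e"
      using r(2)[OF rt(1)] r(2)[OF rt(2)] g(3) by linarith
    finally have "(LINT x:{0<..<1}|lborel. (norm (f (x - lam * t) - f (x - lam * s)))\<^sup>2) < e" .
    moreover have "0 \<le> (LINT x:{0<..<1}|lborel. (norm (f (x - lam * t) - f (x - lam * s)))\<^sup>2)"
      unfolding set_lebesgue_integral_def by (intro integral_nonneg_AE) simp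
    ultimately show ?thesis by simp
  qed
  then show "\<exists>d>0. \<forall>t. t \<noteq> s \<and> norm (t - s) < d \<longrightarrow>
      norm ((LINT x:{0<..<1}|lborel. (norm (f (x - lam * t) - f (x - lam * s)))\<^sup>2) - 0) < e"
    using d(1) lam by (intro exI[of _ "min 1 (d / lam)"]) auto
qed

text \<open>
  Integrating a travelling wave over time at a fixed place amounts to integrating its profile over the
  window that has passed this place.
\<close>

lemma time_average_eq:
  fixes h :: "real \<Rightarrow> 'a::{banach, second_countable_topology}"
  assumes lam: "lam > 0"
  shows "inverse lam *\<^sub>R (LINT y:{x - lam * t<..<x}|lborel. h y) = (LINT r:{0<..<t}|lborel. h (x - lam * r))"
proof -
  have "x + - lam * r \<in> {x - lam * t<..<x} \<longleftrightarrow> r \<in> {0<..<t}" for r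
    using lam by (auto simp: zero_less_mult_iff)
  then have eq: "(\<lambda>r. indicator {x - lam * t<..<x} (x + - lam * r) *\<^sub>R h (x + - lam * r))
      = (\<lambda>r. indicat_real {0<..<t} r *\<^sub>R h (x - lam * r))"
    by (simp add: indicator_def fun_eq_iff)
  show ?thesis
    using lam lborel_integral_real_affine[of "- lam" "\<lambda>y. indicator {x - lam * t<..<x} y *\<^sub>R h y" x]
    unfolding set_lebesgue_integral_def eq by simp
qed

text \<open>
  For a continuous profile the Riemann sums converge uniformly in \<open>x\<close>, since on every interval of a fine
  division the integrand varies by at most \<open>\<eta>\<close>.
\<close>

lemma translation_Riemann_sums_continuous:
  fixes g :: "real \<Rightarrow> 'a::euclidean_space"
  assumes g: "continuous_on UNIV g" and lam: "lam > 0" and t: "t \<ge> 0"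
    and p: "p tagged_division_of {0..t}" and fine: "(\<lambda>r. ball r (d / lam)) fine p"
    and d: "\<And>y z. y \<in> {- lam * t..1} \<Longrightarrow> z \<in> {- lam * t..1} \<Longrightarrow> dist y z < d \<Longrightarrow> dist (g y) (g z) < \<eta>"
    and x: "x \<in> {0<..<1}"
  shows "norm ((\<Sum>(r, k)\<in>p. content k *\<^sub>R g (x - lam * r))
      - inverse lam *\<^sub>R (LINT y:{x - lam * t<..<x}|lborel. g y)) \<le> \<eta> * t"
proof -
  let ?h = "\<lambda>r. g (x - lam * r)"
  have cont: "continuous_on S ?h" for S
    by (intro continuous_on_compose2[OF g]) (auto intro!: continuous_intros)
  have int: "?h integrable_on {u..v}" for u v by (intro integrable_continuous_real cont)
  have "inverse lam *\<^sub>R (LINT y:{x - lam * t<..<x}|lborel. g y) = (LINT r:{0<..<t}|lborel. ?h r)"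
    by (rule time_average_eq[OF lam])
  also have "\<dots> = integral {0<..<t} ?h"
  proof (rule set_borel_integral_eq_integral)
    show "set_integrable lborel {0<..<t} ?h"
      by (rule set_integrable_subset[OF borel_integrable_atLeastAtMost'[OF cont[of "{0..t}"]]]) auto
  qed
  also have "\<dots> = integral {0..t} ?h" by (simp add: integral_open_interval_real)
  also have "\<dots> = (\<Sum>(r, k)\<in>p. integral k ?h)"
    using integral_combine_tagged_division_topdown[of ?h 0 t p] int p by simp
  finally have "(\<Sum>(r, k)\<in>p. content k *\<^sub>R ?h r) - inverse lam *\<^sub>R (LINT y:{x - lam * t<..<x}|lborel. g y)
      = (\<Sum>(r, k)\<in>p. content k *\<^sub>R ?h r - integral k ?h)"
    by (simp add: sum_subtractf split_beta')
  also have "norm \<dots> \<le> (\<Sum>(r, k)\<in>p. \<eta> * content k)"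
  proof (rule order_trans[OF norm_sum], rule sum_mono, clarify)
    fix r k assume rk: "(r, k) \<in> p"
    then obtain u v where k: "k = {u..v}" "u \<le> v" "r \<in> {u..v}"
      using tagged_division_ofD(2,4)[OF p rk] by (metis atLeastAtMost_iff box_real(2) order_trans)
    have sub: "{u..v} \<subseteq> {0..t}" using tagged_division_ofD(3)[OF p rk] k by simp
    have "((\<lambda>s. ?h r - ?h s) has_integral (content k *\<^sub>R ?h r - integral k ?h)) {u..v}"
      using has_integral_diff[OF has_integral_const_real[of "?h r" u v] integrable_integral[OF int[of u v]]]
      by (simp add: k)
    moreover have "norm (?h r - ?h s) \<le> \<eta>" if s: "s \<in> {u..v}" for s
    proof -
      have rs: "r \<in> {0..t}" "s \<in> {0..t}" using sub s k by auto
      then have "lam * r \<le> lam * t" "lam * s \<le> lam * t" "0 \<le> lam * r" "0 \<le> lam * s"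
        using lam by (auto intro: mult_left_mono)
      moreover have "s \<in> ball r (d / lam)" using fineD[OF fine rk] s k by blast
      then have "lam * \<bar>r - s\<bar> < d" using lam by (simp add: dist_real_def field_simps)
      then have "dist (x - lam * r) (x - lam * s) < d"
        using lam by (simp add: dist_real_def abs_mult abs_minus_commute flip: right_diff_distrib)
      ultimately have "dist (?h r) (?h s) < \<eta>" using x by (intro d) auto
      then show ?thesis by (simp add: dist_norm)
    qed
    moreover have "0 \<le> \<eta>" using \<open>u \<le> v\<close> calculation(2)[of u] norm_ge_zero order_trans by (metis atLeastAtMost_iff order_refl)
    ultimately have "norm (content k *\<^sub>R ?h r - integral k ?h) \<le> \<eta> * content {u..v}"
      by (intro has_integral_bound_real[of \<eta> "{}" "\<lambda>s. ?h r - ?h s"]) auto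
    then show "norm (content k *\<^sub>R ?h r - integral k ?h) \<le> \<eta> * content k"
      by (simp only: k(1))
  qed
  also have "\<dots> = \<eta> * t"
    using additive_content_tagged_division[of p 0 t] p t by (simp add: sum_distrib_left[symmetric] split_beta')
  finally show ?thesis .
qed

text \<open>
  Replacing \<open>f\<close> by a continuous \<open>g\<close> changes a Riemann sum by little in \<open>L2\<close>, uniformly in the division,
  since the sum is an average, with total weight \<open>t\<close>, of translates of \<open>f - g\<close>; and it changes the limit
  by little at every point.
\<close>

lemma translation_Riemann_sums_L2:
  fixes f :: "real \<Rightarrow> 'a::euclidean_space"
  assumes f: "f \<in> borel_measurable borel" and sq: "\<And>a b. set_integrable lborel {a..b} (\<lambda>x. (norm (f x))\<^sup>2)"
    and lam: "lam > 0" and t: "t \<ge> 0"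
  shows "((\<lambda>p. LINT x:{0<..<1}|lborel. (norm ((\<Sum>(r, k)\<in>p. content k *\<^sub>R f (x - lam * r))
      - inverse lam *\<^sub>R (LINT y:{x - lam * t<..<x}|lborel. f y)))\<^sup>2) \<longlongrightarrow> 0) (division_filter {0..t})"
proof (rule tendstoI)
  fix e :: real assume e: "e > 0"
  define a where "a = - lam * t"
  have a: "a \<le> 0" using lam t by (simp add: a_def)
  \<comment> \<open>bounds the effect of \<open>f - g\<close> on Riemann sum (\<open>t\<^sup>2\<close>) and limit (window inside an interval of length \<open>1 - a\<close>); the last summand makes it positive\<close>
  define K where "K = t\<^sup>2 + (1 - a) / lam\<^sup>2 + 1"
  have K: "K > 0" using a by (simp add: K_def add_nonneg_pos)
  obtain g where g: "continuous_on UNIV g" "set_integrable lborel {a..1} (\<lambda>x. (norm (f x - g x))\<^sup>2)"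
    "(LINT x:{a..1}|lborel. (norm (f x - g x))\<^sup>2) < e / (9 * K)"
    using square_integrable_approx_continuous[OF f sq[of a 1], of "e / (9 * K)"] e K by auto
  let ?E = "LINT x:{a..1}|lborel. (norm (f x - g x))\<^sup>2"
  note [measurable] = f borel_measurable_continuous_onI[OF g(1)]
  have E0: "0 \<le> ?E" unfolding set_lebesgue_integral_def by (intro integral_nonneg_AE) simp
  define \<eta> where "\<eta> = sqrt e / (3 * (t + 1))"
  have \<eta>: "\<eta> > 0" using e t by (simp add: \<eta>_def)
  have "uniformly_continuous_on {a..1} g"
    using g(1) by (intro compact_uniformly_continuous) (auto intro: continuous_on_subset)
  then obtain d where d: "d > 0" "\<And>x y. x \<in> {a..1} \<Longrightarrow> y \<in> {a..1} \<Longrightarrow> dist x y < d \<Longrightarrow> dist (g x) (g y) < \<eta>"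
    using \<eta> by (metis uniformly_continuous_on_def)
  have less: "(LINT x:{0<..<1}|lborel. (norm ((\<Sum>(r, k)\<in>p. content k *\<^sub>R f (x - lam * r))
      - inverse lam *\<^sub>R (LINT y:{x - lam * t<..<x}|lborel. f y)))\<^sup>2) < e"
    if p: "p tagged_division_of {0..t}" and fine: "(\<lambda>r. ball r (d / lam)) fine p" for p
  proof -
    let ?D = "\<lambda>x. f x - g x"
    let ?R = "\<lambda>h x. (\<Sum>(r, k)\<in>p. content k *\<^sub>R h (x - lam * r))"
    let ?I = "\<lambda>h x. inverse lam *\<^sub>R (LINT y:{x - lam * t<..<x}|lborel. h y)"
    have tags: "a \<le> - (lam * r)" "1 - lam * r \<le> 1" if "(r, k) \<in> p" for r k
    proof -
      have "r \<in> {0..t}" using tagged_division_ofD(2,3)[OF p that] by auto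
      then show "a \<le> - (lam * r)" "1 - lam * r \<le> 1" using lam by (auto simp: a_def)
    qed
    have sum_content: "(\<Sum>(r, k)\<in>p. content k) = t"
      using additive_content_tagged_division[of p 0 t] p t by simp
    let ?w1 = "\<lambda>x. t * (\<Sum>(r, k)\<in>p. content k * (norm (?D (x - lam * r)))\<^sup>2)"
    have 1: "(norm (?R ?D x))\<^sup>2 \<le> ?w1 x" for x
      using square_norm_weighted_sum_le[of p "\<lambda>(r, k). content k" "\<lambda>(r, k). ?D (x - lam * r)"] sum_content
      by (simp add: split_beta')
    have term_int: "set_integrable lborel {0<..<1} (\<lambda>x. content k * (norm (?D (x - lam * r)))\<^sup>2)"
      and term_le: "(LINT x:{0<..<1}|lborel. content k * (norm (?D (x - lam * r)))\<^sup>2) \<le> content k * ?E"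
      if "(r, k) \<in> p" for r k
      using set_integral_translate_le[OF g(2) _ tags[OF that]]
      by (auto intro!: mult_left_mono)
    have w1: "set_integrable lborel {0<..<1} ?w1"
      using term_int by (intro set_integrable_mult_right) (auto simp: set_integrable_def scaleR_sum_right
        split_beta' simp del: real_scaleR_def intro!: integrable_sum)
    have w1_le: "(LINT x:{0<..<1}|lborel. ?w1 x) \<le> t\<^sup>2 * ?E"
    proof -
      have "(LINT x:{0<..<1}|lborel. (\<Sum>(r, k)\<in>p. content k * (norm (?D (x - lam * r)))\<^sup>2))
          = (\<Sum>(r, k)\<in>p. LINT x:{0<..<1}|lborel. content k * (norm (?D (x - lam * r)))\<^sup>2)"
        unfolding set_lebesgue_integral_def scaleR_sum_right split_beta'
        by (intro Bochner_Integration.integral_sum) (use term_int in \<open>auto simp: set_integrable_def\<close>)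
      also have "\<dots> \<le> (\<Sum>(r, k)\<in>p. content k * ?E)"
        by (intro sum_mono) (use term_le in auto)
      also have "\<dots> = t * ?E"
        using sum_content by (simp add: split_beta' flip: sum_distrib_right)
      finally show ?thesis using t by (simp add: power2_eq_square mult_left_mono mult.assoc)
    qed
    have 2: "(norm (?R g x - ?I g x))\<^sup>2 \<le> (\<eta> * t)\<^sup>2" if "x \<in> {0<..<1}" for x
      by (intro power_mono translation_Riemann_sums_continuous[OF g(1) lam t p fine])
         (use d that in \<open>auto simp: a_def\<close>)
    have 3: "(norm (?I g x - ?I f x))\<^sup>2 \<le> (1 - a) / lam\<^sup>2 * ?E" if x: "x \<in> {0<..<1}" for x
    proof -
      let ?S = "{x - lam * t<..<x}"
      have sub: "?S \<subseteq> {a..1}" using x by (auto simp: a_def)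
      have "set_integrable lborel {a..1} f"
        by (rule set_integrable_if_square_integrable[OF _ _ _ sq])
           (auto simp: set_borel_measurable_def emeasure_lborel_Icc_eq)
      then have "set_integrable lborel ?S f" by (rule set_integrable_subset) (use sub in auto)
      moreover have "set_integrable lborel ?S g"
        by (rule set_integrable_subset[OF borel_integrable_atLeastAtMost'[of a 1]])
           (use sub g in \<open>auto intro: continuous_on_subset\<close>)
      ultimately have "?I g x - ?I f x = - (inverse lam *\<^sub>R (LINT y:?S|lborel. ?D y))"
        by (simp add: scaleR_diff_right)
      then have "(norm (?I g x - ?I f x))\<^sup>2 = (norm (LINT y:?S|lborel. ?D y))\<^sup>2 / lam\<^sup>2"
        by (simp add: power_mult_distrib power_inverse divide_inverse mult.commute)
      also have "\<dots> \<le> (measure lborel {a..1} * ?E) / lam\<^sup>2"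
        by (intro divide_right_mono square_set_integral_le g(2) sub)
           (auto simp: set_borel_measurable_def emeasure_lborel_Icc_eq)
      finally show ?thesis using a by simp
    qed
    let ?w = "\<lambda>x. 3 * ?w1 x + (3 * (\<eta> * t)\<^sup>2 + 3 * ((1 - a) / lam\<^sup>2 * ?E))"
    have w: "set_integrable lborel {0<..<1} ?w"
      by (intro set_integral_add(1) set_integrable_mult_right w1 set_integrable_const)
         (auto simp: emeasure_lborel_Ioo)
    have le: "(norm (?R f x - ?I f x))\<^sup>2 \<le> ?w x" if x: "x \<in> {0<..<1}" for x
    proof -
      have "?R f x - ?I f x = ?R ?D x + (?R g x - ?I g x) + (?I g x - ?I f x)"
        by (simp add: split_beta' scaleR_diff_right sum_subtractf)
      then show ?thesis
        using square_norm_add3_le[of "?R ?D x" "?R g x - ?I g x" "?I g x - ?I f x"] 1[of x] 2[OF x] 3[OF x]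
        by simp
    qed
    have "(LINT x:{0<..<1}|lborel. (norm (?R f x - ?I f x))\<^sup>2) \<le> (LINT x:{0<..<1}|lborel. ?w x)"
    proof (intro set_integral_mono' w le)
      show "0 \<le> ?w x" if "x \<in> {0<..<1}" for x using le[OF that] zero_le_power2 order_trans by blast
    qed
    also have "\<dots> = 3 * (LINT x:{0<..<1}|lborel. ?w1 x) + (3 * (\<eta> * t)\<^sup>2 + 3 * ((1 - a) / lam\<^sup>2 * ?E))"
      using w1 by (subst set_integral_add(2))
        (auto intro!: set_integrable_const simp: emeasure_lborel_Ioo set_lebesgue_integral_def[of _ _ "\<lambda>x. _ + _"])
    also have "\<dots> \<le> 3 * (\<eta> * t)\<^sup>2 + 3 * (K * ?E)"
      using w1_le E0 by (simp add: K_def algebra_simps)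
    also have "K * ?E < e / 9"
      using g(3) K by (simp add: field_simps)
    also have "(\<eta> * t)\<^sup>2 \<le> (sqrt e / 3)\<^sup>2"
      using \<eta> t e by (intro power_mono) (auto simp: \<eta>_def field_simps)
    finally show ?thesis using e by (simp add: power_divide)
  qed
  have nonneg: "0 \<le> (LINT x:{0<..<1}|lborel. (norm ((\<Sum>(r, k)\<in>p. content k *\<^sub>R f (x - lam * r))
      - inverse lam *\<^sub>R (LINT y:{x - lam * t<..<x}|lborel. f y)))\<^sup>2)" for p
    unfolding set_lebesgue_integral_def by (intro integral_nonneg_AE) simp
  show "\<forall>\<^sub>F p in division_filter {0..t}. dist (LINT x:{0<..<1}|lborel.
      (norm ((\<Sum>(r, k)\<in>p. content k *\<^sub>R f (x - lam * r))
      - inverse lam *\<^sub>R (LINT y:{x - lam * t<..<x}|lborel. f y)))\<^sup>2) 0 < e"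
    unfolding eventually_division_filter
  proof (intro exI[of _ "\<lambda>r. ball r (d / lam)"] conjI allI impI)
    show "gauge (\<lambda>r. ball r (d / lam))" using d(1) lam by (intro gauge_ball_dependent) simp
  qed (elim conjE, simp only: dist_real_def diff_0_right abs_of_nonneg[OF nonneg] less)
qed

section \<open>Vector-valued functions\<close>

lemma set_lebesgue_borel:
  fixes f :: "'a::euclidean_space \<Rightarrow> 'b::{banach, second_countable_topology}"
  assumes [measurable]: "f \<in> borel_measurable borel" "S \<in> sets borel"
  shows "set_borel_measurable lebesgue S f"
    and "set_integrable lebesgue S f \<longleftrightarrow> set_integrable lborel S f"
    and "(LINT x:S|lebesgue. f x) = (LINT x:S|lborel. f x)"
proof -
  have *: "(\<lambda>x. indicator S x *\<^sub>R f x) \<in> borel_measurable lborel" by measurable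
  show "set_borel_measurable lebesgue S f"
    unfolding set_borel_measurable_def by (rule measurable_completion[OF *])
  show "set_integrable lebesgue S f \<longleftrightarrow> set_integrable lborel S f"
    unfolding set_integrable_def by (rule integrable_completion[OF *])
  show "(LINT x:S|lebesgue. f x) = (LINT x:S|lborel. f x)"
    unfolding set_lebesgue_integral_def by (rule integral_completion[OF *])
qed

lemma set_integrable_lborel_imp_lebesgue:
  fixes f :: "'a::euclidean_space \<Rightarrow> 'b::{banach, second_countable_topology}"
  assumes "set_integrable lborel S f"
  shows "set_integrable lebesgue S f"
proof -
  have *: "integrable lborel (\<lambda>x. indicator S x *\<^sub>R f x)" using assms by (simp add: set_integrable_def)
  then show ?thesis
    unfolding set_integrable_def by (simp only: integrable_completion[OF borel_measurable_integrable[OF *]])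
qed

text \<open>
  Borel measurability, rather than Lebesgue measurability, makes composition with affine maps and
  integrals depending on a parameter unproblematic.
\<close>

definition locally_L2 :: "nat \<Rightarrow> (real \<Rightarrow> complex vec) \<Rightarrow> bool" where
  "locally_L2 n f \<longleftrightarrow> (\<forall>x. f x \<in> carrier_vec n) \<and>
     (\<forall>i<n. (\<lambda>x. f x $ i) \<in> borel_measurable borel \<and>
       (\<forall>a b. set_integrable lborel {a..b} (\<lambda>x. (cmod (f x $ i))\<^sup>2)))"

lemma locally_L2D:
  assumes "locally_L2 n f"
  shows "f x \<in> carrier_vec n" "i < n \<Longrightarrow> (\<lambda>x. f x $ i) \<in> borel_measurable borel"
    "i < n \<Longrightarrow> set_integrable lborel {a..b} (\<lambda>x. (cmod (f x $ i))\<^sup>2)"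
  using assms by (auto simp: locally_L2_def)

lemma locally_L2_integrable:
  assumes "locally_L2 n f" "i < n" "S \<in> sets borel" "S \<subseteq> {a..b}"
  shows "set_integrable lborel S (\<lambda>x. f x $ i)"
proof (rule set_integrable_subset[of _ "{a..b}"])
  note [measurable] = locally_L2D(2)[OF assms(1,2)]
  show "set_integrable lborel {a..b} (\<lambda>x. f x $ i)"
    by (rule set_integrable_if_square_integrable[OF _ _ _ locally_L2D(3)[OF assms(1,2)]])
       (auto simp: set_borel_measurable_def emeasure_lborel_Icc_eq)
qed (use assms in auto)

lemma locally_L2_imp_L2_on:
  assumes "locally_L2 n f" "S \<in> sets borel" "S \<subseteq> {a..b}"
  shows "L2_on S n f"
  unfolding L2_on_def
proof (intro conjI ballI allI impI)
  fix i assume i: "i < n"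
  note [measurable] = locally_L2D(2)[OF assms(1) i] assms(2)
  show "set_borel_measurable lebesgue S (\<lambda>x. f x $ i)" by (intro set_lebesgue_borel) measurable
  have "set_integrable lborel S (\<lambda>x. (cmod (f x $ i))\<^sup>2)"
    by (rule set_integrable_subset[OF locally_L2D(3)[OF assms(1) i]]) (use assms in auto)
  then show "set_integrable lebesgue S (\<lambda>x. (cmod (f x $ i))\<^sup>2)"
    by (subst set_lebesgue_borel(2)) measurable
qed (use locally_L2D(1)[OF assms(1)] in auto)

lemma locally_L2_affine:
  assumes f: "locally_L2 n f" and c: "c \<noteq> 0"
  shows "locally_L2 n (\<lambda>x. f (d + c * x))"
  unfolding locally_L2_def
proof (intro conjI allI impI)
  fix i assume i: "i < n"
  note [measurable] = locally_L2D(2)[OF f i]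
  show "(\<lambda>x. f (d + c * x) $ i) \<in> borel_measurable borel" by measurable
  fix a b
  define u v where "u = min (d + c * a) (d + c * b)" and "v = max (d + c * a) (d + c * b)"
  have "integrable lborel (\<lambda>x. indicator {u..v} (d + c * x) *\<^sub>R (cmod (f (d + c * x) $ i))\<^sup>2)"
    unfolding lborel_integrable_real_affine_iff[OF c, of "\<lambda>x. indicator {u..v} x *\<^sub>R (cmod (f x $ i))\<^sup>2" d]
    using locally_L2D(3)[OF f i, of u v] unfolding set_integrable_def .
  moreover have "indicat_real {u..v} (d + c * x) = indicator {x. d + c * x \<in> {u..v}} x" for x
    by (simp add: indicator_def)
  ultimately have "set_integrable lborel {x. d + c * x \<in> {u..v}} (\<lambda>x. (cmod (f (d + c * x) $ i))\<^sup>2)"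
    unfolding set_integrable_def by (simp only:)
  note wide = this
  have "{a..b} \<subseteq> {x. d + c * x \<in> {u..v}}"
  proof
    fix x assume x: "x \<in> {a..b}"
    show "x \<in> {x. d + c * x \<in> {u..v}}"
    proof (cases "c > 0")
      case True
      then have "c * a \<le> c * x" "c * x \<le> c * b" using x by auto
      then show ?thesis by (auto simp: u_def v_def)
    next
      case False
      then have "c * b \<le> c * x" "c * x \<le> c * a" using x by (auto intro: mult_left_mono_neg)
      then show ?thesis by (auto simp: u_def v_def)
    qed
  qed
  from set_integrable_subset[OF wide _ this]
  show "set_integrable lborel {a..b} (\<lambda>x. (cmod (f (d + c * x) $ i))\<^sup>2)"
    by simp
qed (use locally_L2D(1)[OF f] in auto)

lemma index_mult_mat_vec_sum:
  "M \<in> carrier_mat r n \<Longrightarrow> v \<in> carrier_vec n \<Longrightarrow> i < r \<Longrightarrow> (M *\<^sub>v v) $ i = (\<Sum>j<n. M $$ (i, j) * v $ j)"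
  by (simp add: scalar_prod_def atLeast0LessThan)

lemma locally_L2_mult_mat:
  assumes f: "locally_L2 n f" and M: "M \<in> carrier_mat r n"
  shows "locally_L2 r (\<lambda>x. M *\<^sub>v f x)"
  unfolding locally_L2_def
proof (intro conjI allI impI)
  fix i assume i: "i < r"
  note eq = index_mult_mat_vec_sum[OF M locally_L2D(1)[OF f] i]
  show meas: "(\<lambda>x. (M *\<^sub>v f x) $ i) \<in> borel_measurable borel"
    unfolding eq by (intro borel_measurable_sum borel_measurable_times borel_measurable_const locally_L2D(2)[OF f]) auto
  fix a b
  let ?w = "\<lambda>x. (\<Sum>j<n. (cmod (M $$ (i, j)))\<^sup>2) * (\<Sum>j<n. (cmod (f x $ j))\<^sup>2)"
  show "set_integrable lborel {a..b} (\<lambda>x. (cmod ((M *\<^sub>v f x) $ i))\<^sup>2)"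
  proof (rule set_integrable_bound[where f = ?w])
    have "set_integrable lborel {a..b} (\<lambda>x. \<Sum>j<n. (cmod (f x $ j))\<^sup>2)"
      using locally_L2D(3)[OF f] unfolding set_integrable_def scaleR_sum_right
      by (intro Bochner_Integration.integrable_sum) auto
    then show "set_integrable lborel {a..b} ?w" by (rule set_integrable_mult_right)
    show "set_borel_measurable lborel {a..b} (\<lambda>x. (cmod ((M *\<^sub>v f x) $ i))\<^sup>2)"
      unfolding set_borel_measurable_def using meas by (auto simp del: index_mult_mat_vec)
    have "(cmod ((M *\<^sub>v f x) $ i))\<^sup>2 \<le> ?w x" for x
    proof -
      have "cmod ((M *\<^sub>v f x) $ i) \<le> (\<Sum>j<n. cmod (M $$ (i, j)) * cmod (f x $ j))"
        unfolding eq by (rule order_trans[OF norm_sum]) (simp add: norm_mult)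
      then have "(cmod ((M *\<^sub>v f x) $ i))\<^sup>2 \<le> (\<Sum>j<n. cmod (M $$ (i, j)) * cmod (f x $ j))\<^sup>2"
        by (intro power_mono) auto
      also have "\<dots> \<le> ?w x" by (rule Cauchy_Schwarz_ineq_sum)
      finally show ?thesis .
    qed
    then show "AE x in lborel. x \<in> {a..b} \<longrightarrow> norm ((cmod ((M *\<^sub>v f x) $ i))\<^sup>2) \<le> norm (?w x)"
      by (intro AE_I2) (auto intro: order_trans[OF _ abs_ge_self] simp del: index_mult_mat_vec)
  qed
qed (rule mult_mat_vec_carrier[OF M locally_L2D(1)[OF f]])

text \<open>
  Boundary condition and output of the integrated state are the time integrals of the corresponding
  pointwise expressions.
\<close>

lemma vec_integral_boundary_combination:
  assumes f: "\<And>i. i < n \<Longrightarrow> set_integrable lebesgue S (\<lambda>x. f x $ i)" "\<And>x. x \<in> S \<Longrightarrow> f x \<in> carrier_vec n"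
    and g: "\<And>i. i < n \<Longrightarrow> set_integrable lebesgue S (\<lambda>x. g x $ i)" "\<And>x. x \<in> S \<Longrightarrow> g x \<in> carrier_vec n"
    and M: "M \<in> carrier_mat r n" and N: "N \<in> carrier_mat r n" and S: "S \<in> sets lebesgue"
  shows "c \<cdot>\<^sub>v (M *\<^sub>v vec_integral S n f) - d \<cdot>\<^sub>v (N *\<^sub>v vec_integral S n g)
    = vec_integral S r (\<lambda>x. c \<cdot>\<^sub>v (M *\<^sub>v f x) - d \<cdot>\<^sub>v (N *\<^sub>v g x))"
proof (rule eq_vecI)
  fix i assume "i < dim_vec (vec_integral S r (\<lambda>x. c \<cdot>\<^sub>v (M *\<^sub>v f x) - d \<cdot>\<^sub>v (N *\<^sub>v g x)))"
  then have i: "i < r" by (simp add: vec_integral_def)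
  have comp: "(M *\<^sub>v vec_integral S n f) $ i = (LINT x:S|lebesgue. (\<Sum>j<n. M $$ (i, j) * f x $ j))"
    and comp_int: "set_integrable lebesgue S (\<lambda>x. \<Sum>j<n. M $$ (i, j) * f x $ j)"
    if f: "\<And>i. i < n \<Longrightarrow> set_integrable lebesgue S (\<lambda>x. f x $ i)" and M: "M \<in> carrier_mat r n" for f M
  proof -
    have int: "integrable lebesgue (\<lambda>x. indicator S x *\<^sub>R (M $$ (i, j) * f x $ j))" if "j < n" for j
      using set_integrable_mult_right[OF f[OF that], of "M $$ (i, j)"] by (simp add: set_integrable_def)
    have "(M *\<^sub>v vec_integral S n f) $ i = (\<Sum>j<n. M $$ (i, j) * (LINT x:S|lebesgue. f x $ j))"
      by (subst index_mult_mat_vec_sum[OF M _ i]) (auto simp: vec_integral_def)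
    also have "\<dots> = (\<Sum>j<n. LINT x:S|lebesgue. M $$ (i, j) * f x $ j)"
      by simp
    also have "\<dots> = (LINT x:S|lebesgue. (\<Sum>j<n. M $$ (i, j) * f x $ j))"
      unfolding set_lebesgue_integral_def scaleR_sum_right
      by (rule Bochner_Integration.integral_sum[symmetric]) (use int in auto)
    finally show "(M *\<^sub>v vec_integral S n f) $ i = (LINT x:S|lebesgue. (\<Sum>j<n. M $$ (i, j) * f x $ j))" .
    show "set_integrable lebesgue S (\<lambda>x. \<Sum>j<n. M $$ (i, j) * f x $ j)"
      unfolding set_integrable_def scaleR_sum_right using int by (intro Bochner_Integration.integrable_sum) auto
  qed
  have "(c \<cdot>\<^sub>v (M *\<^sub>v vec_integral S n f) - d \<cdot>\<^sub>v (N *\<^sub>v vec_integral S n g)) $ i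
      = c * (M *\<^sub>v vec_integral S n f) $ i - d * (N *\<^sub>v vec_integral S n g) $ i"
    using M N i by (simp del: index_mult_mat_vec)
  also have "\<dots> = (LINT x:S|lebesgue. c * (\<Sum>j<n. M $$ (i, j) * f x $ j) - d * (\<Sum>j<n. N $$ (i, j) * g x $ j))"
  proof -
    have "set_integrable lebesgue S (\<lambda>x. c * (\<Sum>j<n. M $$ (i, j) * f x $ j))"
      "set_integrable lebesgue S (\<lambda>x. d * (\<Sum>j<n. N $$ (i, j) * g x $ j))"
      using f g M N by (auto intro!: set_integrable_mult_right comp_int)
    moreover have "(M *\<^sub>v vec_integral S n f) $ i = (LINT x:S|lebesgue. (\<Sum>j<n. M $$ (i, j) * f x $ j))"
      "(N *\<^sub>v vec_integral S n g) $ i = (LINT x:S|lebesgue. (\<Sum>j<n. N $$ (i, j) * g x $ j))"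
      using f g M N by (auto intro!: comp simp del: index_mult_mat_vec)
    ultimately show ?thesis by (simp only: set_integral_diff set_integral_mult_right)
  qed
  also have "\<dots> = (LINT x:S|lebesgue. (c \<cdot>\<^sub>v (M *\<^sub>v f x) - d \<cdot>\<^sub>v (N *\<^sub>v g x)) $ i)"
  proof (rule set_lebesgue_integral_cong[OF S], intro allI impI)
    fix x assume x: "x \<in> S"
    have "(c \<cdot>\<^sub>v (M *\<^sub>v f x) - d \<cdot>\<^sub>v (N *\<^sub>v g x)) $ i = c * (M *\<^sub>v f x) $ i - d * (N *\<^sub>v g x) $ i"
      using M N i by (simp del: index_mult_mat_vec)
    then show "c * (\<Sum>j<n. M $$ (i, j) * f x $ j) - d * (\<Sum>j<n. N $$ (i, j) * g x $ j)
        = (c \<cdot>\<^sub>v (M *\<^sub>v f x) - d \<cdot>\<^sub>v (N *\<^sub>v g x)) $ i"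
      using index_mult_mat_vec_sum[OF M f(2)[OF x] i] index_mult_mat_vec_sum[OF N g(2)[OF x] i] by simp
  qed
  finally show "(c \<cdot>\<^sub>v (M *\<^sub>v vec_integral S n f) - d \<cdot>\<^sub>v (N *\<^sub>v vec_integral S n g)) $ i
      = vec_integral S r (\<lambda>x. c \<cdot>\<^sub>v (M *\<^sub>v f x) - d \<cdot>\<^sub>v (N *\<^sub>v g x)) $ i"
    using i by (simp add: vec_integral_def)
qed (use M N in \<open>auto simp: vec_integral_def\<close>)

lemma state_norm_tendsto_zero:
  assumes "\<And>i. i < n \<Longrightarrow> ((\<lambda>t. LINT x:{0<..<1}|lebesgue. (cmod (f t x $ i))\<^sup>2) \<longlongrightarrow> 0) F"
  shows "((\<lambda>t. state_norm n (f t)) \<longlongrightarrow> 0) F"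
proof -
  have "((\<lambda>t. sqrt (\<Sum>i<n. LINT x:{0<..<1}|lebesgue. (cmod (f t x $ i))\<^sup>2)) \<longlongrightarrow> sqrt (\<Sum>i<n. 0)) F"
    using assms by (intro tendsto_real_sqrt tendsto_sum) auto
  then show ?thesis by (simp add: state_norm_def)
qed

lemma square_component_le_state_norm:
  assumes "i < n"
  shows "(LINT x:{0<..<1}|lebesgue. (cmod (f x $ i))\<^sup>2) \<le> (state_norm n f)\<^sup>2"
proof -
  have nonneg: "0 \<le> (LINT x:{0<..<1}|lebesgue. (cmod (f x $ j))\<^sup>2)" for j
    unfolding set_lebesgue_integral_def by (intro integral_nonneg_AE) simp
  have "(LINT x:{0<..<1}|lebesgue. (cmod (f x $ i))\<^sup>2) \<le> (\<Sum>j<n. LINT x:{0<..<1}|lebesgue. (cmod (f x $ j))\<^sup>2)"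
    using assms nonneg by (intro member_le_sum) auto
  then show ?thesis by (simp add: state_norm_def sum_nonneg nonneg)
qed

text \<open>
  Connects the integrals over open intervals that occur in the definition of \<open>H1\<close> with the indefinite
  integral on closed intervals, for which continuity and the fundamental theorem are available.
\<close>

lemma set_integral_Ioo_eq_integral:
  fixes g :: "real \<Rightarrow> complex"
  assumes g: "set_integrable lebesgue {0<..<1} g"
  shows "g absolutely_integrable_on {0..1}"
    and "0 \<le> x \<Longrightarrow> x \<le> 1 \<Longrightarrow> (LINT y:{0<..<x}|lebesgue. g y) = integral {0..x} g"
    and "continuous_on {0..1} (\<lambda>x. LINT y:{0<..<x}|lebesgue. g y)"
proof -
  show *: "g absolutely_integrable_on {0..1}"
    using g absolutely_integrable_on_open_interval[where f = g and a = 0 and b = 1] by simp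
  show eq: "(LINT y:{0<..<x}|lebesgue. g y) = integral {0..x} g" if "0 \<le> x" "x \<le> 1" for x
  proof -
    have "set_integrable lebesgue {0<..<x} g"
      by (rule set_integrable_subset[OF g]) (use that in auto)
    then show ?thesis by (simp add: set_lebesgue_integral_eq_integral integral_open_interval_real)
  qed
  have "continuous_on {0..1} (\<lambda>x. integral {0..x} g)"
    using set_lebesgue_integral_eq_integral(1)[OF *] by (rule indefinite_integral_continuous_1)
  then show "continuous_on {0..1} (\<lambda>x. LINT y:{0<..<x}|lebesgue. g y)"
    by (rule continuous_on_eq) (use eq in auto)
qed

lemma L2_on_unit_integrable:
  assumes "L2_on {0<..<1} n f" "i < n"
  shows "set_integrable lebesgue {0<..<1} (\<lambda>x. f x $ i)"
  by (rule set_integrable_if_square_integrable) (use assms in \<open>auto simp: L2_on_def\<close>)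

lemma has_H1_derivative_carrier:
  assumes "has_H1_derivative n f g" "x \<in> {0..1}"
  shows "f x \<in> carrier_vec n"
proof -
  have "f x = f 0 + vec_integral {0<..<x} n g" "f 0 \<in> carrier_vec n"
    using assms unfolding has_H1_derivative_def by blast+
  then show ?thesis by (metis add_carrier_vec vec_carrier vec_integral_def)
qed

lemma has_H1_derivative_index:
  assumes "has_H1_derivative n f g" "x \<in> {0..1}" "i < n"
  shows "f x $ i = f 0 $ i + (LINT y:{0<..<x}|lebesgue. g y $ i)"
proof -
  have "f x = f 0 + vec_integral {0<..<x} n g" "f 0 \<in> carrier_vec n"
    using assms unfolding has_H1_derivative_def by blast+
  then have "f x $ i = (f 0 + vec_integral {0<..<x} n g) $ i" by metis
  then show ?thesis using assms(3) by (simp add: vec_integral_def)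
qed

lemma has_H1_derivative_continuous:
  assumes "has_H1_derivative n f g" "i < n"
  shows "continuous_on {0..1} (\<lambda>x. f x $ i)"
proof -
  have "set_integrable lebesgue {0<..<1} (\<lambda>x. g x $ i)"
    using assms unfolding has_H1_derivative_def by (intro L2_on_unit_integrable[of n]) blast+
  then have "continuous_on {0..1} (\<lambda>x. f 0 $ i + (LINT y:{0<..<x}|lebesgue. g y $ i))"
    by (intro continuous_on_add continuous_on_const set_integral_Ioo_eq_integral(3))
  then show ?thesis
    by (rule continuous_on_eq) (rule has_H1_derivative_index[OF assms(1) _ assms(2), symmetric])
qed

lemma has_H1_derivative_L2:
  assumes "has_H1_derivative n f g"
  shows "L2_on {0<..<1} n f"
  unfolding L2_on_def
proof (intro conjI ballI allI impI)
  fix i assume i: "i < n"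
  note cont = has_H1_derivative_continuous[OF assms i]
  have "set_integrable lborel {0..1} (\<lambda>x. f x $ i)"
    by (rule borel_integrable_atLeastAtMost'[OF cont])
  then have "set_integrable lebesgue {0..1} (\<lambda>x. f x $ i)"
    by (rule set_integrable_lborel_imp_lebesgue)
  then have "set_integrable lebesgue {0<..<1} (\<lambda>x. f x $ i)"
    by (rule set_integrable_subset) auto
  then show "set_borel_measurable lebesgue {0<..<1} (\<lambda>x. f x $ i)"
    unfolding set_borel_measurable_def set_integrable_def by (rule borel_measurable_integrable)
  have "set_integrable lborel {0..1} (\<lambda>x. (cmod (f x $ i))\<^sup>2)"
    by (rule borel_integrable_atLeastAtMost'[OF continuous_on_power[OF continuous_on_norm[OF cont]]])
  then have "set_integrable lebesgue {0..1} (\<lambda>x. (cmod (f x $ i))\<^sup>2)"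
    by (rule set_integrable_lborel_imp_lebesgue)
  then show "set_integrable lebesgue {0<..<1} (\<lambda>x. (cmod (f x $ i))\<^sup>2)"
    by (rule set_integrable_subset) auto
qed (use has_H1_derivative_carrier[OF assms] in auto)

section \<open>Travelling waves are mild solutions\<close>

lemma L2_on_borel_version:
  assumes "L2_on {0<..<1} n f"
  obtains g where "locally_L2 n g" "AE x\<in>{0<..<1} in lebesgue. g x = f x"
proof -
  let ?h = "\<lambda>i x. indicat_real {0<..<1} x *\<^sub>R f x $ i"
  have h: "?h i \<in> borel_measurable lebesgue" if "i < n" for i
    using assms that by (auto simp: L2_on_def set_borel_measurable_def)
  have "\<exists>g. g \<in> borel_measurable lborel \<and> (AE x in lebesgue. ?h i x = g x)" if i: "i < n" for i
  proof -
    have "(\<lambda>x. Re (?h i x)) \<in> borel_measurable lebesgue" "(\<lambda>x. Im (?h i x)) \<in> borel_measurable lebesgue"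
      by (rule measurable_compose[OF h[OF i] borel_measurable_continuous_onI[OF continuous_on_Re[OF continuous_on_id]]])
        (rule measurable_compose[OF h[OF i] borel_measurable_continuous_onI[OF continuous_on_Im[OF continuous_on_id]]])
    from this[THEN completion_ex_borel_measurable_real]
    obtain r s where rs: "r \<in> borel_measurable lborel" "AE x in lborel. Re (?h i x) = r x"
      "s \<in> borel_measurable lborel" "AE x in lborel. Im (?h i x) = s x"
      by blast
    have "AE x in lborel. ?h i x = complex_of_real (r x) + \<i> * complex_of_real (s x)"
      using rs(2,4) by eventually_elim (simp add: complex_eq_iff)
    moreover have "(\<lambda>x. complex_of_real (r x) + \<i> * complex_of_real (s x)) \<in> borel_measurable lborel"
      using rs(1,3) by measurable
    ultimately show ?thesis unfolding AE_completion_iff by blast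
  qed
  then obtain G where G: "\<And>i. i < n \<Longrightarrow> G i \<in> borel_measurable lborel"
    "\<And>i. i < n \<Longrightarrow> AE x in lebesgue. ?h i x = G i x"
    by metis
  have "locally_L2 n (\<lambda>x. vec n (\<lambda>i. G i x))"
    unfolding locally_L2_def
  proof (intro conjI allI impI)
    fix i assume i: "i < n"
    have [measurable]: "G i \<in> borel_measurable borel" using G(1)[OF i] by simp
    show "(\<lambda>x. vec n (\<lambda>i. G i x) $ i) \<in> borel_measurable borel" using i by simp
    have "integrable lebesgue (\<lambda>x. indicat_real {0<..<1} x *\<^sub>R (cmod (f x $ i))\<^sup>2)"
      using assms i by (auto simp: L2_on_def set_integrable_def)
    also have "(\<lambda>x. indicat_real {0<..<1} x *\<^sub>R (cmod (f x $ i))\<^sup>2) = (\<lambda>x. (cmod (?h i x))\<^sup>2)"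
      by (auto simp: indicator_def fun_eq_iff)
    also have "integrable lebesgue \<dots> \<longleftrightarrow> integrable lebesgue (\<lambda>x. (cmod (G i x))\<^sup>2)"
    proof (rule integrable_cong_AE)
      show "(\<lambda>x. (cmod (G i x))\<^sup>2) \<in> borel_measurable lebesgue"
        by (intro measurable_completion) measurable
      show "AE x in lebesgue. (cmod (?h i x))\<^sup>2 = (cmod (G i x))\<^sup>2"
        using G(2)[OF i] by eventually_elim simp
    qed (use h[OF i] in measurable)
    also have "\<dots> \<longleftrightarrow> integrable lborel (\<lambda>x. (cmod (G i x))\<^sup>2)"
      by (intro integrable_completion) measurable
    finally have "integrable lborel (\<lambda>x. (cmod (G i x))\<^sup>2)" .
    then show "set_integrable lborel {a..b} (\<lambda>x. (cmod (vec n (\<lambda>i. G i x) $ i))\<^sup>2)" for a b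
      using i integrable_mult_indicator[of "{a..b}" lborel, OF _ \<open>integrable lborel _\<close>]
      unfolding set_integrable_def by simp
  qed simp
  moreover have "AE x in lebesgue. \<forall>i\<in>{..<n}. ?h i x = G i x"
    using G(2) by (intro AE_finite_allI) auto
  then have "AE x\<in>{0<..<1} in lebesgue. vec n (\<lambda>i. G i x) = f x"
  proof eventually_elim
    case (elim x)
    show ?case
    proof
      assume x: "x \<in> {0<..<1}"
      then have "f x \<in> carrier_vec n" using assms by (auto simp: L2_on_def)
      then show "vec n (\<lambda>i. G i x) = f x" using elim x by (intro eq_vecI) auto
    qed
  qed
  ultimately show ?thesis by (rule that)
qed

text \<open>
  The change of the integral over a window of length \<open>c\<close> when the window moves from \<open>(-c,0)\<close> to
  \<open>(x - c,x)\<close>: what enters on the right minus what leaves on the left.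
\<close>

lemma set_integral_sliding_window:
  fixes h :: "real \<Rightarrow> complex"
  assumes h: "\<And>a b. set_integrable lborel {a..b} h" and x: "0 \<le> x" and c: "0 \<le> c"
  shows "(LINT y:{x - c<..<x}|lborel. h y)
    = (LINT y:{- c<..<0}|lborel. h y) + (LINT y:{0<..<x}|lborel. h y - h (y - c))"
proof -
  have int: "h integrable_on {a..b}" for a b
    using set_borel_integral_eq_integral(1)[OF h] .
  have sub: "set_integrable lborel {a<..<b} h" for a b
    by (rule set_integrable_subset[OF h[of a b]]) auto
  have eq: "(LINT y:{a<..<b}|lborel. h y) = integral {a..b} h" for a b
    using set_borel_integral_eq_integral(2)[OF sub] by (simp add: integral_open_interval_real)
  have diff: "(LINT y:{0<..<x}|lborel. h y - h (y - c))
      = (LINT y:{0<..<x}|lborel. h y) - (LINT y:{0 - c<..<x - c}|lborel. h y)"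
    using sub[of 0 x] sub[of "0 - c" "x - c"]
    by (simp only: set_integral_diff set_integral_translate)
  have "integral {- c..0} h + integral {0..x} h = integral {- c..x} h"
    by (rule Henstock_Kurzweil_Integration.integral_combine[OF _ _ int]) (use x c in auto)
  moreover have "integral {- c..x - c} h + integral {x - c..x} h = integral {- c..x} h"
    by (rule Henstock_Kurzweil_Integration.integral_combine[OF _ _ int]) (use x c in auto)
  ultimately show ?thesis unfolding diff by (simp add: eq algebra_simps)
qed

context
  fixes f :: "real \<Rightarrow> complex vec" and n :: nat and lam :: real
  assumes f: "locally_L2 n f" and lam: "lam > 0"
begin

lemma dim_wave: "dim_vec (f x) = n"
  using locally_L2D(1)[OF f] by simp

lemma shifted_locally_L2: "locally_L2 n (\<lambda>x. f (x - c))"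
  using locally_L2_affine[OF f, of 1 "- c"] by simp

lemma travelling_wave_state_continuous: "state_continuous n (\<lambda>t \<zeta>. f (\<zeta> - lam * t))"
  unfolding state_continuous_def
proof (intro conjI allI impI)
  show "(\<lambda>\<zeta>. f (\<zeta> - lam * t)) \<in> state_space n" for t
    using locally_L2_imp_L2_on[OF shifted_locally_L2[of "lam * t"], of "{0<..<1}" 0 1]
    by (simp add: greaterThanLessThan_subseteq_atLeastAtMost_iff)
next
  fix s :: real
  have "((\<lambda>t. state_norm n (\<lambda>\<zeta>. f (\<zeta> - lam * t) - f (\<zeta> - lam * s))) \<longlongrightarrow> 0) (at s)"
  proof (rule state_norm_tendsto_zero)
    fix i assume i: "i < n"
    note [measurable] = locally_L2D(2)[OF f i]
    have "(f (\<zeta> - lam * t) - f (\<zeta> - lam * s)) $ i = f (\<zeta> - lam * t) $ i - f (\<zeta> - lam * s) $ i" for t \<zeta>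
      using i by (simp add: dim_wave)
    then have "(LINT \<zeta>:{0<..<1}|lebesgue. (cmod ((f (\<zeta> - lam * t) - f (\<zeta> - lam * s)) $ i))\<^sup>2)
        = (LINT \<zeta>:{0<..<1}|lborel. (cmod (f (\<zeta> - lam * t) $ i - f (\<zeta> - lam * s) $ i))\<^sup>2)" for t
      by (simp only:) (rule set_lebesgue_borel(3); measurable)
    then show "((\<lambda>t. LINT \<zeta>:{0<..<1}|lebesgue. (cmod ((f (\<zeta> - lam * t) - f (\<zeta> - lam * s)) $ i))\<^sup>2) \<longlongrightarrow> 0) (at s)"
      using translation_L2_continuous[OF locally_L2D(2)[OF f i] locally_L2D(3)[OF f i] lam, of s] by simp
  qed
  then show "((\<lambda>t. state_norm n (\<lambda>\<zeta>. f (\<zeta> - lam * t) - f (\<zeta> - lam * s))) \<longlongrightarrow> 0) (at s within {0..})"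
    by (rule filterlim_mono[OF _ order_refl]) (simp add: at_le)
qed

definition wave_integral :: "real \<Rightarrow> real \<Rightarrow> complex vec" where
  "wave_integral t \<zeta> = vec_integral {0<..<t} n (\<lambda>r. f (\<zeta> - lam * r))"

lemma wave_integral_index:
  assumes "i < n"
  shows "wave_integral t \<zeta> $ i = (LINT r:{0<..<t}|lborel. f (\<zeta> - lam * r) $ i)"
    and "wave_integral t \<zeta> $ i = inverse lam *\<^sub>R (LINT y:{\<zeta> - lam * t<..<\<zeta>}|lborel. f y $ i)"
proof -
  note [measurable] = locally_L2D(2)[OF f assms]
  have "(LINT r:{0<..<t}|lebesgue. f (\<zeta> - lam * r) $ i) = (LINT r:{0<..<t}|lborel. f (\<zeta> - lam * r) $ i)"
    by (rule set_lebesgue_borel(3); measurable)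
  then show "wave_integral t \<zeta> $ i = (LINT r:{0<..<t}|lborel. f (\<zeta> - lam * r) $ i)"
    using assms by (simp add: wave_integral_def vec_integral_def)
  then show "wave_integral t \<zeta> $ i = inverse lam *\<^sub>R (LINT y:{\<zeta> - lam * t<..<\<zeta>}|lborel. f y $ i)"
    by (simp only: time_average_eq[OF lam])
qed

text \<open>
  The window formula for the time integral exhibits it as an indefinite integral in space.
\<close>

lemma wave_integral_H1:
  assumes t: "t \<ge> 0"
  shows "has_H1_derivative n (wave_integral t) (\<lambda>\<zeta>. complex_of_real (inverse lam) \<cdot>\<^sub>v (f \<zeta> - f (\<zeta> - lam * t)))"
    (is "has_H1_derivative n _ ?g")
proof -
  have g_eq: "?g = (\<lambda>\<zeta>. (complex_of_real (inverse lam) \<cdot>\<^sub>m 1\<^sub>m n) *\<^sub>v (f \<zeta> - f (\<zeta> - lam * t)))"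
    using locally_L2D(1)[OF f] by (intro ext) (simp add: smult_mat_mult_vec[of _ n n])
  have fi: "(f \<zeta> - f (\<zeta> - lam * t)) $ i = f \<zeta> $ i - f (\<zeta> - lam * t) $ i" if "i < n" for i \<zeta>
    using that by (simp add: dim_wave)
  have diff: "locally_L2 n (\<lambda>\<zeta>. f \<zeta> - f (\<zeta> - lam * t))"
    unfolding locally_L2_def
  proof (intro conjI allI impI)
    fix i assume i: "i < n"
    note [measurable] = locally_L2D(2)[OF f i]
    show "(\<lambda>\<zeta>. (f \<zeta> - f (\<zeta> - lam * t)) $ i) \<in> borel_measurable borel"
      unfolding fi[OF i] by measurable
    show "set_integrable lborel {a..b} (\<lambda>\<zeta>. (cmod ((f \<zeta> - f (\<zeta> - lam * t)) $ i))\<^sup>2)" for a b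
    proof (rule set_integrable_bound)
      show "set_integrable lborel {a..b} (\<lambda>\<zeta>. 2 * (cmod (f \<zeta> $ i))\<^sup>2 + 2 * (cmod (f (\<zeta> - lam * t) $ i))\<^sup>2)"
        by (intro set_integral_add(1) set_integrable_mult_right locally_L2D(3)[OF f i]
            locally_L2D(3)[OF shifted_locally_L2 i])
      show "set_borel_measurable lborel {a..b} (\<lambda>\<zeta>. (cmod ((f \<zeta> - f (\<zeta> - lam * t)) $ i))\<^sup>2)"
        unfolding fi[OF i] set_borel_measurable_def by measurable
      show "AE \<zeta> in lborel. \<zeta> \<in> {a..b} \<longrightarrow> norm ((cmod ((f \<zeta> - f (\<zeta> - lam * t)) $ i))\<^sup>2)
          \<le> norm (2 * (cmod (f \<zeta> $ i))\<^sup>2 + 2 * (cmod (f (\<zeta> - lam * t) $ i))\<^sup>2)"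
        unfolding fi[OF i] using square_norm_add_le[of "f _ $ i" "- f _ $ i"]
        by (intro AE_I2) (simp add: order_trans[OF _ abs_ge_self])
    qed
  qed (use locally_L2D(1)[OF f] in auto)
  have g: "locally_L2 n ?g" unfolding g_eq by (rule locally_L2_mult_mat[OF diff]) simp
  have "wave_integral t \<zeta> = wave_integral t 0 + vec_integral {0<..<\<zeta>} n ?g" if \<zeta>: "\<zeta> \<in> {0..1}" for \<zeta>
  proof (rule eq_vecI)
    fix i assume "i < dim_vec (wave_integral t 0 + vec_integral {0<..<\<zeta>} n ?g)"
    then have i: "i < n" by (simp add: vec_integral_def)
    have "wave_integral t \<zeta> $ i = inverse lam *\<^sub>R (LINT y:{\<zeta> - lam * t<..<\<zeta>}|lborel. f y $ i)"
      by (rule wave_integral_index(2)[OF i])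
    also have "(LINT y:{\<zeta> - lam * t<..<\<zeta>}|lborel. f y $ i)
        = (LINT y:{- (lam * t)<..<0}|lborel. f y $ i) + (LINT y:{0<..<\<zeta>}|lborel. f y $ i - f (y - lam * t) $ i)"
      using \<zeta> lam t by (intro set_integral_sliding_window locally_L2_integrable[OF f i]) auto
    also have "inverse lam *\<^sub>R \<dots> = wave_integral t 0 $ i
        + inverse lam *\<^sub>R (LINT y:{0<..<\<zeta>}|lborel. f y $ i - f (y - lam * t) $ i)"
      using wave_integral_index(2)[OF i, of t 0] by (simp add: scaleR_add_right)
    also have "inverse lam *\<^sub>R (LINT y:{0<..<\<zeta>}|lborel. f y $ i - f (y - lam * t) $ i)
        = (LINT y:{0<..<\<zeta>}|lborel. ?g y $ i)"
      using i
      by (simp add: dim_wave scaleR_conv_of_real set_integral_mult_right[symmetric] del: set_integral_mult_right)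
    also have "\<dots> = (LINT y:{0<..<\<zeta>}|lebesgue. ?g y $ i)"
      by (rule set_lebesgue_borel(3)[symmetric]) (use locally_L2D(2)[OF g i] in auto)
    finally show "wave_integral t \<zeta> $ i = (wave_integral t 0 + vec_integral {0<..<\<zeta>} n ?g) $ i"
      using i by (simp add: vec_integral_def)
  qed (simp add: wave_integral_def vec_integral_def)
  moreover have "wave_integral t 0 \<in> carrier_vec n" by (simp add: wave_integral_def vec_integral_def)
  moreover have "?g \<in> state_space n"
    using locally_L2_imp_L2_on[OF g, of "{0<..<1}" 0 1]
    by (simp add: greaterThanLessThan_subseteq_atLeastAtMost_iff)
  ultimately show ?thesis unfolding has_H1_derivative_def by blast
qed

lemma wave_integrated_state:
  assumes t: "t \<ge> 0"
  shows "integrated_state n (\<lambda>t \<zeta>. f (\<zeta> - lam * t)) t (wave_integral t)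
    (\<lambda>\<zeta>. complex_of_real (inverse lam) \<cdot>\<^sub>v (f \<zeta> - f (\<zeta> - lam * t)))"
  unfolding integrated_state_def state_has_integral_def
proof (intro conjI)
  show "has_H1_derivative n (wave_integral t) (\<lambda>\<zeta>. complex_of_real (inverse lam) \<cdot>\<^sub>v (f \<zeta> - f (\<zeta> - lam * t)))"
    by (rule wave_integral_H1[OF t])
  from has_H1_derivative_L2[OF this] show "wave_integral t \<in> state_space n" by simp
  show "((\<lambda>D. state_norm n (\<lambda>\<zeta>. vec n (\<lambda>i. \<Sum>(\<tau>, k)\<in>D. content k *\<^sub>R (f (\<zeta> - lam * \<tau>) $ i)) - wave_integral t \<zeta>))
      \<longlongrightarrow> 0) (division_filter {0..t})"
  proof (rule state_norm_tendsto_zero)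
    fix i assume i: "i < n"
    note [measurable] = locally_L2D(2)[OF f i]
    let ?q = "\<lambda>D \<zeta>. (\<Sum>(\<tau>, k)\<in>D. content k *\<^sub>R (f (\<zeta> - lam * \<tau>) $ i)) - (LINT r:{0<..<t}|lborel. f (\<zeta> - lam * r) $ i)"
    have "(\<lambda>\<zeta>. LINT r|lborel. indicat_real {0<..<t} r *\<^sub>R (f (\<zeta> - lam * r) $ i)) \<in> borel_measurable borel"
      by (intro sigma_finite_measure.borel_measurable_lebesgue_integral sigma_finite_lborel) measurable
    then have [measurable]: "(\<lambda>\<zeta>. LINT r:{0<..<t}|lborel. f (\<zeta> - lam * r) $ i) \<in> borel_measurable borel"
      by (simp add: set_lebesgue_integral_def)
    have q: "(vec n (\<lambda>i. \<Sum>(\<tau>, k)\<in>D. content k *\<^sub>R (f (\<zeta> - lam * \<tau>) $ i)) - wave_integral t \<zeta>) $ i = ?q D \<zeta>" for D :: "(real \<times> real set) set" and \<zeta>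
      using i wave_integral_index(1)[OF i, of t \<zeta>] by (simp add: wave_integral_def vec_integral_def)
    have eq: "(LINT \<zeta>:{0<..<1}|lebesgue. (cmod ((vec n (\<lambda>i. \<Sum>(\<tau>, k)\<in>D. content k *\<^sub>R (f (\<zeta> - lam * \<tau>) $ i))
        - wave_integral t \<zeta>) $ i))\<^sup>2) = (LINT \<zeta>:{0<..<1}|lborel. (cmod (?q D \<zeta>))\<^sup>2)"
      for D :: "(real \<times> real set) set"
      unfolding q unfolding split_beta' by (rule set_lebesgue_borel(3); measurable)
    have "((\<lambda>D. LINT \<zeta>:{0<..<1}|lborel. (cmod (?q D \<zeta>))\<^sup>2) \<longlongrightarrow> 0) (division_filter {0..t})"
      using translation_Riemann_sums_L2[OF locally_L2D(2)[OF f i] locally_L2D(3)[OF f i] lam t]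
      by (simp only: time_average_eq[OF lam])
    then show "((\<lambda>D. LINT \<zeta>:{0<..<1}|lebesgue. (cmod ((vec n (\<lambda>i. \<Sum>(\<tau>, k)\<in>D. content k *\<^sub>R (f (\<zeta> - lam * \<tau>) $ i))
        - wave_integral t \<zeta>) $ i))\<^sup>2) \<longlongrightarrow> 0) (division_filter {0..t})"
      unfolding eq .
  qed
qed

end

section \<open>Initial states with values in the discrete output nulling subspace\<close>

lemma locally_L2_mult_mat_pow:
  assumes "locally_L2 n f" "M \<in> carrier_mat n n"
  shows "locally_L2 n (\<lambda>x. ((*\<^sub>v) M ^^ k) (f x))"
  by (induction k) (use assms locally_L2_mult_mat[OF _ assms(2)] in auto)

text \<open>
  Piece \<open>k\<close> is placed on \<open>[-k, 1 - k)\<close>; the convention \<open>nat (- m) = 0\<close> for positive \<open>m\<close> continues piece \<open>0\<close>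
  periodically to the right.
\<close>

lemma locally_L2_glue_unit_pieces:
  assumes G: "\<And>k. locally_L2 n (G k)"
  shows "locally_L2 n (\<lambda>x. G (nat (- \<lfloor>x\<rfloor>)) (frac x))"
  unfolding locally_L2_def
proof (intro conjI allI impI)
  let ?f = "\<lambda>x. G (nat (- \<lfloor>x\<rfloor>)) (frac x)"
  fix i assume i: "i < n"
  have piece: "locally_L2 n (\<lambda>x. G (nat (- k)) (x - of_int k))" for k
    using locally_L2_affine[OF G, of 1 "nat (- k)" "- of_int k"] by simp
  have "(\<lambda>x. (\<lambda>k x. G (nat (- k)) (x - of_int k) $ i) \<lfloor>x\<rfloor> x) \<in> borel_measurable borel"
    by (rule measurable_compose_countable) (use locally_L2D(2)[OF piece i] in auto)
  then show meas: "(\<lambda>x. ?f x $ i) \<in> borel_measurable borel" by (simp add: frac_def)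
  fix a b :: real
  have "set_integrable lborel (\<Union>k\<in>{\<lfloor>a\<rfloor>..\<lfloor>b\<rfloor>}. {of_int k..<of_int k + 1}) (\<lambda>x. (cmod (?f x $ i))\<^sup>2)"
  proof (rule set_integrable_UN)
    fix k :: int
    have "set_integrable lborel {of_int k..<of_int k + 1} (\<lambda>x. (cmod (G (nat (- k)) (x - of_int k) $ i))\<^sup>2)"
      by (rule set_integrable_subset[OF locally_L2D(3)[OF piece i, of "of_int k" "of_int k + 1"]]) auto
    also have "?this \<longleftrightarrow> set_integrable lborel {of_int k..<of_int k + 1} (\<lambda>x. (cmod (?f x $ i))\<^sup>2)"
    proof (rule set_integrable_cong[OF refl refl])
      fix x assume "x \<in> {real_of_int k..<real_of_int k + 1}"
      then have "\<lfloor>x\<rfloor> = k" by (intro floor_unique) auto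
      then show "(cmod (G (nat (- k)) (x - of_int k) $ i))\<^sup>2 = (cmod (?f x $ i))\<^sup>2"
        by (simp add: frac_def)
    qed
    finally show "set_integrable lborel {of_int k..<of_int k + 1} (\<lambda>x. (cmod (?f x $ i))\<^sup>2)" .
  qed auto
  moreover have "{a..b} \<subseteq> (\<Union>k\<in>{\<lfloor>a\<rfloor>..\<lfloor>b\<rfloor>}. {of_int k..<of_int k + 1})"
  proof
    fix x assume "x \<in> {a..b}"
    then have "\<lfloor>x\<rfloor> \<in> {\<lfloor>a\<rfloor>..\<lfloor>b\<rfloor>}" "x \<in> {of_int \<lfloor>x\<rfloor>..<of_int \<lfloor>x\<rfloor> + 1}"
      by (auto intro: floor_mono)
    then show "x \<in> (\<Union>k\<in>{\<lfloor>a\<rfloor>..\<lfloor>b\<rfloor>}. {of_int k..<of_int k + 1})" by blast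
  qed
  ultimately show "set_integrable lborel {a..b} (\<lambda>x. (cmod (?f x $ i))\<^sup>2)"
    using set_integrable_subset[of lborel "\<Union>k\<in>{\<lfloor>a\<rfloor>..\<lfloor>b\<rfloor>}. {of_int k..<of_int k + 1}" _ "{a..b}"] by simp
qed (use locally_L2D(1)[OF G] in auto)

context phs_matrices
begin

text \<open>
  The feedback determines the profile on \<open>[-k - 1, -k)\<close> from the one on \<open>[-k, 1 - k)\<close>. On the first
  unit interval a Borel version of the initial state is projected to the subspace: this changes it only on a null
  set, and afterwards all values lie in the subspace, so that the feedback is nulling at every point.
\<close>

lemma extend_initial_state:
  assumes F: "F \<in> carrier_mat p n"
    and null: "\<And>v. v \<in> Vd \<Longrightarrow> A *\<^sub>v v + B *\<^sub>v (F *\<^sub>v v) \<in> Vd \<and> C *\<^sub>v v + D *\<^sub>v (F *\<^sub>v v) = 0\<^sub>v m"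
    and z0: "z0 \<in> L2_into n Vd"
  shows "\<exists>f. locally_L2 n f \<and> (\<forall>x. f x \<in> Vd) \<and> (AE x\<in>{0<..<1} in lebesgue. f x = z0 x) \<and>
    (\<forall>x<0. f x = A *\<^sub>v f (x + 1) + B *\<^sub>v (F *\<^sub>v f (x + 1)))"
proof -
  obtain P where P: "P \<in> carrier_mat n n" "\<And>w. w \<in> carrier_vec n \<Longrightarrow> P *\<^sub>v w \<in> Vd"
    "\<And>w. w \<in> Vd \<Longrightarrow> P *\<^sub>v w = w"
    using subspace_projection[OF Vd_subspace] by metis
  obtain g where g: "locally_L2 n g" "AE x\<in>{0<..<1} in lebesgue. g x = z0 x"
    using L2_on_borel_version[of n z0] z0 by (auto simp: L2_into_def)
  define M where "M = A + B * F"
  have M: "M \<in> carrier_mat n n" using A B F by (auto simp: M_def)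
  have Mv: "M *\<^sub>v v = A *\<^sub>v v + B *\<^sub>v (F *\<^sub>v v)" if "v \<in> carrier_vec n" for v
    unfolding M_def using A B F that
    by (simp add: add_mult_distrib_mat_vec[of _ n n] assoc_mult_mat_vec[of _ n p _ n])
  define G where "G k x = ((*\<^sub>v) M ^^ k) (P *\<^sub>v g x)" for k x
  have G_Vd: "G k x \<in> Vd" for k x
  proof (induction k)
    case 0
    show ?case using P(2) locally_L2D(1)[OF g(1)] by (simp add: G_def)
  next
    case (Suc k)
    then show ?case using null Mv vec_subspaceD(1)[OF Vd_subspace Suc] by (simp add: G_def)
  qed
  define f where "f x = G (nat (- \<lfloor>x\<rfloor>)) (frac x)" for x
  show ?thesis
  proof (intro exI conjI allI impI)
    show "locally_L2 n f"
      unfolding f_def G_def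
      by (intro locally_L2_glue_unit_pieces locally_L2_mult_mat_pow locally_L2_mult_mat[OF g(1) P(1)] M)
    show "f x \<in> Vd" for x by (simp add: f_def G_Vd)
    have "AE x in lebesgue. x \<in> {0<..<1} \<longrightarrow> z0 x \<in> Vd"
      using z0 unfolding L2_into_def by blast
    with g(2) show "AE x\<in>{0<..<1} in lebesgue. f x = z0 x"
    proof eventually_elim
      case (elim x)
      show ?case
      proof
        assume x: "x \<in> {0<..<1}"
        then have "\<lfloor>x\<rfloor> = 0" by (intro floor_unique) auto
        then show "f x = z0 x" using elim x P(3) by (simp add: f_def G_def frac_def)
      qed
    qed
    fix x :: real assume "x < 0"
    then have "nat (- \<lfloor>x\<rfloor>) = Suc (nat (- \<lfloor>x + 1\<rfloor>))" by (simp add: floor_less_zero) linarith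
    moreover have "frac (x + 1) = frac x" by (simp add: frac_def)
    ultimately have "f x = M *\<^sub>v f (x + 1)" by (simp add: f_def G_def)
    also have "\<dots> = A *\<^sub>v f (x + 1) + B *\<^sub>v (F *\<^sub>v f (x + 1))"
      by (rule Mv) (use G_Vd vec_subspaceD(1)[OF Vd_subspace] in \<open>simp add: f_def\<close>)
    finally show "f x = A *\<^sub>v f (x + 1) + B *\<^sub>v (F *\<^sub>v f (x + 1))" .
  qed
qed

lemma output_can_vanish_if_values_in_Vd:
  assumes z0: "z0 \<in> L2_into n Vd"
  shows "output_can_vanish lam n p m K L Ky Ly z0"
proof -
  obtain F where F: "F \<in> carrier_mat p n"
    "\<And>v. v \<in> Vd \<Longrightarrow> A *\<^sub>v v + B *\<^sub>v (F *\<^sub>v v) \<in> Vd \<and> C *\<^sub>v v + D *\<^sub>v (F *\<^sub>v v) = 0\<^sub>v m"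
    using output_nulling_feedback by metis
  obtain f where f: "locally_L2 n f" "\<And>x. f x \<in> Vd" "AE x\<in>{0<..<1} in lebesgue. f x = z0 x"
    and f_rec: "\<And>x. x < 0 \<Longrightarrow> f x = A *\<^sub>v f (x + 1) + B *\<^sub>v (F *\<^sub>v f (x + 1))"
    using extend_initial_state[OF F z0] by blast
  have fc: "f x \<in> carrier_vec n" for x by (rule locally_L2D(1)[OF f(1)])
  let ?z = "\<lambda>t \<zeta>. f (\<zeta> - lam * t)" and ?Z = "wave_integral f n lam"
    and ?dZ = "\<lambda>t \<zeta>. complex_of_real (inverse lam) \<cdot>\<^sub>v (f \<zeta> - f (\<zeta> - lam * t))"
  define u where "u t = F *\<^sub>v f (1 - lam * t)" for t
  have uc: "u t \<in> carrier_vec p" for t using F(1) fc by (simp add: u_def)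
  have shift: "locally_L2 n (\<lambda>t. f (x - lam * t))" for x
    using locally_L2_affine[OF f(1), of "- lam" x] lam by simp
  have u: "locally_L2 p u"
    using locally_L2_mult_mat[OF shift[of 1] F(1)] unfolding u_def[abs_def] .
  have rec: "f (0 - lam * r) = A *\<^sub>v f (1 - lam * r) + B *\<^sub>v u r" if "r > 0" for r
  proof -
    have "0 - lam * r < 0" using that lam by simp
    moreover have "0 - lam * r + 1 = 1 - lam * r" by simp
    ultimately show ?thesis unfolding u_def using f_rec[of "0 - lam * r"] by metis
  qed
  have boundary: "complex_of_real (- lam) \<cdot>\<^sub>v (M *\<^sub>v ?Z t 0) - complex_of_real lam \<cdot>\<^sub>v (N *\<^sub>v ?Z t 1)
      = vec_integral {0<..<t} r (\<lambda>s. complex_of_real (- lam) \<cdot>\<^sub>v (M *\<^sub>v f (0 - lam * s))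
          - complex_of_real lam \<cdot>\<^sub>v (N *\<^sub>v f (1 - lam * s)))"
    if "M \<in> carrier_mat r n" "N \<in> carrier_mat r n" for M N r t
    unfolding wave_integral_def[OF f(1) lam]
  proof (rule vec_integral_boundary_combination)
    fix i assume i: "i < n"
    show "set_integrable lebesgue {0<..<t} (\<lambda>s. f (0 - lam * s) $ i)"
      "set_integrable lebesgue {0<..<t} (\<lambda>s. f (1 - lam * s) $ i)"
      by (rule set_integrable_lborel_imp_lebesgue[OF locally_L2_integrable[OF shift i, of _ 0 t]]; auto)+
  qed (use that fc in auto)
  have cong: "vec_integral {0<..<t} r g = vec_integral {0<..<t} r h" if "\<And>s. s > 0 \<Longrightarrow> g s = h s" for t r g h
    unfolding vec_integral_def
    by (intro eq_vecI) (auto intro!: set_lebesgue_integral_cong simp: that)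
  have state: "mild_solution lam n p K L z0 u ?z"
    unfolding mild_solution_def
  proof (intro conjI allI impI exI)
    fix t :: real assume t: "0 \<le> t"
    show "integrated_state n ?z t (?Z t) (?dZ t)"
      by (rule wave_integrated_state[OF f(1) lam t])
    show "AE \<zeta>\<in>{0<..<1} in lebesgue. ?z t \<zeta> - z0 \<zeta> = complex_of_real (- lam) \<cdot>\<^sub>v ?dZ t \<zeta>"
      using f(3)
    proof eventually_elim
      case (elim \<zeta>)
      show ?case
      proof
        assume "\<zeta> \<in> {0<..<1}"
        with elim have "z0 \<zeta> = f \<zeta>" by simp
        then show "?z t \<zeta> - z0 \<zeta> = complex_of_real (- lam) \<cdot>\<^sub>v ?dZ t \<zeta>"
          using lam by (intro eq_vecI) (auto simp: carrier_vecD[OF fc] field_simps)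
      qed
    qed
    have "0\<^sub>v (n - p) @\<^sub>v vec_integral {0<..<t} p u = vec_integral {0<..<t} n (\<lambda>s. 0\<^sub>v (n - p) @\<^sub>v u s)"
      unfolding vec_integral_def using p carrier_vecD[OF uc]
      by (intro eq_vecI) (auto simp: set_lebesgue_integral_def)
    also have "\<dots> = vec_integral {0<..<t} n (\<lambda>s. complex_of_real (- lam) \<cdot>\<^sub>v (K *\<^sub>v f (0 - lam * s))
          - complex_of_real lam \<cdot>\<^sub>v (L *\<^sub>v f (1 - lam * s)))"
      by (rule cong) (rule boundary_condition_iff[OF fc fc uc, THEN iffD2, OF rec])
    finally show "0\<^sub>v (n - p) @\<^sub>v vec_integral {0<..<t} p u
        = complex_of_real (- lam) \<cdot>\<^sub>v (K *\<^sub>v ?Z t 0) - complex_of_real lam \<cdot>\<^sub>v (L *\<^sub>v ?Z t 1)"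
      by (simp only: boundary[OF K L])
  qed (rule travelling_wave_state_continuous[OF f(1) lam])
  have "has_output lam n m Ky Ly ?z (\<lambda>_. 0\<^sub>v m)"
    unfolding has_output_def
  proof (intro conjI allI impI exI)
    show "L2_loc m (\<lambda>_. 0\<^sub>v m)"
      unfolding L2_loc_def L2_on_def by (auto simp: set_borel_measurable_def set_integrable_def)
    fix t :: real assume t: "0 \<le> t"
    show "integrated_state n ?z t (?Z t) (?dZ t)"
      by (rule wave_integrated_state[OF f(1) lam t])
    have "complex_of_real (- lam) \<cdot>\<^sub>v (Ky *\<^sub>v f (0 - lam * s)) - complex_of_real lam \<cdot>\<^sub>v (Ly *\<^sub>v f (1 - lam * s)) = 0\<^sub>v m"
      if "s > 0" for s
      unfolding rec[OF that] output_eq[OF fc uc] using F(2)[OF f(2)] by (simp add: u_def)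
    then show "vec_integral {0<..<t} m (\<lambda>_. 0\<^sub>v m)
        = complex_of_real (- lam) \<cdot>\<^sub>v (Ky *\<^sub>v ?Z t 0) - complex_of_real lam \<cdot>\<^sub>v (Ly *\<^sub>v ?Z t 1)"
      unfolding boundary[OF Ky Ly] by (intro cong) simp
  qed
  moreover have "L2_loc p u"
    unfolding L2_loc_def using locally_L2_imp_L2_on[OF u, of "{0<..<_}" 0]
    by (auto simp: greaterThanLessThan_subseteq_atLeastAtMost_iff)
  moreover have "AE t\<in>{0<..} in lebesgue. 0\<^sub>v m = 0\<^sub>v m" by simp
  ultimately show ?thesis unfolding output_can_vanish_def using state by blast
qed

end

section \<open>Characteristics of the transport equation\<close>

lemma integral_has_vector_derivative_ray:
  fixes f :: "real \<Rightarrow> 'a::banach"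
  assumes "continuous_on {a..} f" "t \<ge> a"
  shows "((\<lambda>u. integral {a..u} f) has_vector_derivative f t) (at t within {a..})"
proof -
  have "((\<lambda>u. integral {a..u} f) has_vector_derivative f t) (at t within {a..t + 1})"
    using assms by (intro integral_has_vector_derivative) (auto intro: continuous_on_subset)
  moreover have "at t within {a..t + 1} = at t within {a..}"
    by (rule at_within_nhd[of _ "{..<t + 1}"]) auto
  ultimately show ?thesis by simp
qed

text \<open>
  The hypothesis \<open>circ\<close> says that the form \<open>G dx - lam G dt\<close> has zero circulation around the rectangles
  with corner \<open>(0,0)\<close>, which is the transport equation in integral form. So it has a potential \<open>H\<close>, which is
  differentiable with \<open>dH = G (dx - lam dt)\<close> and hence constant along characteristics. Differentiating
  the equation \<open>H x t = H (x - lam * s) (t - s)\<close> in \<open>t\<close> gives the claim; \<open>G\<close> itself need not be differentiable.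
\<close>

lemma constant_along_characteristics:
  fixes G :: "real \<Rightarrow> real \<Rightarrow> 'a::banach"
  assumes cont: "continuous_on ({0..1} \<times> {0..}) (\<lambda>(x, t). G x t)"
    and circ: "\<And>x t. x \<in> {0..1} \<Longrightarrow> 0 \<le> t \<Longrightarrow>
      integral {0..x} (\<lambda>\<xi>. G \<xi> t) - integral {0..x} (\<lambda>\<xi>. G \<xi> 0)
        = - lam *\<^sub>R (integral {0..t} (G x) - integral {0..t} (G 0))"
    and lam: "lam > 0" and x: "x \<le> 1" "lam * s \<le> x" and s: "0 \<le> s" "s \<le> t"
  shows "G x t = G (x - lam * s) (t - s)"
proof -
  have contx: "continuous_on {0..1} (\<lambda>\<xi>. G \<xi> t)" if "t \<ge> 0" for t
    using continuous_on_compose2[OF cont, of "{0..1}" "\<lambda>\<xi>. (\<xi>, t)"] that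
    by (simp add: continuous_on_Pair image_subset_iff)
  have contt: "continuous_on {0..} (G x)" if "x \<in> {0..1}" for x
    using continuous_on_compose2[OF cont, of "{0..}" "\<lambda>t. (x, t)"] that
    by (simp add: continuous_on_Pair image_subset_iff)
  define H where "H x t = integral {0..x} (\<lambda>\<xi>. G \<xi> t) - lam *\<^sub>R integral {0..t} (G 0)" for x t
  have H_eq: "H x t = integral {0..x} (\<lambda>\<xi>. G \<xi> 0) - lam *\<^sub>R integral {0..t} (G x)"
    if "x \<in> {0..1}" "t \<ge> 0" for x t
    using circ[OF that] by (simp add: H_def algebra_simps)
  have Hx: "((\<lambda>x. H x t) has_vector_derivative G x t) (at x within {0..1})"
    if "x \<in> {0..1}" "t \<ge> 0" for x t
    unfolding H_def using that contx[of t]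
    by (auto intro!: derivative_eq_intros integral_has_vector_derivative)
  have Ht: "(H x has_vector_derivative - lam *\<^sub>R G x t) (at t within {0..})"
    if "x \<in> {0..1}" "t \<ge> 0" for x t
  proof -
    have "((\<lambda>t. integral {0..x} (\<lambda>\<xi>. G \<xi> 0) - lam *\<^sub>R integral {0..t} (G x))
            has_vector_derivative - lam *\<^sub>R G x t) (at t within {0..})"
      using integral_has_vector_derivative_ray[OF contt[OF that(1)] that(2)]
      by (auto intro!: derivative_eq_intros)
    then show ?thesis
      by (rule has_vector_derivative_transform[rotated 2]) (use that H_eq in auto)
  qed
  have H_deriv: "((\<lambda>(x, t). H x t) has_derivative (\<lambda>(h, k). (h - lam * k) *\<^sub>R G x t))
      (at (x, t) within {0..1} \<times> {0..})" if xt: "x \<in> {0..1}" "t \<ge> 0" for x t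
  proof -
    have "((\<lambda>(x, t). H x t) has_derivative
        (\<lambda>(h, k). h *\<^sub>R G x t + blinfun_scaleR_left (- lam *\<^sub>R G x t) k))
        (at (x, t) within {0..1} \<times> {0..})"
    proof (rule has_derivative_partialsI[where fy = "\<lambda>x t. blinfun_scaleR_left (- lam *\<^sub>R G x t)"])
      show "((\<lambda>x. H x t) has_derivative (\<lambda>h. h *\<^sub>R G x t)) (at x within {0..1})"
        using Hx[OF xt] by (simp add: has_vector_derivative_def)
      show "(H x has_derivative blinfun_apply (blinfun_scaleR_left (- lam *\<^sub>R G x t)))
          (at t within {0..})" if "x \<in> {0..1}" "t \<in> {0..}" for x t
        using Ht[of x t] that by (simp add: has_vector_derivative_def)
      have "continuous_on ({0..1} \<times> {0..}) (\<lambda>z. blinfun_scaleR_left (- lam *\<^sub>R (case z of (x, t) \<Rightarrow> G x t)))"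
        by (intro continuous_intros cont bounded_linear.continuous_on[OF bounded_linear_blinfun_scaleR_left])
      then show "continuous (at (x, t) within {0..1} \<times> {0..})
          (\<lambda>(x, t). blinfun_scaleR_left (- lam *\<^sub>R G x t))"
        using xt by (auto simp: continuous_on_eq_continuous_within split_beta')
    qed (use xt in auto)
    then show ?thesis by (simp add: split_beta' algebra_simps)
  qed
  have H_const: "H x t = H (x - lam * s) (t - s)" if "x \<le> 1" "lam * s \<le> x" "0 \<le> s" "s \<le> t" for t
  proof -
    let ?q = "\<lambda>r. (x - lam * s + lam * r, t - s + r)"
    have inside: "?q r \<in> {0..1} \<times> {0..}" if "r \<in> {0..s}" for r
    proof -
      have "lam * r \<le> lam * s" "0 \<le> lam * r" using that lam by auto
      then show ?thesis using that \<open>x \<le> 1\<close> \<open>lam * s \<le> x\<close> \<open>s \<le> t\<close> by auto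
    qed
    have "((\<lambda>r. case ?q r of (x, t) \<Rightarrow> H x t) has_derivative (\<lambda>h. 0)) (at r within {0..s})"
      if r: "r \<in> {0..s}" for r
    proof -
      have "(?q has_derivative (\<lambda>h. (lam * h, h))) (at r within {0..s})"
        by (intro has_derivative_Pair) (auto intro!: derivative_eq_intros)
      moreover have "((\<lambda>(x, t). H x t) has_derivative
          (\<lambda>(h, k). (h - lam * k) *\<^sub>R G (x - lam * s + lam * r) (t - s + r)))
          (at (?q r) within ?q ` {0..s})"
      proof (rule has_derivative_subset[OF H_deriv])
        show "?q ` {0..s} \<subseteq> {0..1} \<times> {0..}" using inside by blast
      qed (use inside[OF r] in simp_all)
      ultimately have "((\<lambda>(x, t). H x t) \<circ> ?q has_derivative
          (\<lambda>(h, k). (h - lam * k) *\<^sub>R G (x - lam * s + lam * r) (t - s + r)) \<circ> (\<lambda>h. (lam * h, h)))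
          (at r within {0..s})"
        by (rule diff_chain_within)
      then show ?thesis by (simp add: o_def)
    qed
    from has_derivative_zero_constant[OF convex_real_interval(5) this]
    obtain c where c: "\<And>r. r \<in> {0..s} \<Longrightarrow> H (x - lam * s + lam * r) (t - s + r) = c"
      unfolding prod.case by blast
    have "H x t = c" using c[of s] that by simp
    also have "c = H (x - lam * s) (t - s)" using c[of 0] that by simp
    finally show ?thesis .
  qed
  have x0: "x \<in> {0..1}" "x - lam * s \<in> {0..1}"
    using x s lam mult_nonneg_nonneg[of lam s] by (simp_all del: mult_nonneg_nonneg)
  have 1: "(H x has_vector_derivative - lam *\<^sub>R G x t) (at t within {s..t + 1})"
    by (rule has_vector_derivative_within_subset[OF Ht]) (use x0 s in auto)
  have "(H (x - lam * s) \<circ> (\<lambda>t. t - s) has_vector_derivative 1 *\<^sub>R (- lam *\<^sub>R G (x - lam * s) (t - s))) (at t within {s..t + 1})"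
  proof (rule vector_diff_chain_within)
    show "((\<lambda>t. t - s) has_vector_derivative 1) (at t within {s..t + 1})"
      by (auto intro!: derivative_eq_intros)
    show "(H (x - lam * s) has_vector_derivative - lam *\<^sub>R G (x - lam * s) (t - s))
        (at (t - s) within (\<lambda>t. t - s) ` {s..t + 1})"
      by (rule has_vector_derivative_within_subset[OF Ht]) (use x0 s in auto)
  qed
  then have 2: "(H x has_vector_derivative - lam *\<^sub>R G (x - lam * s) (t - s)) (at t within {s..t + 1})"
    unfolding o_def scaleR_one
    apply (rule has_vector_derivative_transform[rotated 2])
    subgoal using s by simp
    subgoal for r by (rule H_const) (use x s in auto)
    done
  have "at t within {s..t + 1} \<noteq> bot"
    using s islimpt_Icc[of s "t + 1" t] by (simp only: trivial_limit_within) simp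
  from vector_derivative_unique_within[OF this 1 2] show ?thesis using lam by simp
qed

section \<open>Mild solutions and their spatial primitives\<close>

text \<open>
  Almost every point is a right Lebesgue point of the function.
\<close>

lemma zero_AE_if_integrals_zero:
  fixes g :: "real \<Rightarrow> complex"
  assumes g: "set_integrable lebesgue {0<..<1} g"
    and zero: "\<And>x. 0 \<le> x \<Longrightarrow> x \<le> 1 \<Longrightarrow> (LINT y:{0<..<x}|lebesgue. g y) = 0"
  shows "AE x\<in>{0<..<1} in lebesgue. g x = 0"
proof -
  define f where "f x = (if x \<in> {0<..<1} then g x else 0)" for x
  have "f absolutely_integrable_on UNIV"
    using g absolutely_integrable_restrict_UNIV[of "{0<..<1}" g] unfolding f_def[abs_def] by simp
  then have "f integrable_on cbox a b" for a b
    by (intro integrable_on_subcbox[of f UNIV] set_lebesgue_integral_eq_integral(1)) auto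
  from integrable_ccontinuous_explicit[of f, OF this]
  obtain N where N: "negligible N"
    "\<And>x e. x \<notin> N \<Longrightarrow> 0 < e \<Longrightarrow> \<exists>d>0. \<forall>h. 0 < h \<and> h < d \<longrightarrow>
      norm (integral (cbox x (x + h *\<^sub>R One)) f /\<^sub>R h ^ DIM(real) - f x) < e"
    by blast
  have g_int: "g integrable_on {0..1}"
    using set_integral_Ioo_eq_integral(1)[OF g] by (rule set_lebesgue_integral_eq_integral(1))
  have sub: "integral {x..y} f = 0" if "0 < x" "x \<le> y" "y < 1" for x y
  proof -
    have "integral {0..x} g + integral {x..y} g = integral {0..y} g"
      by (rule Henstock_Kurzweil_Integration.integral_combine)
        (use that in \<open>auto intro: integrable_on_subinterval[OF g_int]\<close>)
    then have "integral {x..y} g = 0"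
      using zero[of x] zero[of y] set_integral_Ioo_eq_integral(2)[OF g] that by simp
    moreover have "integral {x..y} f = integral {x..y} g"
      by (rule Henstock_Kurzweil_Integration.integral_cong) (use that in \<open>auto simp: f_def\<close>)
    ultimately show ?thesis by simp
  qed
  have "g x = 0" if x: "x \<in> {0<..<1}" "x \<notin> N" for x
  proof (rule ccontr)
    assume "g x \<noteq> 0"
    then obtain d where d: "d > 0" "\<And>h. 0 < h \<Longrightarrow> h < d \<Longrightarrow>
        norm (integral (cbox x (x + h *\<^sub>R One)) f /\<^sub>R h ^ DIM(real) - f x) < norm (g x)"
      using N(2)[OF x(2), of "norm (g x)"] by auto
    define h where "h = min (d / 2) ((1 - x) / 2)"
    have h: "0 < h" "h < d" "x + h < 1" using d x by (auto simp: h_def min_def field_simps)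
    have "integral (cbox x (x + h *\<^sub>R One)) f = 0" using sub[of x "x + h"] h x by simp
    then show False using d(2)[OF h(1,2)] x(1) by (simp add: f_def)
  qed
  moreover have "AE x in lebesgue. x \<notin> N"
    using N(1) unfolding negligible_iff_null_sets by (rule AE_not_in)
  ultimately show ?thesis by (auto elim: eventually_mono)
qed

definition square_integrable_on :: "(real \<Rightarrow> complex) \<Rightarrow> real set \<Rightarrow> bool" where
  "square_integrable_on f S \<longleftrightarrow> set_borel_measurable lebesgue S f \<and>
     set_integrable lebesgue S (\<lambda>x. (cmod (f x))\<^sup>2)"

lemma square_integrable_cong:
  assumes "\<And>x. x \<in> S \<Longrightarrow> f x = g x"
  shows "square_integrable_on f S \<longleftrightarrow> square_integrable_on g S"
proof -
  have "(\<lambda>x. indicat_real S x *\<^sub>R f x) = (\<lambda>x. indicat_real S x *\<^sub>R g x)"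
    using assms by (auto simp: fun_eq_iff split: split_indicator)
  moreover have "set_integrable lebesgue S (\<lambda>x. (cmod (f x))\<^sup>2) \<longleftrightarrow> set_integrable lebesgue S (\<lambda>x. (cmod (g x))\<^sup>2)"
    by (rule set_integrable_cong) (use assms in auto)
  ultimately show ?thesis by (simp add: square_integrable_on_def set_borel_measurable_def)
qed

lemma square_integrable_scaleR:
  "square_integrable_on f S \<Longrightarrow> square_integrable_on (\<lambda>x. c *\<^sub>R f x) S"
  unfolding square_integrable_on_def
proof (intro conjI)
  assume *: "set_borel_measurable lebesgue S f \<and> set_integrable lebesgue S (\<lambda>x. (cmod (f x))\<^sup>2)"
  have "(\<lambda>x. c *\<^sub>R (indicator S x *\<^sub>R f x)) \<in> borel_measurable lebesgue"
    using * unfolding set_borel_measurable_def by (intro borel_measurable_const_scaleR) simp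
  then show "set_borel_measurable lebesgue S (\<lambda>x. c *\<^sub>R f x)"
    unfolding set_borel_measurable_def by (simp add: mult.commute)
  have "set_integrable lebesgue S (\<lambda>x. c\<^sup>2 * (cmod (f x))\<^sup>2)"
    using * by (intro set_integrable_mult_right) simp
  then show "set_integrable lebesgue S (\<lambda>x. (cmod (c *\<^sub>R f x))\<^sup>2)"
    by (simp add: power_mult_distrib)
qed

lemma square_integrable_add:
  assumes f: "square_integrable_on f S" and g: "square_integrable_on g S"
  shows "square_integrable_on (\<lambda>x. f x + g x) S"
proof -
  have meas: "(\<lambda>x. indicator S x *\<^sub>R (f x + g x)) \<in> borel_measurable lebesgue"
    using f g unfolding square_integrable_on_def set_borel_measurable_def scaleR_add_right
    by (intro borel_measurable_add) auto
  note [measurable] = meas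
  have "(\<lambda>x. (cmod (indicator S x *\<^sub>R (f x + g x)))\<^sup>2) \<in> borel_measurable lebesgue"
    by measurable
  also have "(\<lambda>x. (cmod (indicator S x *\<^sub>R (f x + g x)))\<^sup>2) = (\<lambda>x. indicator S x *\<^sub>R (cmod (f x + g x))\<^sup>2)"
    by (auto simp: indicator_def)
  finally have meas2: "set_borel_measurable lebesgue S (\<lambda>x. (cmod (f x + g x))\<^sup>2)"
    by (simp add: set_borel_measurable_def)
  have "set_integrable lebesgue S (\<lambda>x. (cmod (f x + g x))\<^sup>2)"
  proof (rule set_integrable_bound[OF _ meas2])
    show "set_integrable lebesgue S (\<lambda>x. 2 * (cmod (f x))\<^sup>2 + 2 * (cmod (g x))\<^sup>2)"
      using f g unfolding square_integrable_on_def
      by (intro set_integral_add(1) set_integrable_mult_right) auto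
    show "AE x in lebesgue. x \<in> S \<longrightarrow>
        norm ((cmod (f x + g x))\<^sup>2) \<le> norm (2 * (cmod (f x))\<^sup>2 + 2 * (cmod (g x))\<^sup>2)"
      using square_norm_add_le[of "f _" "g _"] by (intro AE_I2) simp
  qed
  with meas show ?thesis by (simp add: square_integrable_on_def set_borel_measurable_def)
qed

lemma square_integrable_sum:
  assumes "S \<in> sets lebesgue" "\<And>k. k \<in> D \<Longrightarrow> square_integrable_on (f k) S"
  shows "square_integrable_on (\<lambda>x. \<Sum>k\<in>D. f k x) S"
  using assms(2)
proof (induction D rule: infinite_finite_induct)
  case (insert k D)
  then show ?case using square_integrable_add[of "f k" S "\<lambda>x. \<Sum>k\<in>D. f k x"] by simp
qed (simp_all add: square_integrable_on_def set_borel_measurable_def set_integrable_def)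

lemma L2_on_square_integrable:
  "L2_on S n f \<Longrightarrow> i < n \<Longrightarrow> square_integrable_on (\<lambda>x. f x $ i) S"
  by (auto simp: L2_on_def square_integrable_on_def)

lemma norm_set_integral_le_state_norm:
  assumes i: "i < n" and sq: "square_integrable_on (\<lambda>x. f x $ i) {0<..<1}" and x: "0 \<le> x" "x \<le> 1"
  shows "cmod (LINT y:{0<..<x}|lebesgue. f y $ i) \<le> state_norm n f"
proof (rule power2_le_imp_le)
  have "(cmod (LINT y:{0<..<x}|lebesgue. f y $ i))\<^sup>2
      \<le> measure lebesgue {0<..<1::real} * (LINT y:{0<..<1}|lebesgue. (cmod (f y $ i))\<^sup>2)"
    by (rule square_set_integral_le) (use sq x in \<open>auto simp: square_integrable_on_def\<close>)
  also have "\<dots> \<le> (state_norm n f)\<^sup>2"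
    using square_component_le_state_norm[OF i, of f] by simp
  finally show "(cmod (LINT y:{0<..<x}|lebesgue. f y $ i))\<^sup>2 \<le> (state_norm n f)\<^sup>2" .
  show "0 \<le> state_norm n f"
    unfolding state_norm_def set_lebesgue_integral_def
    by (intro real_sqrt_ge_zero sum_nonneg integral_nonneg_AE) simp
qed

text \<open>
  Integration over \<open>(0,x)\<close> is a bounded functional on the state space, so it maps Riemann sums that
  converge in \<open>L2\<close> to convergent Riemann sums of scalars.
\<close>

lemma state_has_integral_imp_has_integral:
  assumes I: "state_has_integral n z I 0 t" and t: "0 \<le> t"
    and z: "\<And>\<tau>. 0 \<le> \<tau> \<Longrightarrow> z \<tau> \<in> state_space n" and i: "i < n" and x: "0 \<le> x" "x \<le> 1"
  shows "((\<lambda>\<tau>. LINT y:{0<..<x}|lebesgue. z \<tau> y $ i) has_integral (LINT y:{0<..<x}|lebesgue. I y $ i)) {0..t}"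
proof -
  let ?p = "\<lambda>\<tau>. LINT y:{0<..<x}|lebesgue. z \<tau> y $ i"
  let ?v = "\<lambda>D \<zeta>. vec n (\<lambda>i. \<Sum>(\<tau>, k)\<in>D. content k *\<^sub>R (z \<tau> \<zeta> $ i)) - I \<zeta>"
  have IL2: "L2_on {0<..<1} n I" using I by (simp add: state_has_integral_def)
  have sub: "set_integrable lebesgue {0<..<x} (\<lambda>y. f y $ i)" if "L2_on {0<..<1} n f" for f
    by (rule set_integrable_subset[OF L2_on_unit_integrable[OF that i]]) (use x in auto)
  have bound: "norm ((\<Sum>(\<tau>, k)\<in>D. content k *\<^sub>R ?p \<tau>) - (LINT y:{0<..<x}|lebesgue. I y $ i))
      \<le> state_norm n (?v D)" if D: "D tagged_division_of {0..t}" for D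
  proof -
    have zL2: "L2_on {0<..<1} n (z \<tau>)" if "(\<tau>, k) \<in> D" for \<tau> k
      using z[of \<tau>] tagged_division_ofD(2,3)[OF D that] by auto
    have comp: "?v D \<zeta> $ i = (\<Sum>(\<tau>, k)\<in>D. content k *\<^sub>R (z \<tau> \<zeta> $ i)) + (- 1) *\<^sub>R (I \<zeta> $ i)"
      if "\<zeta> \<in> {0<..<1}" for \<zeta>
    proof -
      have "I \<zeta> \<in> carrier_vec n" using IL2 that by (auto simp: L2_on_def)
      then show ?thesis using i by simp
    qed
    have "square_integrable_on (\<lambda>\<zeta>. (\<Sum>(\<tau>, k)\<in>D. content k *\<^sub>R (z \<tau> \<zeta> $ i)) + (- 1) *\<^sub>R (I \<zeta> $ i)) {0<..<1}"
      unfolding split_beta'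
      by (intro square_integrable_add square_integrable_scaleR square_integrable_sum
          L2_on_square_integrable[OF _ i] IL2) (use zL2 in auto)
    then have sq: "square_integrable_on (\<lambda>\<zeta>. ?v D \<zeta> $ i) {0<..<1}"
      by (rule square_integrable_cong[THEN iffD1, rotated]) (rule comp[symmetric])
    have int: "integrable lebesgue (\<lambda>y. indicat_real {0<..<x} y *\<^sub>R (content k *\<^sub>R (z \<tau> y $ i)))"
      if "(\<tau>, k) \<in> D" for \<tau> k
      using integrable_scaleR_right[of "content k" lebesgue "\<lambda>y. indicat_real {0<..<x} y *\<^sub>R (z \<tau> y $ i)"]
        sub[OF zL2[OF that]]
      by (simp add: set_integrable_def mult.commute)
    have "(\<Sum>(\<tau>, k)\<in>D. content k *\<^sub>R ?p \<tau>) = (\<Sum>(\<tau>, k)\<in>D. LINT y:{0<..<x}|lebesgue. content k *\<^sub>R (z \<tau> y $ i))"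
      by simp
    also have "\<dots> = (LINT y:{0<..<x}|lebesgue. \<Sum>(\<tau>, k)\<in>D. content k *\<^sub>R (z \<tau> y $ i))"
      unfolding set_lebesgue_integral_def scaleR_sum_right split_beta'
      by (rule Bochner_Integration.integral_sum[symmetric]) (use int in auto)
    finally have "(\<Sum>(\<tau>, k)\<in>D. content k *\<^sub>R ?p \<tau>) - (LINT y:{0<..<x}|lebesgue. I y $ i)
        = (LINT y:{0<..<x}|lebesgue. (\<Sum>(\<tau>, k)\<in>D. content k *\<^sub>R (z \<tau> y $ i)) - I y $ i)"
      using sub[OF IL2] int by (subst set_integral_diff)
        (auto simp: set_integrable_def scaleR_sum_right split_beta' simp del: real_scaleR_def
          intro!: Bochner_Integration.integrable_sum)
    also have "\<dots> = (LINT y:{0<..<x}|lebesgue. ?v D y $ i)"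
      by (rule set_lebesgue_integral_cong) (use comp x in auto)
    also have "norm \<dots> \<le> state_norm n (?v D)"
      by (rule norm_set_integral_le_state_norm[OF i sq x])
    finally show ?thesis .
  qed
  have "((\<lambda>D. (\<Sum>(\<tau>, k)\<in>D. content k *\<^sub>R ?p \<tau>) - (LINT y:{0<..<x}|lebesgue. I y $ i)) \<longlongrightarrow> 0)
      (division_filter {0..t})"
  proof (rule Lim_null_comparison)
    show "((\<lambda>D. state_norm n (?v D)) \<longlongrightarrow> 0) (division_filter {0..t})"
      using I by (simp add: state_has_integral_def)
    show "\<forall>\<^sub>F D in division_filter {0..t}. norm ((\<Sum>(\<tau>, k)\<in>D. content k *\<^sub>R ?p \<tau>)
        - (LINT y:{0<..<x}|lebesgue. I y $ i)) \<le> state_norm n (?v D)"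
      using eventually_division_filter_tagged_division by eventually_elim (rule bound)
  qed
  then show ?thesis
    using has_integral_cbox[of ?p _ 0 t] by (simp add: LIM_zero_iff)
qed

text \<open>
  Continuity in time holds uniformly in \<open>x\<close>, because the difference of the primitives at two times is bounded
  by the distance of the states.
\<close>

lemma spatial_primitive_continuous:
  assumes z: "state_continuous n z" and i: "i < n"
  shows "continuous_on ({0..1} \<times> {0..}) (\<lambda>(x, t). LINT y:{0<..<x}|lebesgue. z t y $ i)"
proof -
  let ?p = "\<lambda>x t. LINT y:{0<..<x}|lebesgue. z t y $ i"
  have L2: "L2_on {0<..<1} n (z t)" if "t \<ge> 0" for t
    using z that by (auto simp: state_continuous_def)
  have diff: "cmod (?p x t - ?p x s) \<le> state_norm n (\<lambda>\<zeta>. z t \<zeta> - z s \<zeta>)"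
    if ts: "t \<ge> 0" "s \<ge> 0" and x: "x \<in> {0..1}" for t s x
  proof -
    have sub: "set_integrable lebesgue {0<..<x} (\<lambda>y. z t y $ i)" if "t \<ge> 0" for t
      by (rule set_integrable_subset[OF L2_on_unit_integrable[OF L2[OF that] i]]) (use x in auto)
    have comp: "(z t y - z s y) $ i = z t y $ i + (- 1) *\<^sub>R z s y $ i" if "y \<in> {0<..<1}" for y
    proof -
      have "z s y \<in> carrier_vec n" using L2[OF ts(2)] that by (auto simp: L2_on_def)
      then show ?thesis using i by simp
    qed
    have "square_integrable_on (\<lambda>y. z t y $ i + (- 1) *\<^sub>R z s y $ i) {0<..<1}"
      by (intro square_integrable_add square_integrable_scaleR L2_on_square_integrable[OF _ i] L2 ts)
    then have sq: "square_integrable_on (\<lambda>y. (z t y - z s y) $ i) {0<..<1}"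
      by (rule square_integrable_cong[THEN iffD1, rotated]) (rule comp[symmetric])
    have "?p x t - ?p x s = (LINT y:{0<..<x}|lebesgue. z t y $ i - z s y $ i)"
      using sub[OF ts(1)] sub[OF ts(2)] by (subst set_integral_diff) auto
    also have "\<dots> = (LINT y:{0<..<x}|lebesgue. (z t y - z s y) $ i)"
      by (rule set_lebesgue_integral_cong) (use comp x in auto)
    finally show ?thesis using norm_set_integral_le_state_norm[OF i sq] x by simp
  qed
  have zero: "state_norm n (\<lambda>\<zeta>. z s \<zeta> - z s \<zeta>) = 0" if "s \<ge> 0" for s
  proof -
    have "dim_vec (z s y) = n" if "y \<in> {0<..<1}" for y
      using L2[OF \<open>s \<ge> 0\<close>] that by (auto simp: L2_on_def)
    then have "(LINT y:{0<..<1}|lebesgue. (cmod ((z s y - z s y) $ j))\<^sup>2) = (LINT y:{0<..<1::real}|lebesgue. 0)"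
      if "j < n" for j
      by (intro set_lebesgue_integral_cong) (use that in auto)
    then show ?thesis by (simp add: state_norm_def set_lebesgue_integral_def)
  qed
  show ?thesis
    unfolding continuous_on_iff
  proof (intro ballI allI impI)
    fix q0 :: "real \<times> real" and e :: real assume q0: "q0 \<in> {0..1} \<times> {0..}" and e: "e > 0"
    obtain y s where ys: "q0 = (y, s)" "y \<in> {0..1}" "s \<in> {0..}" using q0 by blast
    have "continuous_on {0..1} (\<lambda>x. ?p x s)"
      by (rule set_integral_Ioo_eq_integral(3)[OF L2_on_unit_integrable[OF L2 i]]) (use ys in auto)
    then obtain d1 where d1: "d1 > 0" "\<And>x. x \<in> {0..1} \<Longrightarrow> dist x y < d1 \<Longrightarrow> dist (?p x s) (?p y s) < e / 2"
      using ys e unfolding continuous_on_iff by (meson half_gt_zero)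
    have "((\<lambda>t. state_norm n (\<lambda>\<zeta>. z t \<zeta> - z s \<zeta>)) \<longlongrightarrow> 0) (at s within {0..})"
      using z ys by (auto simp: state_continuous_def)
    then have "\<forall>\<^sub>F t in at s within {0..}. dist (state_norm n (\<lambda>\<zeta>. z t \<zeta> - z s \<zeta>)) 0 < e / 2"
      using e by (intro tendstoD) auto
    then obtain d2 where d2: "d2 > 0" "\<And>t. t \<in> {0..} \<Longrightarrow> t \<noteq> s \<Longrightarrow> dist t s < d2 \<Longrightarrow>
        dist (state_norm n (\<lambda>\<zeta>. z t \<zeta> - z s \<zeta>)) 0 < e / 2"
      unfolding eventually_at by blast
    show "\<exists>d>0. \<forall>q\<in>{0..1} \<times> {0..}. dist q q0 < d \<longrightarrow>
        dist (case q of (x, t) \<Rightarrow> ?p x t) (case q0 of (x, t) \<Rightarrow> ?p x t) < e"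
      unfolding ys(1) prod.case
    proof (intro exI[of _ "min d1 d2"] conjI ballI impI)
      fix q :: "real \<times> real" assume q: "q \<in> {0..1} \<times> {0..}" "dist q (y, s) < min d1 d2"
      obtain x t where xt: "q = (x, t)" by (cases q)
      have dx: "dist x y < d1" "dist t s < d2"
        using dist_fst_le[of q "(y, s)"] dist_snd_le[of q "(y, s)"] q(2) xt by auto
      have "state_norm n (\<lambda>\<zeta>. z t \<zeta> - z s \<zeta>) < e / 2"
        using d2(2)[of t] dx q xt zero[of s] ys e by (cases "t = s") (auto simp: dist_real_def)
      moreover have "dist (?p x t) (?p x s) \<le> state_norm n (\<lambda>\<zeta>. z t \<zeta> - z s \<zeta>)"
        using diff[of t s x] q xt ys by (simp add: dist_norm)
      moreover have "dist (?p x s) (?p y s) < e / 2" using d1(2)[of x] dx q xt by auto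
      ultimately have "dist (?p x t) (?p y s) < e"
        using dist_triangle[of "?p x t" "?p y s" "?p x s"] by linarith
      then show "dist (case q of (x, t) \<Rightarrow> ?p x t) (?p y s) < e" by (simp add: xt)
    qed (use d1 d2 in auto)
  qed
qed

section \<open>Boundary traces of mild solutions\<close>

lemma continuous_eq_if_integrals_eq:
  fixes f g :: "real \<Rightarrow> complex"
  assumes f: "continuous_on {0..1} f" and g: "continuous_on {0..1} g"
    and eq: "\<And>x. x \<in> {0..1} \<Longrightarrow> integral {0..x} f = integral {0..x} g" and x: "x \<in> {0..1}"
  shows "f x = g x"
proof -
  have 1: "((\<lambda>u. integral {0..u} f) has_vector_derivative f x) (at x within {0..1})"
    by (rule integral_has_vector_derivative[OF f x])
  have "((\<lambda>u. integral {0..u} g) has_vector_derivative g x) (at x within {0..1})"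
    by (rule integral_has_vector_derivative[OF g x])
  then have 2: "((\<lambda>u. integral {0..u} f) has_vector_derivative g x) (at x within {0..1})"
    by (rule has_vector_derivative_transform[rotated 2]) (use x eq in auto)
  have "at x within {0..1} \<noteq> bot"
    using x by (simp add: trivial_limit_within islimpt_Icc)
  from vector_derivative_unique_within[OF this 1 2] show ?thesis .
qed

lemma integrated_state_integral:
  assumes z: "state_continuous n z" and Z: "integrated_state n z t Z dZ" and t: "0 \<le> t"
    and i: "i < n" and x: "x \<in> {0..1}"
  shows "((\<lambda>\<tau>. LINT y:{0<..<x}|lebesgue. z \<tau> y $ i) has_integral integral {0..x} (\<lambda>y. Z y $ i)) {0..t}"
proof -
  have H1: "has_H1_derivative n Z dZ" and I: "state_has_integral n z Z 0 t"
    using Z by (auto simp: integrated_state_def)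
  have "(LINT y:{0<..<x}|lebesgue. Z y $ i) = integral {0..x} (\<lambda>y. Z y $ i)"
    by (rule set_integral_Ioo_eq_integral(2)[OF L2_on_unit_integrable[OF has_H1_derivative_L2[OF H1] i]])
      (use x in auto)
  then show ?thesis
    using state_has_integral_imp_has_integral[OF I t _ i, of x] z x by (auto simp: state_continuous_def)
qed

text \<open>
  Solution and output may come with different representatives of the integrated state; continuity
  makes them equal at every point, in particular at the boundary.
\<close>

lemma integrated_state_unique:
  assumes z: "state_continuous n z" and t: "0 \<le> t"
    and Z: "integrated_state n z t Z dZ" "integrated_state n z t Z' dZ'" and x: "x \<in> {0..1}"
  shows "Z x = Z' x"
proof -
  have H1: "has_H1_derivative n Z dZ" "has_H1_derivative n Z' dZ'"
    using Z by (auto simp: integrated_state_def)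
  have "Z x $ i = Z' x $ i" if i: "i < n" for i
    by (rule continuous_eq_if_integrals_eq[OF has_H1_derivative_continuous[OF H1(1) i]
          has_H1_derivative_continuous[OF H1(2) i] _ x])
      (rule has_integral_unique[OF integrated_state_integral[OF z Z(1) t i]
          integrated_state_integral[OF z Z(2) t i]])
  then show ?thesis
    using has_H1_derivative_carrier[OF H1(1) x] has_H1_derivative_carrier[OF H1(2) x]
    by (intro eq_vecI) auto
qed

text \<open>
  For \<open>T \<ge> 1 / lam\<close> the characteristic that ends in \<open>(1,T)\<close> starts at the boundary \<open>x = 0\<close>, for smaller
  \<open>T\<close> it starts at time \<open>0\<close>. The terms with \<open>p0\<close> account for the difference between the integrated state and the
  function that is constant along characteristics.
\<close>

lemma mild_solution_boundary_traces:
  assumes lam: "lam > 0" and z: "state_continuous n z" and z0: "L2_on {0<..<1} n z0"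
    and Z: "\<And>t. 0 \<le> t \<Longrightarrow> integrated_state n z t (Z t) (dZ t)"
    and dZ: "\<And>t. 0 \<le> t \<Longrightarrow>
      AE \<zeta>\<in>{0<..<1} in lebesgue. z t \<zeta> - z0 \<zeta> = complex_of_real (- lam) \<cdot>\<^sub>v dZ t \<zeta>"
    and i: "i < n"
  defines "p0 \<equiv> \<lambda>x. LINT y:{0<..<x}|lebesgue. z0 y $ i"
  shows "1 / lam \<le> T \<Longrightarrow> Z T 1 $ i = Z (T - 1 / lam) 0 $ i + p0 1 / complex_of_real lam"
    and "0 \<le> T \<Longrightarrow> T \<le> 1 / lam \<Longrightarrow> Z T 1 $ i = (p0 1 - p0 (1 - lam * T)) / complex_of_real lam"
    and "Z 0 0 $ i = 0"
proof -
  define p where "p x t = (LINT y:{0<..<x}|lebesgue. z t y $ i)" for x t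
  define b where "b t = Z t 0 $ i" for t
  have H1: "has_H1_derivative n (Z t) (dZ t)" if "0 \<le> t" for t
    using Z[OF that] by (simp add: integrated_state_def)
  have zL2: "L2_on {0<..<1} n (z t)" if "0 \<le> t" for t
    using z that by (auto simp: state_continuous_def)
  have dZL2: "L2_on {0<..<1} n (dZ t)" if "0 \<le> t" for t
    using H1[OF that] unfolding has_H1_derivative_def by blast
  have sub: "set_integrable lebesgue {0<..<x} (\<lambda>y. f y $ i)" if "L2_on {0<..<1} n f" "x \<le> 1" for f x
    by (rule set_integrable_subset[OF L2_on_unit_integrable[OF that(1) i]]) (use that in auto)
  have Z_eq: "Z t x $ i = b t - (p x t - p0 x) / complex_of_real lam" if t: "0 \<le> t" and x: "x \<in> {0..1}" for t x
  proof -
    have x1: "x \<le> 1" using x by simp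
    have "p x t - p0 x = (LINT y:{0<..<x}|lebesgue. z t y $ i - z0 y $ i)"
      unfolding p_def p0_def using sub[OF zL2[OF t] x1] sub[OF z0 x1] by (subst set_integral_diff) auto
    also have "\<dots> = (LINT y:{0<..<x}|lebesgue. complex_of_real (- lam) * dZ t y $ i)"
      unfolding set_lebesgue_integral_def
    proof (rule integral_cong_AE)
      have "set_integrable lebesgue {0<..<x} (\<lambda>y. z t y $ i - z0 y $ i)"
        by (rule set_integral_diff(1)[OF sub[OF zL2[OF t] x1] sub[OF z0 x1]])
      then show "(\<lambda>y. indicat_real {0<..<x} y *\<^sub>R (z t y $ i - z0 y $ i)) \<in> borel_measurable lebesgue"
        unfolding set_integrable_def by (rule borel_measurable_integrable)
      have "set_integrable lebesgue {0<..<x} (\<lambda>y. complex_of_real (- lam) * dZ t y $ i)"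
        by (rule set_integrable_mult_right) (rule sub[OF dZL2[OF t] x1])
      then show "(\<lambda>y. indicat_real {0<..<x} y *\<^sub>R (complex_of_real (- lam) * dZ t y $ i)) \<in> borel_measurable lebesgue"
        unfolding set_integrable_def by (rule borel_measurable_integrable)
      show "AE y in lebesgue. indicat_real {0<..<x} y *\<^sub>R (z t y $ i - z0 y $ i)
          = indicat_real {0<..<x} y *\<^sub>R (complex_of_real (- lam) * dZ t y $ i)"
        using dZ[OF t]
      proof eventually_elim
        case (elim y)
        show ?case
        proof (cases "y \<in> {0<..<x}")
          case True
          then have y: "y \<in> {0<..<1}" using x1 by auto
          have "z0 y \<in> carrier_vec n" "dZ t y \<in> carrier_vec n"
            using z0 dZL2[OF t] y by (auto simp: L2_on_def)
          moreover have "(z t y - z0 y) $ i = (complex_of_real (- lam) \<cdot>\<^sub>v dZ t y) $ i"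
            using elim y by simp
          ultimately show ?thesis using i True by simp
        qed simp
      qed
    qed
    also have "\<dots> = - complex_of_real lam * (LINT y:{0<..<x}|lebesgue. dZ t y $ i)"
      using set_integral_mult_right[of lebesgue "{0<..<x}" "complex_of_real (- lam)" "\<lambda>y. dZ t y $ i"] by simp
    finally have "(LINT y:{0<..<x}|lebesgue. dZ t y $ i) = - (p x t - p0 x) / complex_of_real lam"
      using lam by (simp add: field_simps)
    then show ?thesis
      using has_H1_derivative_index[OF H1[OF t] x i] by (simp add: b_def diff_divide_distrib)
  qed
  have N: "(p x has_integral integral {0..x} (\<lambda>y. Z t y $ i)) {0..t}" if "0 \<le> t" "x \<in> {0..1}" for x t
    using integrated_state_integral[OF z Z[OF that(1)] that(1) i that(2)] by (simp add: p_def[abs_def])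
  have Z_cont: "continuous_on {0..1} (\<lambda>x. Z t x $ i)" if "0 \<le> t" for t
    by (rule has_H1_derivative_continuous[OF H1[OF that] i])
  have Z0: "Z 0 x $ i = 0" if "x \<in> {0..1}" for x
  proof (rule continuous_eq_if_integrals_eq[OF Z_cont _ _ that])
    fix x :: real assume "x \<in> {0..1}"
    have "integral {0..x} (\<lambda>y. Z 0 y $ i) = integral {0..0} (p x)"
      by (rule integral_unique[OF N[OF order_refl \<open>x \<in> {0..1}\<close>], symmetric])
    also have "\<dots> = 0"
      using integral_refl[of 0 "p x"] unfolding cbox_interval .
    finally show "integral {0..x} (\<lambda>y. Z 0 y $ i) = integral {0..x} (\<lambda>y. 0)" by simp
  qed auto
  then show "Z 0 0 $ i = 0" by simp
  then have b0: "b 0 = 0" by (simp add: b_def)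
  have p_0: "p x 0 = p0 x" if "x \<in> {0..1}" for x
    using Z_eq[of 0 x] Z0[OF that] b0 that lam by simp
  have p_cont: "continuous_on ({0..1} \<times> {0..}) (\<lambda>(x, t). p x t)"
    unfolding p_def by (rule spatial_primitive_continuous[OF z i])
  have p_cont_t: "continuous_on {0..} (p x)" if "x \<in> {0..1}" for x
    using continuous_on_compose2[OF p_cont, of "{0..}" "\<lambda>t. (x, t)"] that
    by (simp add: continuous_on_Pair image_subset_iff)
  have p_cont_x: "continuous_on {0..1} (\<lambda>x. p x t)" if "0 \<le> t" for t
    using continuous_on_compose2[OF p_cont, of "{0..1}" "\<lambda>x. (x, t)"] that
    by (simp add: continuous_on_Pair image_subset_iff)
  have p0_cont: "continuous_on {0..1} p0"
    unfolding p0_def by (rule set_integral_Ioo_eq_integral(3)[OF L2_on_unit_integrable[OF z0 i]])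
  \<comment> \<open>averaging over space expresses the trace at \<open>0\<close> by quantities whose continuity in time is known\<close>
  have b_eq: "b t = integral {0..t} (p 1) + (integral {0..1} (\<lambda>x. p x t) - integral {0..1} p0) / complex_of_real lam"
    if t: "0 \<le> t" for t
  proof -
    have "integral {0..t} (p 1) = integral {0..1} (\<lambda>x. Z t x $ i)"
      using N[OF t, of 1] by (simp add: integral_unique)
    also have "\<dots> = integral {0..1} (\<lambda>x. b t - (p x t - p0 x) / complex_of_real lam)"
      by (rule Henstock_Kurzweil_Integration.integral_cong) (use Z_eq[OF t] in auto)
    also have "\<dots> = b t - (integral {0..1} (\<lambda>x. p x t) - integral {0..1} p0) / complex_of_real lam"
    proof (rule integral_unique)
      have "((\<lambda>x. (p x t - p0 x) / complex_of_real lam) has_integral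
          (integral {0..1} (\<lambda>x. p x t) - integral {0..1} p0) / complex_of_real lam) {0..1}"
        by (intro has_integral_divide has_integral_diff integrable_integral integrable_continuous_real
            p_cont_x[OF t] p0_cont)
      from has_integral_diff[OF has_integral_const_real[of "b t" 0 1] this]
      show "((\<lambda>x. b t - (p x t - p0 x) / complex_of_real lam) has_integral
          b t - (integral {0..1} (\<lambda>x. p x t) - integral {0..1} p0) / complex_of_real lam) {0..1}"
        by simp
    qed
    finally show ?thesis by simp
  qed
  have b_cont: "continuous_on {0..} b"
  proof -
    have "continuous_on {0..} (\<lambda>t. integral {0..t} (p 1))"
      unfolding continuous_on_eq_continuous_within
      using has_vector_derivative_continuous[OF integral_has_vector_derivative_ray[OF p_cont_t[of 1]]] by auto
    moreover have "continuous_on ({0..} \<times> {0..1}) (\<lambda>(t, x). p x t)"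
      using continuous_on_compose2[OF p_cont, of "{0..} \<times> {0..1}" "\<lambda>q. (snd q, fst q)"]
        continuous_on_Pair[OF continuous_on_snd[OF continuous_on_id] continuous_on_fst[OF continuous_on_id],
          of "{0..} \<times> {0..1}"]
      by (simp add: split_beta' image_subset_iff)
    then have "continuous_on {0..} (\<lambda>t. integral {0..1} (\<lambda>x. p x t))"
      using integral_continuous_on_param[of "{0..}" 0 1 "\<lambda>t x. p x t"] by simp
    ultimately have "continuous_on {0..} (\<lambda>t. integral {0..t} (p 1)
        + (integral {0..1} (\<lambda>x. p x t) - integral {0..1} p0) / complex_of_real lam)"
      using lam by (intro continuous_on_add continuous_on_divide continuous_on_diff continuous_on_const) auto
    then show ?thesis by (rule continuous_on_eq) (simp add: b_eq)
  qed
  define G where "G x t = b t - p x t / complex_of_real lam" for x t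
  have Z_G: "Z t x $ i = G x t + p0 x / complex_of_real lam" if "0 \<le> t" "x \<in> {0..1}" for t x
    using Z_eq[OF that] by (simp add: G_def diff_divide_distrib)
  have G_0: "G x 0 = - p0 x / complex_of_real lam" if "x \<in> {0..1}" for x
    using p_0[OF that] b0 by (simp add: G_def)
  have p_at_0: "p 0 t = 0" for t by (simp add: p_def set_lebesgue_integral_def)
  have G_cont: "continuous_on ({0..1} \<times> {0..}) (\<lambda>(x, t). G x t)"
  proof -
    have "continuous_on ({0..1::real} \<times> {0..}) (\<lambda>q. b (snd q))"
      by (rule continuous_on_compose2[OF b_cont]) (auto intro!: continuous_intros)
    moreover have "continuous_on ({0..1} \<times> {0..}) (\<lambda>q. p (fst q) (snd q))"
      using p_cont by (simp add: split_beta')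
    ultimately have "continuous_on ({0..1} \<times> {0..}) (\<lambda>q. b (snd q) - p (fst q) (snd q) / complex_of_real lam)"
      using lam by (intro continuous_on_diff continuous_on_divide continuous_on_const) auto
    then show ?thesis by (simp add: G_def split_beta')
  qed
  have circ: "integral {0..x} (\<lambda>\<xi>. G \<xi> t) - integral {0..x} (\<lambda>\<xi>. G \<xi> 0)
      = - lam *\<^sub>R (integral {0..t} (G x) - integral {0..t} (G 0))" if x: "x \<in> {0..1}" and t: "0 \<le> t" for x t
  proof -
    have G_int_x: "(\<lambda>\<xi>. G \<xi> t) integrable_on {0..x}" if "0 \<le> t" for t
      unfolding G_def using p_cont_x[OF that] x lam
      by (intro integrable_continuous_real continuous_on_diff continuous_on_divide continuous_on_const)
        (auto intro: continuous_on_subset)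
    have G_int_t: "G x integrable_on {0..t}" if "x \<in> {0..1}" for x
      unfolding G_def[abs_def] using p_cont_t[OF that] b_cont lam
      by (intro integrable_continuous_real continuous_on_diff continuous_on_divide continuous_on_const)
        (auto intro: continuous_on_subset)
    have "integral {0..x} (\<lambda>\<xi>. G \<xi> t) - integral {0..x} (\<lambda>\<xi>. G \<xi> 0) = integral {0..x} (\<lambda>\<xi>. G \<xi> t - G \<xi> 0)"
      using G_int_x[OF t] G_int_x[of 0] by (simp add: Henstock_Kurzweil_Integration.integral_diff)
    also have "\<dots> = integral {0..x} (\<lambda>\<xi>. Z t \<xi> $ i)"
      by (rule Henstock_Kurzweil_Integration.integral_cong) (use Z_G[OF t] G_0 x in auto)
    also have "\<dots> = integral {0..t} (p x)"
      using N[OF t x] by (simp add: integral_unique)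
    also have "\<dots> = integral {0..t} (\<lambda>\<tau>. (- lam) *\<^sub>R (G x \<tau> - G 0 \<tau>))"
      using lam by (intro Henstock_Kurzweil_Integration.integral_cong)
        (simp add: G_def p_at_0 scaleR_conv_of_real)
    also have "\<dots> = - lam *\<^sub>R (integral {0..t} (G x) - integral {0..t} (G 0))"
      using Henstock_Kurzweil_Integration.integral_diff[OF G_int_t[OF x] G_int_t[of 0]] by simp
    finally show ?thesis .
  qed
  note transport = constant_along_characteristics[OF G_cont circ lam]
  show "Z T 1 $ i = Z (T - 1 / lam) 0 $ i + p0 1 / complex_of_real lam" if T: "1 / lam \<le> T"
  proof -
    have T0: "0 \<le> T" using T lam by (meson divide_nonneg_pos order_trans zero_le_one)
    have "G 1 T = G (1 - lam * (1 / lam)) (T - 1 / lam)"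
      by (rule transport) (use T lam in auto)
    also have "\<dots> = b (T - 1 / lam)" using lam by (simp add: G_def p_at_0)
    finally show ?thesis using Z_G[OF T0, of 1] by (simp add: b_def)
  qed
  show "Z T 1 $ i = (p0 1 - p0 (1 - lam * T)) / complex_of_real lam" if T: "0 \<le> T" "T \<le> 1 / lam"
  proof -
    have "lam * T \<le> 1" using T lam by (simp add: field_simps)
    then have "G 1 T = G (1 - lam * T) (T - T)"
      by (intro transport) (use T lam in auto)
    also have "\<dots> = - p0 (1 - lam * T) / complex_of_real lam"
      using G_0[of "1 - lam * T"] \<open>lam * T \<le> 1\<close> T lam by simp
    finally show ?thesis using Z_G[OF T(1), of 1] by (simp add: diff_divide_distrib)
  qed
qed

context phs_matrices
begin

text \<open>
  The integrated boundary condition and output equation are those of the discrete-time system, except that the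
  trace at the outflow end at time \<open>t\<close> and the trace at the inflow end at time \<open>t - 1 / lam\<close> differ by the
  constant \<open>(\<integral>\<^sub>0\<^sup>1 z0) / lam\<close>. Taking differences between two sequences of times removes this constant.
\<close>

lemma primitive_in_Vd_if_output_can_vanish:
  assumes z0: "L2_on {0<..<1} n z0" and van: "output_can_vanish lam n p m K L Ky Ly z0"
    and x: "x \<in> {0..1}"
  shows "vec_integral {0<..<1} n z0 - vec_integral {0<..<x} n z0 \<in> Vd"
proof -
  obtain u z y where sol: "mild_solution lam n p K L z0 u z" and out: "has_output lam n m Ky Ly z y"
    and y0: "AE t\<in>{0<..} in lebesgue. y t = 0\<^sub>v m"
    using van unfolding output_can_vanish_def by blast
  have z: "state_continuous n z" using sol by (simp add: mild_solution_def)
  have "\<forall>t\<in>{0..}. \<exists>Q. integrated_state n z t (fst Q) (snd Q) \<and>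
      (AE \<zeta>\<in>{0<..<1} in lebesgue. z t \<zeta> - z0 \<zeta> = complex_of_real (- lam) \<cdot>\<^sub>v snd Q \<zeta>) \<and>
      0\<^sub>v (n - p) @\<^sub>v vec_integral {0<..<t} p u =
        complex_of_real (- lam) \<cdot>\<^sub>v (K *\<^sub>v fst Q 0) - complex_of_real lam \<cdot>\<^sub>v (L *\<^sub>v fst Q 1)"
    (is "\<forall>t\<in>{0..}. \<exists>Q. ?P t Q")
  proof
    fix t :: real assume "t \<in> {0..}"
    then obtain Zt dZt where "?P t (Zt, dZt)"
      using sol unfolding mild_solution_def fst_conv snd_conv by (meson atLeast_iff)
    then show "\<exists>Q. ?P t Q" by (rule exI)
  qed
  from bchoice[OF this] obtain Q where Q: "\<forall>t\<in>{0..}. ?P t (Q t)" ..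
  define Z dZ where "Z t = fst (Q t)" and "dZ t = snd (Q t)" for t
  have Z: "integrated_state n z t (Z t) (dZ t)"
    and dZ: "AE \<zeta>\<in>{0<..<1} in lebesgue. z t \<zeta> - z0 \<zeta> = complex_of_real (- lam) \<cdot>\<^sub>v dZ t \<zeta>"
    and bc: "0\<^sub>v (n - p) @\<^sub>v vec_integral {0<..<t} p u =
      complex_of_real (- lam) \<cdot>\<^sub>v (K *\<^sub>v Z t 0) - complex_of_real lam \<cdot>\<^sub>v (L *\<^sub>v Z t 1)"
    if "0 \<le> t" for t
    using bspec[OF Q, of t] that by (simp_all add: Z_def dZ_def)
  define U where "U t = vec_integral {0<..<t} p u" for t
  define s where "s t = Z t 1" for t
  have Zc: "Z t \<zeta> \<in> carrier_vec n" if "0 \<le> t" "\<zeta> \<in> {0..1}" for t \<zeta>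
    using has_H1_derivative_carrier[OF _ that(2)] Z[OF that(1)] by (auto simp: integrated_state_def)
  have sc: "s t \<in> carrier_vec n" if "0 \<le> t" for t using Zc[OF that, of 1] by (simp add: s_def)
  have Uc: "U t \<in> carrier_vec p" for t by (simp add: U_def vec_integral_def)
  have b_eq: "Z t 0 = A *\<^sub>v s t + B *\<^sub>v U t" if t: "0 \<le> t" for t
    using boundary_condition_iff[OF Zc[OF t, of 0] sc[OF t] Uc[of t]] bc[OF t] by (simp add: s_def U_def)
  have out_eq: "C *\<^sub>v s t + D *\<^sub>v U t = 0\<^sub>v m" if t: "0 \<le> t" for t
  proof -
    obtain Z' dZ' where Z': "integrated_state n z t Z' dZ'"
      "vec_integral {0<..<t} m y = complex_of_real (- lam) \<cdot>\<^sub>v (Ky *\<^sub>v Z' 0) - complex_of_real lam \<cdot>\<^sub>v (Ly *\<^sub>v Z' 1)"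
      using out t unfolding has_output_def by blast
    have "Z' \<zeta> = Z t \<zeta>" if "\<zeta> \<in> {0..1}" for \<zeta>
      by (rule integrated_state_unique[OF z t Z'(1) Z[OF t] that])
    then have "vec_integral {0<..<t} m y = C *\<^sub>v s t + D *\<^sub>v U t"
      unfolding output_eq[OF sc[OF t] Uc, symmetric] b_eq[OF t, symmetric] using Z'(2) by (simp add: s_def)
    moreover have "vec_integral {0<..<t} m y = 0\<^sub>v m"
    proof (rule eq_vecI)
      fix i assume "i < dim_vec (0\<^sub>v m :: complex vec)"
      then have i: "i < m" by simp
      have "(LINT r:{0<..<t}|lebesgue. y r $ i) = 0"
        unfolding set_lebesgue_integral_def
      proof (rule integral_eq_zero_AE)
        show "AE r in lebesgue. indicat_real {0<..<t} r *\<^sub>R y r $ i = 0"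
          using y0 by eventually_elim (use i in \<open>auto simp: indicator_def\<close>)
      qed
      then show "vec_integral {0<..<t} m y $ i = 0\<^sub>v m $ i" using i by (simp add: vec_integral_def)
    qed (simp add: vec_integral_def)
    ultimately show ?thesis by simp
  qed
  define \<pi> where "\<pi> x = vec_integral {0<..<x} n z0" for x
  have \<pi>: "\<pi> x \<in> carrier_vec n" "i < n \<Longrightarrow> \<pi> x $ i = (LINT y:{0<..<x}|lebesgue. z0 y $ i)" for x i
    by (simp_all add: \<pi>_def vec_integral_def)
  let ?c = "complex_of_real (inverse lam)"
  note traces = mild_solution_boundary_traces[OF lam z z0 Z dZ]
  have s_late: "s T = Z (T - 1 / lam) 0 + ?c \<cdot>\<^sub>v \<pi> 1" if T: "1 / lam \<le> T" for T
  proof -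
    have T': "0 \<le> T" "0 \<le> T - 1 / lam" using T lam by (auto intro: order_trans[of 0 "1 / lam"])
    show ?thesis
      using Zc[OF T'(1), of 1] Zc[OF T'(2), of 0] \<pi>(1)[of 1] traces(1)[OF _ _ _ T] \<pi>(2)[of _ 1]
      by (intro eq_vecI) (auto simp: s_def divide_inverse mult.commute)
  qed
  have s_early: "s T = ?c \<cdot>\<^sub>v (\<pi> 1 - \<pi> (1 - lam * T))" if T: "0 \<le> T" "T \<le> 1 / lam" for T
    using Zc[OF T(1), of 1] \<pi>(1)[of 1] \<pi>(1)[of "1 - lam * T"] traces(2)[OF _ _ _ T] \<pi>(2)[of _ 1] \<pi>(2)[of _ "1 - lam * T"]
    by (intro eq_vecI) (auto simp: s_def divide_inverse mult.commute)
  \<comment> \<open>the times of arrival at the outflow end, after \<open>k\<close> re-entries at the inflow end, of what starts in \<open>x\<close> and in \<open>1\<close>\<close>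
  define t1 t2 where "t1 k = (real k + 1 - x) / lam" and "t2 k = real k / lam" for k :: nat
  have t: "0 \<le> t1 k" "0 \<le> t2 k" "t1 (Suc k) - 1 / lam = t1 k" "t2 (Suc k) - 1 / lam = t2 k"
    "1 / lam \<le> t1 (Suc k)" "1 / lam \<le> t2 (Suc k)" for k
    using x lam by (auto simp: t1_def t2_def field_simps)
  define w where "w k = s (t1 k) - s (t2 k)" for k
  define v where "v k = U (t1 k) - U (t2 k)" for k
  have sub: "M *\<^sub>v w k + N *\<^sub>v v k = (M *\<^sub>v s (t1 k) + N *\<^sub>v U (t1 k)) - (M *\<^sub>v s (t2 k) + N *\<^sub>v U (t2 k))"
    if "M \<in> carrier_mat r n" "N \<in> carrier_mat r p" for M N r k
    unfolding w_def v_def mult_minus_distrib_mat_vec[OF that(1) sc[OF t(1)] sc[OF t(2)]]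
      mult_minus_distrib_mat_vec[OF that(2) Uc Uc]
    using that by (intro eq_vecI) (auto simp del: index_mult_mat_vec)
  have "nulling_trajectory w v"
    unfolding nulling_trajectory_def
  proof (intro allI conjI)
    fix k
    show "w k \<in> carrier_vec n" using sc[OF t(1)] sc[OF t(2)] by (simp add: w_def)
    show "v k \<in> carrier_vec p" using Uc by (simp add: v_def)
    have "s (t1 (Suc k)) = Z (t1 k) 0 + ?c \<cdot>\<^sub>v \<pi> 1" "s (t2 (Suc k)) = Z (t2 k) 0 + ?c \<cdot>\<^sub>v \<pi> 1"
      using s_late[OF t(5)[of k]] s_late[OF t(6)[of k]] unfolding t(3,4) by auto
    then have "w (Suc k) = Z (t1 k) 0 - Z (t2 k) 0"
      using Zc[OF t(1), of 0 k] Zc[OF t(2), of 0 k] \<pi>(1)[of 1] by (intro eq_vecI) (auto simp: w_def)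
    also have "\<dots> = A *\<^sub>v w k + B *\<^sub>v v k"
      unfolding sub[OF A B] b_eq[OF t(1)] b_eq[OF t(2)] ..
    finally show "w (Suc k) = A *\<^sub>v w k + B *\<^sub>v v k" .
    show "C *\<^sub>v w k + D *\<^sub>v v k = 0\<^sub>v m"
      unfolding sub[OF C D] out_eq[OF t(1)] out_eq[OF t(2)] by simp
  qed
  then have "w 0 \<in> Vd" unfolding Vd_iff by blast
  moreover have "w 0 = ?c \<cdot>\<^sub>v (\<pi> 1 - \<pi> x)"
  proof -
    have "t1 0 \<le> 1 / lam" "t2 0 \<le> 1 / lam" "1 - lam * t1 0 = x" "1 - lam * t2 0 = 1"
      using x lam by (auto simp: t1_def t2_def field_simps)
    then have "s (t1 0) = ?c \<cdot>\<^sub>v (\<pi> 1 - \<pi> x)" "s (t2 0) = ?c \<cdot>\<^sub>v (\<pi> 1 - \<pi> 1)"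
      using s_early[OF t(1)[of 0]] s_early[OF t(2)[of 0]] by auto
    then show ?thesis using \<pi>(1) by (intro eq_vecI) (auto simp: w_def carrier_vecD[OF \<pi>(1)])
  qed
  ultimately have "complex_of_real lam \<cdot>\<^sub>v (?c \<cdot>\<^sub>v (\<pi> 1 - \<pi> x)) \<in> Vd"
    using vec_subspaceD(4)[OF Vd_subspace, of "w 0" "complex_of_real lam"] by simp
  also have "complex_of_real lam \<cdot>\<^sub>v (?c \<cdot>\<^sub>v (\<pi> 1 - \<pi> x)) = \<pi> 1 - \<pi> x"
    using lam \<pi>(1) by (intro eq_vecI) (auto simp: carrier_vecD[OF \<pi>(1)])
  finally show ?thesis by (simp add: \<pi>_def)
qed

text \<open>
  With a projection \<open>P\<close> onto the subspace, \<open>P z0 - z0\<close> has integral zero over \<open>(0,x)\<close> for all \<open>x\<close>.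
\<close>

lemma values_in_Vd_if_output_can_vanish:
  assumes z0: "L2_on {0<..<1} n z0" and van: "output_can_vanish lam n p m K L Ky Ly z0"
  shows "z0 \<in> L2_into n Vd"
proof -
  obtain P where P: "P \<in> carrier_mat n n" "\<And>w. w \<in> carrier_vec n \<Longrightarrow> P *\<^sub>v w \<in> Vd"
    "\<And>w. w \<in> Vd \<Longrightarrow> P *\<^sub>v w = w"
    using subspace_projection[OF Vd_subspace] by metis
  define \<pi> where "\<pi> x = vec_integral {0<..<x} n z0" for x
  have \<pi>c: "\<pi> x \<in> carrier_vec n" for x by (simp add: \<pi>_def vec_integral_def)
  have one: "1\<^sub>m n \<in> carrier_mat n n" by simp
  let ?h = "\<lambda>y. 1 \<cdot>\<^sub>v (P *\<^sub>v z0 y) - 1 \<cdot>\<^sub>v (1\<^sub>m n *\<^sub>v z0 y)"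
  have z0c: "z0 y \<in> carrier_vec n" if "y \<in> {0<..<1}" for y using z0 that by (auto simp: L2_on_def)
  have h_int: "vec_integral {0<..<x} n ?h = 1 \<cdot>\<^sub>v (P *\<^sub>v \<pi> x) - 1 \<cdot>\<^sub>v (1\<^sub>m n *\<^sub>v \<pi> x)" if x: "x \<in> {0..1}" for x
    unfolding \<pi>_def
  proof (rule vec_integral_boundary_combination[symmetric, OF _ _ _ _ P(1) one])
    show "set_integrable lebesgue {0<..<x} (\<lambda>y. z0 y $ i)" if "i < n" for i
      by (rule set_integrable_subset[OF L2_on_unit_integrable[OF z0 that]]) (use x in auto)
    then show "set_integrable lebesgue {0<..<x} (\<lambda>y. z0 y $ i)" if "i < n" for i
      using that .
  qed (use x z0c in auto)
  have comp: "?h y $ i = (\<Sum>j<n. (P $$ (i, j) - (1\<^sub>m n) $$ (i, j)) * z0 y $ j)" if "y \<in> {0<..<1}" "i < n" for y i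
  proof -
    have "?h y $ i = (P *\<^sub>v z0 y) $ i - (1\<^sub>m n *\<^sub>v z0 y) $ i"
      using that P(1) carrier_vecD[OF z0c[OF that(1)]] by (simp del: index_mult_mat_vec)
    then show ?thesis
      using index_mult_mat_vec_sum[OF P(1) z0c[OF that(1)] that(2)] index_mult_mat_vec_sum[OF one z0c[OF that(1)] that(2)]
      by (simp only: sum_subtractf left_diff_distrib)
  qed
  have fixed: "P *\<^sub>v (\<pi> 1 - \<pi> x) = \<pi> 1 - \<pi> x" if "x \<in> {0..1}" for x
    using P(3)[OF primitive_in_Vd_if_output_can_vanish[OF z0 van that]] by (simp add: \<pi>_def)
  have \<pi>0: "\<pi> 0 = 0\<^sub>v n"
    by (intro eq_vecI) (auto simp: \<pi>_def vec_integral_def set_lebesgue_integral_def)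
  have P\<pi>: "P *\<^sub>v \<pi> x = \<pi> x" if x: "x \<in> {0..1}" for x
  proof -
    have "\<pi> x = (\<pi> 1 - \<pi> 0) - (\<pi> 1 - \<pi> x)"
      using \<pi>0 by (intro eq_vecI) (auto simp: carrier_vecD[OF \<pi>c])
    then show ?thesis
      using fixed[OF x] fixed[of 0] \<pi>c mult_minus_distrib_mat_vec[OF P(1), of "\<pi> 1 - \<pi> 0" "\<pi> 1 - \<pi> x"]
      by (metis atLeastAtMost_iff minus_carrier_vec order_refl zero_le_one)
  qed
  have zero: "AE y\<in>{0<..<1} in lebesgue. ?h y $ i = 0" if i: "i < n" for i
  proof (rule zero_AE_if_integrals_zero)
    have "set_integrable lebesgue {0<..<1} (\<lambda>y. \<Sum>j<n. (P $$ (i, j) - (1\<^sub>m n) $$ (i, j)) * z0 y $ j)"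
      using set_integrable_mult_right[OF L2_on_unit_integrable[OF z0]]
      unfolding set_integrable_def scaleR_sum_right by (intro Bochner_Integration.integrable_sum) auto
    then show "set_integrable lebesgue {0<..<1} (\<lambda>y. ?h y $ i)"
      by (rule set_integrable_cong[THEN iffD1, rotated -1]) (use comp[OF _ i] in \<open>auto simp del: index_mult_mat_vec\<close>)
    fix x :: real assume x: "0 \<le> x" "x \<le> 1"
    have "(LINT y:{0<..<x}|lebesgue. ?h y $ i) = vec_integral {0<..<x} n ?h $ i"
      unfolding vec_integral_def using i by (simp del: index_mult_mat_vec)
    also have "\<dots> = (1 \<cdot>\<^sub>v \<pi> x - 1 \<cdot>\<^sub>v (1\<^sub>m n *\<^sub>v \<pi> x)) $ i"
      using h_int[of x] P\<pi>[of x] x by simp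
    also have "\<dots> = 0" using i \<pi>c[of x] by simp
    finally show "(LINT y:{0<..<x}|lebesgue. ?h y $ i) = 0" .
  qed
  have "AE y in lebesgue. \<forall>i\<in>{..<n}. y \<in> {0<..<1} \<longrightarrow> ?h y $ i = 0"
    using zero by (intro AE_finite_allI) auto
  then have "AE y\<in>{0<..<1} in lebesgue. z0 y \<in> Vd"
  proof eventually_elim
    case (elim y)
    show ?case
    proof
      assume y: "y \<in> {0<..<1}"
      have "P *\<^sub>v z0 y = z0 y"
      proof (rule eq_vecI)
        fix i assume "i < dim_vec (z0 y)"
        then have i: "i < n" using z0c[OF y] by simp
        have "?h y $ i = (P *\<^sub>v z0 y) $ i - z0 y $ i"
          using i P(1) carrier_vecD[OF z0c[OF y]] one_mult_mat_vec[OF z0c[OF y]]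
          by (simp del: index_mult_mat_vec)
        moreover have "?h y $ i = 0" using elim y i by blast
        ultimately show "(P *\<^sub>v z0 y) $ i = z0 y $ i" by simp
      qed (use P(1) z0c[OF y] in simp)
      then show "z0 y \<in> Vd" using P(2)[OF z0c[OF y]] by simp
    qed
  qed
  then show ?thesis using z0 by (simp add: L2_into_def)
qed

end

theorem theorem3p3:
  fixes lam :: real and n p m :: nat and K L Ky Ly :: "complex mat"
  assumes "lam > 0" and "p \<le> n"
    and "K \<in> carrier_mat n n" and "L \<in> carrier_mat n n"
    and "Ky \<in> carrier_mat m n" and "Ly \<in> carrier_mat m n"
    and "invertible_mat K"
  defines "Vd \<equiv> discrete_output_nulling n p m
                   (A_d K L) (B_d lam n p K) (C_d lam K L Ky Ly) (D_d lam n p K Ky)"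
  shows "(\<forall>z0 \<in> state_space n.
            output_can_vanish lam n p m K L Ky Ly z0 \<longleftrightarrow> z0 \<in> L2_into n Vd)
         \<and> phs_output_nulling lam n p m K L Ky Ly = L2_into n Vd"
proof -
  interpret phs_matrices lam n p m K L Ky Ly
    using assms(1-7) by unfold_locales
  have "output_can_vanish lam n p m K L Ky Ly z0 \<longleftrightarrow> z0 \<in> L2_into n Vd" if "z0 \<in> state_space n" for z0
    using values_in_Vd_if_output_can_vanish output_can_vanish_if_values_in_Vd that
    unfolding Vd_def by blast
  moreover have "L2_into n Vd \<subseteq> state_space n" by (auto simp: L2_into_def)
  ultimately show ?thesis unfolding phs_output_nulling_def by blast
qed

end
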